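(* Let $m_1,m_2,m_3,l_1,l_2,l_3>0$ be fixed and let $k_2=0$. There exists $K_1$ such that for any $k_1>K_1$ there exists $\varepsilon=\varepsilon(k_1)>0$ such that for all $F\in\mathbb{R}$ with $|F|<\varepsilon$ there is a nonempty open set $W\subset\mathbb{R}^3$, invariant under the flow of the reduced system $$\dot\varphi_1=v_1,\qquad \dot v_1=\frac{A_{22}r_1-A_{12}r_2}{A_{11}A_{22}-A_{12}^2},\qquad \dot v_2=\frac{A_{11}r_2-A_{12}r_1}{A_{11}A_{22}-A_{12}^2}$$ with coordinates $(\varphi_1,v_1,v_2)$ and filled by non-constant periodic trajectories of it, such that: (1) the reduced system is integrable in $W$: there are two functionally independent smooth first integrals on $W$; (2) the full system, consisting of the reduced system together with the equation $\dot\varphi_2=v_2$, is, in the region $\{(\varphi_1,v_1,v_2)\in W\}$ of its four-dimensional phase space with coordinates $(\varphi_1,\varphi_2,v_1,v_2)$, integrable in the sense of the Jacobi theorem and integrable in a broad sense.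
   Context: These are the equations of the Ziegler pendulum with zero stiffness $k_2=0$ of the spring at the pivot. Here $$A_{11}=m_1l_1^2+m_3l_3^2,$$ $$A_{12}=m_1l_1^2+m_3l_3^2+(m_1l_1-m_3l_3)l_2\cos\varphi_1,$$ $$A_{22}=(m_1+m_2+m_3)l_2^2+m_1l_1^2+m_3l_3^2+2(m_1l_1-m_3l_3)l_2\cos\varphi_1,$$ $$r_1=-k_1\varphi_1-(m_1l_1-m_3l_3)l_2v_2^2\sin\varphi_1,$$ $$r_2=-Fl_2\sin\varphi_1+(m_1l_1-m_3l_3)l_2v_1(v_1+2v_2)\sin\varphi_1.$$ One has $A_{11}A_{22}-A_{12}^2>0$ everywhere. For the four-dimensional full system: it is integrable in the sense of the Jacobi theorem (in a region) if it has there two functionally independent smooth first integrals and a smooth invariant measure (smooth positive density); it is integrable in a broad sense if it has there two functionally independent smooth first integrals and a two-dimensional Lie algebra of symmetries that preserves these first integrals, namely the one spanned by two commuting, linearly independent vector fields: the vector field of the system itself and $\partial/\partial\varphi_2$. *)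

theory Defs
  imports "HOL-Analysis.Analysis"
begin

section \<open>Smooth maps and vector fields\<close>

text \<open>For open \<open>S\<close>, being \<open>n\<close> times continuously differentiable on \<open>S\<close>.\<close>

primrec higher_differentiable_on ::
  "'a::real_normed_vector set \<Rightarrow> ('a \<Rightarrow> 'b::real_normed_vector) \<Rightarrow> nat \<Rightarrow> bool" where
  "higher_differentiable_on S f 0 \<longleftrightarrow> continuous_on S f"
| "higher_differentiable_on S f (Suc n) \<longleftrightarrow>
     (\<forall>x\<in>S. f differentiable (at x)) \<and>
     (\<forall>v. higher_differentiable_on S (\<lambda>x. frechet_derivative f (at x) v) n)"

definition smooth_on ::
  "'a::real_normed_vector set \<Rightarrow> ('a \<Rightarrow> 'b::real_normed_vector) \<Rightarrow> bool" where
  "smooth_on S f \<longleftrightarrow> (\<forall>n. higher_differentiable_on S f n)"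

definition lie_bracket ::
  "('a::real_normed_vector \<Rightarrow> 'a) \<Rightarrow> ('a \<Rightarrow> 'a) \<Rightarrow> 'a \<Rightarrow> 'a" where
  "lie_bracket X Y p =
     frechet_derivative Y (at p) (X p) - frechet_derivative X (at p) (Y p)"

text \<open>A solution of \<open>x' = X x\<close> on an interval \<open>J\<close>, with one-sided derivatives at the
  endpoints that belong to \<open>J\<close>.\<close>

definition solution_on ::
  "('a::real_normed_vector \<Rightarrow> 'a) \<Rightarrow> real set \<Rightarrow> (real \<Rightarrow> 'a) \<Rightarrow> bool" where
  "solution_on X J x \<longleftrightarrow>
     is_interval J \<and> (\<forall>t\<in>J. (x has_vector_derivative X (x t)) (at t within J))"

definition flow_invariant :: "('a::real_normed_vector \<Rightarrow> 'a) \<Rightarrow> 'a set \<Rightarrow> bool" where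
  "flow_invariant X W \<longleftrightarrow>
     (\<forall>J x. solution_on X J x \<longrightarrow> (\<exists>s\<in>J. x s \<in> W) \<longrightarrow> x ` J \<subseteq> W)"

definition filled_by_nonconstant_periodic ::
  "('a::real_normed_vector \<Rightarrow> 'a) \<Rightarrow> 'a set \<Rightarrow> bool" where
  "filled_by_nonconstant_periodic X W \<longleftrightarrow>
     (\<forall>p\<in>W. \<exists>x T. solution_on X UNIV x \<and> x 0 = p \<and>
        T > 0 \<and> (\<forall>t. x (t + T) = x t) \<and> (\<exists>t. x t \<noteq> p))"

section \<open>Integrability\<close>

definition preserves_function ::
  "('a::real_normed_vector \<Rightarrow> 'a) \<Rightarrow> 'a set \<Rightarrow> ('a \<Rightarrow> real) \<Rightarrow> bool" where
  "preserves_function X U f \<longleftrightarrow>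
     (\<forall>J x. solution_on X J x \<longrightarrow> x ` J \<subseteq> U \<longrightarrow> (\<forall>s\<in>J. \<forall>t\<in>J. f (x s) = f (x t)))"

definition smooth_first_integral ::
  "('a::real_normed_vector \<Rightarrow> 'a) \<Rightarrow> 'a set \<Rightarrow> ('a \<Rightarrow> real) \<Rightarrow> bool" where
  "smooth_first_integral X U f \<longleftrightarrow> smooth_on U f \<and> preserves_function X U f"

text \<open>Independence is required at every point: the differentials of the two functions
  are linearly independent throughout \<open>U\<close>.\<close>

definition functionally_independent ::
  "'a::real_normed_vector set \<Rightarrow> ('a \<Rightarrow> real) \<Rightarrow> ('a \<Rightarrow> real) \<Rightarrow> bool" where
  "functionally_independent U f g \<longleftrightarrow>
     (\<forall>p\<in>U. \<forall>a b. (\<forall>h. a * frechet_derivative f (at p) h + b * frechet_derivative g (at p) h = 0)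
        \<longrightarrow> a = 0 \<and> b = 0)"

definition independent_first_integrals ::
  "('a::real_normed_vector \<Rightarrow> 'a) \<Rightarrow> 'a set \<Rightarrow> ('a \<Rightarrow> real) \<Rightarrow> ('a \<Rightarrow> real) \<Rightarrow> bool" where
  "independent_first_integrals X U f g \<longleftrightarrow>
     smooth_first_integral X U f \<and> smooth_first_integral X U g \<and> functionally_independent U f g"

text \<open>The measure with density \<open>\<rho>\<close> on \<open>U\<close> is invariant under the (possibly only locally
  defined) flow of \<open>X\<close>: whenever \<open>g\<close> is the time-\<open>t\<close> map on a Borel set \<open>D\<close> whose
  trajectories stay in \<open>U\<close> during \<open>{0..t}\<close>, the sets \<open>D\<close> and \<open>g ` D\<close> have the same measure.
  Negative times are covered by exchanging the roles of \<open>D\<close> and \<open>g ` D\<close>.\<close>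

definition smooth_invariant_measure ::
  "('a::euclidean_space \<Rightarrow> 'a) \<Rightarrow> 'a set \<Rightarrow> ('a \<Rightarrow> real) \<Rightarrow> bool" where
  "smooth_invariant_measure X U \<rho> \<longleftrightarrow>
     smooth_on U \<rho> \<and> (\<forall>p\<in>U. \<rho> p > 0) \<and>
     (\<forall>D t g. D \<in> sets borel \<longrightarrow> D \<subseteq> U \<longrightarrow> t \<ge> 0 \<longrightarrow>
        (\<forall>p\<in>D. \<exists>x. solution_on X {0..t} x \<and> x 0 = p \<and> x t = g p \<and> x ` {0..t} \<subseteq> U) \<longrightarrow>
        (\<integral>\<^sup>+p\<in>g ` D. ennreal (\<rho> p) \<partial>lborel) = (\<integral>\<^sup>+p\<in>D. ennreal (\<rho> p) \<partial>lborel))"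

definition jacobi_integrable :: "(real^4 \<Rightarrow> real^4) \<Rightarrow> (real^4) set \<Rightarrow> bool" where
  "jacobi_integrable X U \<longleftrightarrow>
     (\<exists>f g. independent_first_integrals X U f g) \<and> (\<exists>\<rho>. smooth_invariant_measure X U \<rho>)"

text \<open>The symmetry algebra is the span of \<open>X\<close> and \<open>Y\<close>. As the two fields commute and
  are pointwise linearly independent, it is an abelian Lie algebra of dimension two whose
  elements commute with \<open>X\<close>; that \<open>X\<close> preserves \<open>f\<close> and \<open>g\<close> is part of
  \<^const>\<open>independent_first_integrals\<close>.\<close>

definition broadly_integrable_with ::
  "(real^4 \<Rightarrow> real^4) \<Rightarrow> (real^4 \<Rightarrow> real^4) \<Rightarrow> (real^4) set \<Rightarrow> bool" where
  "broadly_integrable_with Y X U \<longleftrightarrow>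
     smooth_on U X \<and> smooth_on U Y \<and>
     (\<forall>p\<in>U. lie_bracket X Y p = 0) \<and>
     (\<forall>p\<in>U. \<forall>a b. a *\<^sub>R X p + b *\<^sub>R Y p = 0 \<longrightarrow> a = 0 \<and> b = 0) \<and>
     (\<exists>f g. independent_first_integrals X U f g \<and>
        preserves_function Y U f \<and> preserves_function Y U g)"

section \<open>The Ziegler pendulum with zero stiffness at the pivot\<close>

text \<open>Points of the reduced phase space are \<open>(\<phi>\<^sub>1, v\<^sub>1, v\<^sub>2)\<close>, points of the full phase
  space are \<open>(\<phi>\<^sub>1, \<phi>\<^sub>2, v\<^sub>1, v\<^sub>2)\<close>; both angles range over the real line.\<close>

definition ziegler_reduced ::
  "real \<Rightarrow> real \<Rightarrow> real \<Rightarrow> real \<Rightarrow> real \<Rightarrow> real \<Rightarrow> real \<Rightarrow> real \<Rightarrow> real^3 \<Rightarrow> real^3" where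
  "ziegler_reduced m1 m2 m3 l1 l2 l3 k1 F x =
     (let \<phi>1 = x $ 1; v1 = x $ 2; v2 = x $ 3;
          A11 = m1 * l1^2 + m3 * l3^2;
          A12 = m1 * l1^2 + m3 * l3^2 + (m1 * l1 - m3 * l3) * l2 * cos \<phi>1;
          A22 = (m1 + m2 + m3) * l2^2 + m1 * l1^2 + m3 * l3^2
                + 2 * (m1 * l1 - m3 * l3) * l2 * cos \<phi>1;
          r1 = - k1 * \<phi>1 - (m1 * l1 - m3 * l3) * l2 * v2^2 * sin \<phi>1;
          r2 = - F * l2 * sin \<phi>1 + (m1 * l1 - m3 * l3) * l2 * v1 * (v1 + 2 * v2) * sin \<phi>1
      in vector [v1,
                 (A22 * r1 - A12 * r2) / (A11 * A22 - A12^2),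
                 (A11 * r2 - A12 * r1) / (A11 * A22 - A12^2)])"

definition forget_phi2 :: "real^4 \<Rightarrow> real^3" where
  "forget_phi2 x = vector [x $ 1, x $ 3, x $ 4]"

definition ziegler_full ::
  "real \<Rightarrow> real \<Rightarrow> real \<Rightarrow> real \<Rightarrow> real \<Rightarrow> real \<Rightarrow> real \<Rightarrow> real \<Rightarrow> real^4 \<Rightarrow> real^4" where
  "ziegler_full m1 m2 m3 l1 l2 l3 k1 F x =
     (let y = ziegler_reduced m1 m2 m3 l1 l2 l3 k1 F (forget_phi2 x)
      in vector [y $ 1, x $ 4, y $ 2, y $ 3])"

definition d_phi2 :: "real^4 \<Rightarrow> real^4" where
  "d_phi2 x = axis 2 1"

end

theory Submission
  imports Defs "HOL-Complex_Analysis.Complex_Analysis"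
begin

text \<open>
  The reduced field is reversible: the reflection \<open>\<phi>\<^sub>1 \<mapsto> - \<phi>\<^sub>1\<close> followed by reversal of time maps
  solutions to solutions. Hence a trajectory that leaves the plane \<open>\<phi>\<^sub>1 = 0\<close> and meets it again
  is closed, its second half being the mirror image of the first. Close to the origin the spring
  dominates a small follower force, \<open>v\<^sub>1' \<le> - \<kappa>\<^sup>2 \<phi>\<^sub>1\<close> for \<open>\<phi>\<^sub>1 > 0\<close> (\<open>restoring_estimate\<close>), and
  Sturm comparison with \<open>y'' = - \<kappa>\<^sup>2 y\<close> brings every slow trajectory that starts on the half-plane
  \<open>\<phi>\<^sub>1 = 0 < v\<^sub>1\<close> back to the plane within time \<open>\<pi> / \<kappa>\<close> (\<open>half_period\<close>). The set \<open>W\<close> swept out by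
  these trajectories consists of periodic orbits, each of which crosses the half-plane in
  exactly one point (\<open>first_return\<close>). The map \<open>P\<close> that sends a point of \<open>W\<close> to this crossing is constant along
  trajectories, so the two free coordinates of \<open>P\<close> are first integrals. They are independent on the
  half-plane, where \<open>P\<close> is the identity, and the flow carries independence to all of \<open>W\<close>.

  Both gradients are orthogonal to the field \<open>X\<close>, so their cross product is \<open>\<lambda> X\<close> with a function \<open>\<lambda>\<close>
  without zeros. The flow transforms gradients by the transposed inverse of its derivative and \<open>X\<close>
  by the derivative itself; this forces \<open>\<bar>\<lambda>\<bar>\<close> to be an invariant density (\<open>lam_flow\<close>). As
  \<open>\<phi>\<^sub>2\<close> does not occur on the right-hand side of the full system, the integrals and the density lift
  to four dimensions, and \<open>\<partial>/\<partial>\<phi>\<^sub>2\<close> commutes with the full field.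

  The analytic core is the smoothness of \<open>P\<close>, that is, smooth dependence of solutions on their
  initial values. It is obtained by complexification. The field is the restriction of a holomorphic
  field \<open>Z\<close>; the iterates of the Euler map \<open>z \<mapsto> z + h Z z\<close> are holomorphic and converge uniformly
  to the complex flow; uniform limits of holomorphic functions are holomorphic
  (\<open>holo_on_uniform_limit\<close>), and so are their directional derivatives
  (\<open>holo_on_directional_derivative\<close>). Time maps are therefore real analytic (\<open>analytic_flow\<close>),
  and real analytic functions are closed under differentiation, hence smooth
  (\<open>real_analytic_imp_smooth\<close>). Near the half-plane, \<open>P\<close> is given by the time-one map of a suitably
  rescaled field (\<open>section_projection\<close>); elsewhere it is that local map composed with a time map of
  the flow.
\<close>

(* The symbol is left to vector components; otherwise terms of undetermined type are ambiguous. *)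
no_notation fps_nth (infixl "$" 75)

section \<open>Holomorphic functions of several complex variables\<close>

lemma norm_vec_cscale: "norm (c *s (v::complex^'n)) = cmod c * norm v"
  by (simp add: norm_vec_def L2_set_def norm_mult power_mult_distrib real_sqrt_mult
      flip: sum_distrib_left)

lemma bounded_linear_cscale_left: "bounded_linear (\<lambda>c::complex. c *s (v::complex^'n))"
  by (simp add: linear_conv_bounded_linear[symmetric] linear_iff vec_eq_iff algebra_simps)

text \<open>A Frechet derivative that is complex linear: this is holomorphy in several variables. Asking only for
  the first derivative makes compositions, products and quotients a matter of the chain rule;
  regularity of all orders is recovered below.\<close>

definition holo_on :: "(complex^'n) set \<Rightarrow> (complex^'n \<Rightarrow> complex) \<Rightarrow> bool" where
  "holo_on U F \<longleftrightarrow> (\<forall>z\<in>U. \<exists>F'. (F has_derivative F') (at z) \<and> (\<forall>c v. F' (c *s v) = c * F' v))"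

lemma holo_on_subset: "holo_on U F \<Longrightarrow> V \<subseteq> U \<Longrightarrow> holo_on V F"
  by (auto simp: holo_on_def)

lemma holo_on_continuous: "holo_on U F \<Longrightarrow> continuous_on U F"
  unfolding holo_on_def
  by (meson continuous_at_imp_continuous_on has_derivative_continuous)

lemma holo_on_frechet:
  assumes "holo_on U F" "z \<in> U"
  shows "(F has_derivative frechet_derivative F (at z)) (at z)"
    "frechet_derivative F (at z) (c *s v) = c * frechet_derivative F (at z) v"
proof -
  obtain F' where F': "(F has_derivative F') (at z)" "\<And>c v. F' (c *s v) = c * F' v"
    using assms unfolding holo_on_def by blast
  have "frechet_derivative F (at z) = F'" using F'(1) frechet_derivative_at by metis
  then show "(F has_derivative frechet_derivative F (at z)) (at z)"
    "frechet_derivative F (at z) (c *s v) = c * frechet_derivative F (at z) v"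
    using F' by auto
qed

text \<open>Restriction to complex lines is what gives access to the one-variable theory: Cauchy estimates on
  lines bound the full derivative, because every vector spans a line.\<close>

lemma holo_on_line:
  assumes "holo_on U F" "z + \<zeta> *s v \<in> U"
  shows "((\<lambda>\<zeta>. F (z + \<zeta> *s v)) has_field_derivative frechet_derivative F (at (z + \<zeta> *s v)) v) (at \<zeta>)"
proof -
  note F = holo_on_frechet[OF assms]
  have "((\<lambda>\<zeta>. z + \<zeta> *s v) has_derivative (\<lambda>c. c *s v)) (at \<zeta>)"
    using bounded_linear_imp_has_derivative[OF bounded_linear_cscale_left, of v "at \<zeta>"]
    by (auto intro!: derivative_eq_intros)
  from diff_chain_at[OF this F(1)]
  have "((\<lambda>\<zeta>. F (z + \<zeta> *s v)) has_derivative (\<lambda>c. c * frechet_derivative F (at (z + \<zeta> *s v)) v)) (at \<zeta>)"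
    by (simp add: o_def F(2))
  moreover have "(\<lambda>c. c * D) = (*) D" for D :: complex by (simp add: fun_eq_iff)
  ultimately show ?thesis
    unfolding has_field_derivative_def by simp
qed

lemma holo_on_line_holomorphic:
  assumes "holo_on U F" "\<And>\<zeta>. \<zeta> \<in> S \<Longrightarrow> z + \<zeta> *s v \<in> U"
  shows "(\<lambda>\<zeta>. F (z + \<zeta> *s v)) holomorphic_on S"
  using holo_on_line[OF assms(1)] assms(2)
  by (meson field_differentiable_at_within field_differentiable_def holomorphic_on_def)

lemma Cauchy_bound_ball:
  assumes "h holomorphic_on ball z \<rho>" "\<And>\<zeta>. \<zeta> \<in> ball z \<rho> \<Longrightarrow> cmod (h \<zeta>) \<le> M" "0 < r" "r < \<rho>"
  shows "cmod ((deriv ^^ n) h z) \<le> fact n * M / r ^ n"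
proof (rule Cauchy_inequality)
  have sub: "cball z r \<subseteq> ball z \<rho>" using assms(4) by auto
  show "h holomorphic_on ball z r" using assms sub by (meson ball_subset_cball holomorphic_on_subset subset_trans)
  show "continuous_on (cball z r) h" using assms(1) sub holomorphic_on_imp_continuous_on continuous_on_subset by blast
  show "norm (h x) \<le> M" if "norm (z - x) = r" for x
    using that assms(2)[of x] assms(4) by (simp add: dist_norm)
qed fact

text \<open>On the half-size disc Cauchy's inequality, applied on discs of radius \<open>\<rho> / 3\<close>, bounds the second
  derivative by \<open>2 M / (\<rho> / 3)\<^sup>2\<close>; this is the origin of the constant 18.\<close>

lemma Taylor1_bound:
  assumes h: "h holomorphic_on ball 0 \<rho>" "\<And>\<zeta>. \<zeta> \<in> ball 0 \<rho> \<Longrightarrow> cmod (h \<zeta>) \<le> M" "0 < \<rho>"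
    and w: "cmod w \<le> \<rho> / 2"
  shows "cmod (h w - h 0 - deriv h 0 * w) \<le> 18 * M / \<rho>\<^sup>2 * (cmod w)\<^sup>2"
proof -
  let ?S = "cball (0::complex) (\<rho>/2)"
  have S: "?S \<subseteq> ball 0 \<rho>" using h(3) by auto
  have d: "((deriv ^^ i) h has_field_derivative (deriv ^^ Suc i) h x) (at x within ?S)" if "x \<in> ?S" for i x
  proof -
    have "(deriv ^^ i) h holomorphic_on ball 0 \<rho>" using h(1) holomorphic_higher_deriv by blast
    then show ?thesis using that S
      by (metis (no_types, lifting) funpow.simps(2) has_field_derivative_at_within holomorphic_derivI in_mono o_apply open_ball)
  qed
  have B: "cmod ((deriv ^^ Suc 1) h x) \<le> 18 * M / \<rho>\<^sup>2" if x: "x \<in> ?S" for x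
  proof -
    have sub: "ball x (\<rho>/2) \<subseteq> ball 0 \<rho>"
    proof
      fix y assume "y \<in> ball x (\<rho>/2)"
      moreover have "dist 0 y \<le> dist 0 x + dist x y" by (rule dist_triangle)
      ultimately show "y \<in> ball 0 \<rho>" using x by simp
    qed
    have "cmod ((deriv ^^ Suc 1) h x) \<le> fact (Suc 1) * M / (\<rho>/3) ^ Suc 1"
      by (rule Cauchy_bound_ball[where \<rho>="\<rho>/2"]) (use h sub in \<open>auto intro: holomorphic_on_subset\<close>)
    also have "\<dots> = 18 * M / \<rho>\<^sup>2" by (simp add: power2_eq_square)
    finally show ?thesis .
  qed
  have "cmod ((deriv ^^ 0) h w - (\<Sum>i\<le>1. (deriv ^^ i) h 0 * (w - 0) ^ i / fact i))
     \<le> 18 * M / \<rho>\<^sup>2 * cmod (w - 0) ^ Suc 1 / fact 1"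
    by (rule complex_Taylor[where S="?S"]) (use d B w h(3) in \<open>auto simp del: funpow.simps\<close>)
  then show ?thesis by (simp add: algebra_simps power2_eq_square)
qed

lemma holo_on_deriv_line:
  assumes "holo_on (ball z r) F" "0 < r"
  shows "deriv (\<lambda>\<zeta>. F (z + \<zeta> *s v)) 0 = frechet_derivative F (at z) v"
  using holo_on_line[OF assms(1), of z 0 v] assms(2) by (simp add: DERIV_imp_deriv)

lemma unit_vector:
  fixes v :: "complex^'n"
  assumes "v \<noteq> 0"
  obtains u where "norm u = 1" "v = complex_of_real (norm v) *s u"
proof
  show "norm (complex_of_real (1 / norm v) *s v) = 1" using assms by (simp only: norm_vec_cscale) (simp add: norm_divide)
  show "v = complex_of_real (norm v) *s (complex_of_real (1 / norm v) *s v)"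
    using assms by (simp add: vec_eq_iff)
qed

lemma in_ball_line:
  fixes z :: "complex^'n" assumes "norm u = 1" "\<zeta> \<in> ball 0 r" shows "z + \<zeta> *s u \<in> ball z r"
  using assms by (simp add: dist_norm norm_vec_cscale)

lemma holo_on_Cauchy:
  assumes F: "holo_on (ball z r) F" "0 < r" and M: "\<And>w. w \<in> ball z r \<Longrightarrow> cmod (F w) \<le> M"
  shows "cmod (frechet_derivative F (at z) v) \<le> 2 * M / r * norm v"
proof (cases "v = 0")
  case True
  have "linear (frechet_derivative F (at z))"
    using holo_on_frechet(1)[OF F(1), of z] F(2) by (simp add: has_derivative_linear)
  then show ?thesis by (simp add: True linear_0)
next
  case False
  then obtain u where u: "norm u = 1" "v = complex_of_real (norm v) *s u" by (rule unit_vector)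
  have "cmod ((deriv ^^ 1) (\<lambda>\<zeta>. F (z + \<zeta> *s u)) 0) \<le> fact 1 * M / (r/2) ^ 1"
    by (rule Cauchy_bound_ball[where \<rho>=r])
      (use F M in_ball_line[OF u(1)] in \<open>auto intro!: holo_on_line_holomorphic\<close>)
  then have "cmod (frechet_derivative F (at z) u) \<le> 2 * M / r"
    by (simp add: holo_on_deriv_line[OF F] mult.commute)
  then have "norm v * cmod (frechet_derivative F (at z) u) \<le> norm v * (2 * M / r)"
    by (intro mult_left_mono) auto
  moreover have "frechet_derivative F (at z) v = complex_of_real (norm v) * frechet_derivative F (at z) u"
    using holo_on_frechet(2)[OF F(1), of z "complex_of_real (norm v)" u] F(2) u(2) by simp
  ultimately show ?thesis by (simp add: norm_mult mult.commute)
qed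

text \<open>The remainder is bounded by the supremum alone, with no reference to second derivatives of \<open>F\<close>.
  Such bounds survive uniform limits and identify derivatives as limits of difference quotients.\<close>

lemma holo_on_Taylor:
  assumes F: "holo_on (ball z r) F" "0 < r" and M: "\<And>w. w \<in> ball z r \<Longrightarrow> cmod (F w) \<le> M"
    and v: "norm v \<le> r / 2"
  shows "cmod (F (z + v) - F z - frechet_derivative F (at z) v) \<le> 18 * M / r\<^sup>2 * (norm v)\<^sup>2"
proof (cases "v = 0")
  case True
  have "linear (frechet_derivative F (at z))"
    using holo_on_frechet(1)[OF F(1), of z] F(2) by (simp add: has_derivative_linear)
  then show ?thesis by (simp add: True linear_0)
next
  case False
  then obtain u where u: "norm u = 1" "v = complex_of_real (norm v) *s u" by (rule unit_vector)
  let ?h = "\<lambda>\<zeta>. F (z + \<zeta> *s u)"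
  have "cmod (?h (norm v) - ?h 0 - deriv ?h 0 * norm v) \<le> 18 * M / r\<^sup>2 * (cmod (norm v))\<^sup>2"
    by (rule Taylor1_bound)
      (use F M v in_ball_line[OF u(1)] in \<open>auto intro!: holo_on_line_holomorphic\<close>)
  moreover have "frechet_derivative F (at z) v = complex_of_real (norm v) * frechet_derivative F (at z) u"
    using holo_on_frechet(2)[OF F(1), of z "complex_of_real (norm v)" u] F(2) u(2) by simp
  ultimately show ?thesis using u(2) by (simp add: holo_on_deriv_line[OF F] mult.commute)
qed

lemma has_derivative_quadratic:
  fixes F :: "'a::real_normed_vector \<Rightarrow> 'b::real_normed_vector"
  assumes L: "bounded_linear L" and \<delta>: "0 < \<delta>"
    and q: "\<And>v. norm v \<le> \<delta> \<Longrightarrow> norm (F (z + v) - F z - L v) \<le> C * (norm v)\<^sup>2"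
  shows "(F has_derivative L) (at z)"
  unfolding has_derivative_at_within
proof (intro conjI L)
  show "((\<lambda>y. (F y - F z - L (y - z)) /\<^sub>R norm (y - z)) \<longlongrightarrow> 0) (at z)"
  proof (rule Lim_null_comparison)
    show "\<forall>\<^sub>F y in at z. norm ((F y - F z - L (y - z)) /\<^sub>R norm (y - z)) \<le> C * norm (y - z)"
      unfolding eventually_at
    proof (intro exI[of _ \<delta>] conjI \<delta> ballI impI)
      fix y assume y: "y \<noteq> z \<and> dist y z < \<delta>"
      have "norm (F y - F z - L (y - z)) \<le> C * (norm (y - z))\<^sup>2"
        using q[of "y - z"] y by (simp add: dist_norm)
      then show "norm ((F y - F z - L (y - z)) /\<^sub>R norm (y - z)) \<le> C * norm (y - z)"
        using y by (simp add: power2_eq_square divide_simps)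
    qed
    have "((\<lambda>y. C * norm (y - z)) \<longlongrightarrow> C * norm (z - z)) (at z)"
      by (intro tendsto_intros)
    then show "((\<lambda>y. C * norm (y - z)) \<longlongrightarrow> 0) (at z)" by simp
  qed
qed

text \<open>Cauchy estimates for the differences show that the derivatives at a point converge; complex
  linearity passes to the limit, and so does the quadratic Taylor bound, which says that the limit
  of the derivatives is the derivative of the limit.\<close>

theorem holo_on_uniform_limit:
  assumes "open U" and F: "\<forall>\<^sub>F n in sequentially. holo_on U (F n)"
    and lim: "uniform_limit U F G sequentially"
  shows "holo_on U G"
  unfolding holo_on_def
proof
  fix z assume "z \<in> U"
  obtain r0 where r0: "r0 > 0" "ball z r0 \<subseteq> U" using \<open>open U\<close> \<open>z \<in> U\<close> openE by blast
  obtain N0 where N0: "\<And>n. n \<ge> N0 \<Longrightarrow> holo_on U (F n)"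
    using F unfolding eventually_sequentially by blast
  obtain N1 where N1: "\<And>n w. n \<ge> N1 \<Longrightarrow> w \<in> U \<Longrightarrow> dist (F n w) (G w) < 1"
    using uniform_limitD[OF lim, of 1] unfolding eventually_sequentially by auto
  define N where "N = max N0 N1"
  have hN: "holo_on U (F n)" if "n \<ge> N" for n using that N0 by (simp add: N_def)
  let ?r = "r0/2"
  have sub: "cball z ?r \<subseteq> U" using r0 by auto
  have subb: "ball z ?r \<subseteq> U" using sub ball_subset_cball by blast
  have hb: "holo_on (ball z ?r) (F n)" if "n \<ge> N" for n using hN[OF that] subb holo_on_subset by blast
  have "compact (F N ` cball z ?r)"
    by (intro compact_continuous_image continuous_on_subset[OF holo_on_continuous[OF hN] sub]) auto
  then obtain M0 where M0: "\<And>w. w \<in> cball z ?r \<Longrightarrow> cmod (F N w) \<le> M0"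
    using compact_imp_bounded bounded_iff by (metis imageI)
  define M where "M = M0 + 2"
  have M: "cmod (F n w) \<le> M" if "n \<ge> N" "w \<in> ball z ?r" for n w
  proof -
    have wU: "w \<in> U" using that subb by auto
    have "dist (F n w) (F N w) \<le> dist (F n w) (G w) + dist (F N w) (G w)"
      by (simp add: dist_triangle2)
    also have "\<dots> \<le> 2" using N1[of n w] N1[of N w] that wU by (simp add: N_def)
    finally have d: "cmod (F n w - F N w) \<le> 2" by (simp add: dist_norm)
    have "cmod (F N w) \<le> M0" using M0 that by auto
    then show ?thesis using norm_triangle_ineq[of "F n w - F N w" "F N w"] d by (simp add: M_def)
  qed
  let ?L = "\<lambda>n. frechet_derivative (F n) (at z)"
  have zb: "z \<in> ball z ?r" using r0 by simp
  have der: "(F n has_derivative ?L n) (at z)" if "n \<ge> N" for n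
    using holo_on_frechet(1)[OF hb[OF that] zb] .
  have conv: "\<exists>l. (\<lambda>n. ?L n v) \<longlonglongrightarrow> l" for v
  proof -
    have "Cauchy (\<lambda>n. ?L n v)"
    proof (rule metric_CauchyI)
      fix e :: real assume e: "e > 0"
      \<comment> \<open>Two members of the sequence differ by at most \<open>2 d\<close>, which the Cauchy estimate multiplies by
        \<open>2 / ?r\<close>; \<open>norm v + 1\<close> avoids division by zero.\<close>
      define d where "d = e * ?r / (8 * (norm v + 1))"
      have nv: "norm v + 1 > 0" by (smt (verit) norm_ge_zero)
      have d: "d > 0" using e r0 nv by (simp add: d_def)
      obtain K0 where K0: "\<And>n w. n \<ge> K0 \<Longrightarrow> w \<in> U \<Longrightarrow> dist (F n w) (G w) < d"
        using uniform_limitD[OF lim d] unfolding eventually_sequentially by auto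
      show "\<exists>K. \<forall>m\<ge>K. \<forall>n\<ge>K. dist (?L m v) (?L n v) < e"
      proof (intro exI allI impI)
        fix m n assume mn: "m \<ge> max N K0" "n \<ge> max N K0"
        let ?D = "\<lambda>w. F m w - F n w"
        have dD: "(?D has_derivative (\<lambda>v. frechet_derivative (F m) (at w) v - frechet_derivative (F n) (at w) v)) (at w)"
          if "w \<in> ball z ?r" for w
          using that mn by (intro has_derivative_diff holo_on_frechet(1)[OF hb]) auto
        have hD: "holo_on (ball z ?r) ?D"
          unfolding holo_on_def
        proof (intro ballI exI conjI allI)
          fix w c v assume w: "w \<in> ball z ?r"
          show "(?D has_derivative (\<lambda>v. frechet_derivative (F m) (at w) v - frechet_derivative (F n) (at w) v)) (at w)"
            using dD[OF w] .
          show "frechet_derivative (F m) (at w) (c *s v) - frechet_derivative (F n) (at w) (c *s v) =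
             c * (frechet_derivative (F m) (at w) v - frechet_derivative (F n) (at w) v)"
            using w mn holo_on_frechet(2)[OF hb[of m] w] holo_on_frechet(2)[OF hb[of n] w]
            by (simp add: algebra_simps)
        qed
        have "cmod (?D w) \<le> 2 * d" if "w \<in> ball z ?r" for w
        proof -
          have "w \<in> U" using that subb by auto
          then have "dist (F m w) (G w) < d" "dist (F n w) (G w) < d" using K0 mn by auto
          then have "dist (F m w) (F n w) \<le> 2 * d" by (smt (verit) dist_triangle2)
          then show ?thesis by (simp add: dist_norm)
        qed
        from holo_on_Cauchy[OF hD _ this] r0
        have "cmod (frechet_derivative ?D (at z) v) \<le> 2 * (2 * d) / ?r * norm v" by simp
        also have "frechet_derivative ?D (at z) v = ?L m v - ?L n v"
          using frechet_derivative_at[OF dD[OF zb]] by metis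
        also have "2 * (2 * d) / ?r * norm v \<le> 2 * (2 * d) / ?r * (norm v + 1)"
          using d r0 by (intro mult_left_mono) auto
        also have "\<dots> = e / 2 * ((norm v + 1) / (norm v + 1))" using r0 nv by (simp add: d_def divide_simps)
        also have "\<dots> = e / 2" using nv by simp
        also have "\<dots> < e" using e by simp
        finally show "dist (?L m v) (?L n v) < e" by (simp add: dist_norm)
      qed
    qed
    then show ?thesis using Cauchy_convergent convergent_def by blast
  qed
  define L where "L v = lim (\<lambda>n. ?L n v)" for v
  have Llim: "(\<lambda>n. ?L n v) \<longlonglongrightarrow> L v" for v
    using conv[of v] unfolding L_def by (metis limI)
  have ev: "\<forall>\<^sub>F n in sequentially. n \<ge> N" by (rule eventually_ge_at_top)
  have lin: "linear (?L n)" if "n \<ge> N" for n using der[OF that] has_derivative_linear by blast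
  have "linear L"
  proof (rule linearI)
    fix a b :: "complex^'a"
    have "(\<lambda>n. ?L n (a + b)) \<longlonglongrightarrow> L a + L b"
      by (rule Lim_transform_eventually[OF tendsto_add[OF Llim Llim]])
        (use ev in eventually_elim, simp add: lin linear_add)
    then show "L (a + b) = L a + L b" using Llim LIMSEQ_unique by blast
  next
    fix c and b :: "complex^'a"
    have "(\<lambda>n. ?L n (c *\<^sub>R b)) \<longlonglongrightarrow> c *\<^sub>R L b"
      by (rule Lim_transform_eventually[OF tendsto_scaleR[OF tendsto_const Llim]])
        (use ev in eventually_elim, simp add: lin linear_scale)
    then show "L (c *\<^sub>R b) = c *\<^sub>R L b" using Llim LIMSEQ_unique by blast
  qed
  then have bl: "bounded_linear L" by (simp add: linear_conv_bounded_linear)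
  have hom: "L (c *s v) = c * L v" for c v
  proof -
    have "(\<lambda>n. ?L n (c *s v)) \<longlonglongrightarrow> c * L v"
      by (rule Lim_transform_eventually[OF tendsto_mult[OF tendsto_const Llim]])
        (use ev in eventually_elim, simp add: holo_on_frechet(2)[OF hb zb])
    then show ?thesis using Llim LIMSEQ_unique by blast
  qed
  have pt: "(\<lambda>n. F n w) \<longlonglongrightarrow> G w" if "w \<in> U" for w using tendsto_uniform_limitI[OF lim that] .
  have "(G has_derivative L) (at z)"
  proof (rule has_derivative_quadratic[OF bl])
    show "0 < ?r / 2" using r0 by simp
    fix v :: "complex^'a" assume v: "norm v \<le> ?r / 2"
    have zv: "z + v \<in> U" using v subb r0 by (intro subsetD[OF subb]) (auto simp: dist_norm)
    have "(\<lambda>n. cmod (F n (z + v) - F n z - ?L n v)) \<longlonglongrightarrow> cmod (G (z + v) - G z - L v)"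
      by (intro tendsto_intros pt Llim zv \<open>z \<in> U\<close>)
    moreover have "\<forall>\<^sub>F n in sequentially. cmod (F n (z + v) - F n z - ?L n v) \<le> 18 * M / ?r\<^sup>2 * (norm v)\<^sup>2"
      using ev by eventually_elim (rule holo_on_Taylor[OF hb], use r0 M v in auto)
    ultimately show "cmod (G (z + v) - G z - L v) \<le> 18 * M / ?r\<^sup>2 * (norm v)\<^sup>2"
      by (rule tendsto_upperbound) simp
  qed
  then show "\<exists>F'. (G has_derivative F') (at z) \<and> (\<forall>c v. F' (c *s v) = c * F' v)" using hom by blast
qed

lemma has_derivative_vec_nth_iff:
  fixes G :: "'a::real_normed_vector \<Rightarrow> 'b::euclidean_space ^ 'n"
  shows "(G has_derivative G') F \<longleftrightarrow> (\<forall>i. ((\<lambda>x. G x $ i) has_derivative (\<lambda>h. G' h $ i)) F)"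
proof
  show "(G has_derivative G') F \<Longrightarrow> \<forall>i. ((\<lambda>x. G x $ i) has_derivative (\<lambda>h. G' h $ i)) F"
    by (auto intro: bounded_linear.has_derivative[OF bounded_linear_vec_nth])
  assume *: "\<forall>i. ((\<lambda>x. G x $ i) has_derivative (\<lambda>h. G' h $ i)) F"
  have bl: "bounded_linear (axis i :: 'b \<Rightarrow> 'b^'n)" for i
    by (simp add: linear_conv_bounded_linear[symmetric] linear_iff vec_eq_iff axis_def)
  have "((\<lambda>x. \<Sum>i\<in>UNIV. axis i (G x $ i)) has_derivative (\<lambda>h. \<Sum>i\<in>UNIV. axis i (G' h $ i))) F"
    using * by (intro has_derivative_sum bounded_linear.has_derivative[OF bl]) auto
  moreover have "(\<Sum>i\<in>UNIV. axis i (v $ i)) = v" for v :: "'b^'n"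
    by (simp add: vec_eq_iff axis_def if_distrib cong: if_cong)
  ultimately show "(G has_derivative G') F" by simp
qed

lemma holo_onI:
  assumes "\<And>z. z \<in> U \<Longrightarrow> (F has_derivative F' z) (at z)" "\<And>z c v. z \<in> U \<Longrightarrow> F' z (c *s v) = c * F' z v"
  shows "holo_on U F"
  using assms unfolding holo_on_def by blast

lemma holo_on_const: "holo_on U (\<lambda>z. c)"
  by (rule holo_onI[where F'="\<lambda>_ _. 0"]) auto

lemma holo_on_nth: "holo_on U (\<lambda>z. z $ i)"
  by (rule holo_onI[where F'="\<lambda>_ v. v $ i"])
    (auto intro: bounded_linear_imp_has_derivative bounded_linear_vec_nth)

lemma holo_on_add: "holo_on U F \<Longrightarrow> holo_on U G \<Longrightarrow> holo_on U (\<lambda>z. F z + G z)"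
  by (rule holo_onI[where F'="\<lambda>z v. frechet_derivative F (at z) v + frechet_derivative G (at z) v"])
    (auto intro!: has_derivative_add holo_on_frechet simp: holo_on_frechet(2) algebra_simps)

lemma holo_on_mult:
  assumes "holo_on U F" "holo_on U G"
  shows "holo_on U (\<lambda>z. F z * G z)"
proof (rule holo_onI)
  fix z assume z: "z \<in> U"
  show "((\<lambda>z. F z * G z) has_derivative
      (\<lambda>v. F z * frechet_derivative G (at z) v + frechet_derivative F (at z) v * G z)) (at z)"
    by (intro has_derivative_mult holo_on_frechet(1)[OF _ z] assms)
qed (simp add: holo_on_frechet(2)[OF assms(1)] holo_on_frechet(2)[OF assms(2)] algebra_simps)

lemma holo_on_diff: "holo_on U F \<Longrightarrow> holo_on U G \<Longrightarrow> holo_on U (\<lambda>z. F z - G z)"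
  using holo_on_add[of U F "\<lambda>z. -1 * G z"] holo_on_mult[OF holo_on_const, of U G "-1"] by simp

lemma holo_on_compose_holomorphic:
  assumes "holo_on U F" "h holomorphic_on A" "open A" "F ` U \<subseteq> A"
  shows "holo_on U (\<lambda>z. h (F z))"
proof (rule holo_onI)
  fix z assume z: "z \<in> U"
  then have "F z \<in> A" using assms(4) by auto
  then have "(h has_field_derivative deriv h (F z)) (at (F z))" using assms(2,3) holomorphic_derivI by blast
  then have "(h has_derivative (\<lambda>w. deriv h (F z) * w)) (at (F z))"
    unfolding has_field_derivative_def by simp
  from diff_chain_at[OF holo_on_frechet(1)[OF assms(1) z] this]
  show "((\<lambda>z. h (F z)) has_derivative (\<lambda>v. deriv h (F z) * frechet_derivative F (at z) v)) (at z)"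
    by (simp add: o_def)
  show "\<And>c v. deriv h (F z) * frechet_derivative F (at z) (c *s v) = c * (deriv h (F z) * frechet_derivative F (at z) v)"
    by (simp add: holo_on_frechet(2)[OF assms(1) z])
qed

lemma holo_on_compose:
  fixes G :: "complex^'n \<Rightarrow> complex^'m"
  assumes "holo_on V F" "\<And>i. holo_on U (\<lambda>z. G z $ i)" "G ` U \<subseteq> V"
  shows "holo_on U (\<lambda>z. F (G z))"
proof (rule holo_onI)
  fix z assume z: "z \<in> U"
  then have Gz: "G z \<in> V" using assms(3) by auto
  let ?G' = "\<lambda>v. \<chi> i. frechet_derivative (\<lambda>z. G z $ i) (at z) v"
  have "(G has_derivative ?G') (at z)"
    unfolding has_derivative_vec_nth_iff using holo_on_frechet(1)[OF assms(2) z] by simp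
  from diff_chain_at[OF this holo_on_frechet(1)[OF assms(1) Gz]]
  show "((\<lambda>z. F (G z)) has_derivative (\<lambda>v. frechet_derivative F (at (G z)) (?G' v))) (at z)"
    by (simp add: o_def)
  have "?G' (c *s v) = c *s ?G' v" for c v
    by (simp add: vec_eq_iff holo_on_frechet(2)[OF assms(2) z])
  then show "\<And>c v. frechet_derivative F (at (G z)) (?G' (c *s v)) = c * frechet_derivative F (at (G z)) (?G' v)"
    by (simp add: holo_on_frechet(2)[OF assms(1) Gz])
qed

lemma holo_on_local:
  assumes "\<And>z. z \<in> U \<Longrightarrow> \<exists>V. z \<in> V \<and> holo_on V F"
  shows "holo_on U F"
  using assms unfolding holo_on_def by blast

text \<open>The directional derivative is the limit of the holomorphic difference quotients
  \<open>n (F (z + v / n) - F z)\<close>, locally uniform by the Taylor bound.\<close>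

theorem holo_on_directional_derivative:
  assumes "open U" "holo_on U F"
  shows "holo_on U (\<lambda>z. frechet_derivative F (at z) v)"
proof (rule holo_on_local)
  fix z assume "z \<in> U"
  then obtain r where r: "r > 0" "cball z r \<subseteq> U" using assms(1) open_contains_cball by blast
  have "compact (F ` cball z r)"
    by (intro compact_continuous_image continuous_on_subset[OF holo_on_continuous[OF assms(2)] r(2)]) auto
  then obtain M where M: "\<And>w. w \<in> cball z r \<Longrightarrow> cmod (F w) \<le> M"
    using compact_imp_bounded bounded_iff by (metis imageI)
  have M0: "0 \<le> M" using M[of z] r by (smt (verit) centre_in_cball norm_ge_zero)
  let ?V = "ball z (r/2)"
  have sub: "ball w (r/2) \<subseteq> cball z r" if "w \<in> ?V" for w
  proof
    fix y assume "y \<in> ball w (r/2)"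
    moreover have "dist z y \<le> dist z w + dist w y" by (rule dist_triangle)
    ultimately show "y \<in> cball z r" using that by simp
  qed
  have hV: "holo_on ?V F"
    using r by (intro holo_on_subset[OF assms(2)]) auto
  have hw: "holo_on (ball w (r/2)) F" if "w \<in> ?V" for w
    using holo_on_subset[OF assms(2)] sub[OF that] r(2) by blast
  define Q where "Q n w = of_nat n * (F (w + (1 / real n) *\<^sub>R v) - F w)" for n :: nat and w
  obtain N :: nat where N: "4 * norm v / r + 1 \<le> real N" using real_arch_simple by blast
  have nb: "n > 0" "norm ((1 / real n) *\<^sub>R v) \<le> r/4" if "n \<ge> N" for n
  proof -
    have n: "4 * norm v / r + 1 \<le> real n" using N that by linarith
    moreover have "4 * norm v / r \<ge> 0" using r by simp
    ultimately show "n > 0" by (cases n) auto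
    show "norm ((1 / real n) *\<^sub>R v) \<le> r/4"
    proof -
      have "4 * norm v / r \<le> real n" using n by linarith
      then show ?thesis using r \<open>n > 0\<close> by (simp add: field_simps)
    qed
  qed
  have "holo_on ?V (\<lambda>w. frechet_derivative F (at w) v)"
  proof (rule holo_on_uniform_limit)
    show "open ?V" by simp
    show "\<forall>\<^sub>F n in sequentially. holo_on ?V (Q n)"
      using eventually_ge_at_top[of N]
    proof eventually_elim
      case (elim n)
      have im: "(\<lambda>w. w + (1 / real n) *\<^sub>R v) ` ?V \<subseteq> U"
      proof safe
        fix w assume "w \<in> ?V"
        moreover have "w + (1 / real n) *\<^sub>R v \<in> ball w (r/2)"
        proof -
          have "norm ((1 / real n) *\<^sub>R v) < r/2" using nb(2)[OF elim] r(1) by linarith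
          then show ?thesis by (simp add: dist_norm del: norm_scaleR)
        qed
        ultimately show "w + (1 / real n) *\<^sub>R v \<in> U" using sub r(2) by blast
      qed
      have t: "holo_on ?V (\<lambda>w. (w + (1 / real n) *\<^sub>R v) $ i)" for i
        using holo_on_add[OF holo_on_nth holo_on_const] by simp
      show "holo_on ?V (Q n)"
        unfolding Q_def
        by (intro holo_on_mult holo_on_const holo_on_diff holo_on_compose[OF assms(2) t im] hV)
    qed
    show "uniform_limit ?V Q (\<lambda>w. frechet_derivative F (at w) v) sequentially"
    proof (rule uniform_limitI)
      fix e :: real assume e: "e > 0"
      define C where "C = 18 * M / (r/2)\<^sup>2 * (norm v)\<^sup>2"
      have C0: "C \<ge> 0" using M0 by (simp add: C_def)
      obtain K :: nat where K: "C / e + 1 \<le> real K" using real_arch_simple by blast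
      show "\<forall>\<^sub>F n in sequentially. \<forall>w\<in>?V. dist (Q n w) (frechet_derivative F (at w) v) < e"
        using eventually_ge_at_top[of "max N K"]
      proof eventually_elim
        case (elim n)
        then have n: "n \<ge> N" "n \<ge> K" by auto
        note n0 = nb(1)[OF n(1)]
        show ?case
        proof
          fix w assume w: "w \<in> ?V"
          let ?u = "(1 / real n) *\<^sub>R v"
          have lin: "linear (frechet_derivative F (at w))"
            using holo_on_frechet(1)[OF hw[OF w], of w] r by (simp add: has_derivative_linear)
          have "cmod (F (w + ?u) - F w - frechet_derivative F (at w) ?u) \<le> 18 * M / (r/2)\<^sup>2 * (norm ?u)\<^sup>2"
            by (rule holo_on_Taylor[OF hw[OF w]]) (use r nb(2)[OF n(1)] sub[OF w] M in auto)
          also have "\<dots> = C / real n ^ 2" using n0 by (simp add: C_def power_divide power_mult_distrib)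
          finally have "real n * cmod (F (w + ?u) - F w - frechet_derivative F (at w) ?u) \<le> real n * (C / real n ^ 2)"
            by (intro mult_left_mono) auto
          also have "real n * cmod (F (w + ?u) - F w - frechet_derivative F (at w) ?u)
            = cmod (of_nat n * (F (w + ?u) - F w - frechet_derivative F (at w) ?u))"
            by (simp add: norm_mult)
          also have "of_nat n * (F (w + ?u) - F w - frechet_derivative F (at w) ?u) = Q n w - frechet_derivative F (at w) v"
            using n0 by (simp add: Q_def linear_scale[OF lin] algebra_simps scaleR_conv_of_real[where 'a=complex])
          also have "real n * (C / real n ^ 2) = C / real n" using n0 by (simp add: power2_eq_square)
          also have "C / real n < e"
          proof -
            have "C / e < real n" using K n(2) by linarith
            then show ?thesis using e n0 by (simp add: field_simps)
          qed
          finally show "dist (Q n w) (frechet_derivative F (at w) v) < e" by (simp add: dist_norm)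
        qed
      qed
    qed
  qed
  then show "\<exists>V. z \<in> V \<and> holo_on V (\<lambda>z. frechet_derivative F (at z) v)" using r by (intro exI[of _ ?V]) auto
qed

section \<open>Real analytic functions\<close>

definition cvec :: "real^'n \<Rightarrow> complex^'n" where
  "cvec p = (\<chi> i. of_real (p $ i))"

lemma cvec_nth [simp]: "cvec p $ i = of_real (p $ i)"
  by (simp add: cvec_def)

lemma norm_cvec [simp]: "norm (cvec p) = norm p"
  by (simp add: norm_vec_def)

lemma linear_cvec: "linear cvec"
  by (simp add: linear_iff vec_eq_iff complex_eq_iff)

lemmas cvec_diff = linear_diff[OF linear_cvec]
lemmas bounded_linear_cvec = linear_cvec[unfolded linear_conv_bounded_linear]

lemma dist_cvec [simp]: "dist (cvec p) (cvec q) = dist p q"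
  by (simp add: dist_norm flip: cvec_diff)

text \<open>Analyticity expressed by a local holomorphic extension instead of a power series: closure properties
  are then inherited from those of holomorphic functions.\<close>

definition real_analytic_on :: "(real^'n) set \<Rightarrow> (real^'n \<Rightarrow> real) \<Rightarrow> bool" where
  "real_analytic_on U f \<longleftrightarrow>
     (\<forall>p\<in>U. \<exists>r>0. \<exists>F. holo_on (ball (cvec p) r) F \<and> (\<forall>q\<in>ball p r. F (cvec q) = of_real (f q)))"

lemma real_analytic_onE:
  assumes "real_analytic_on U f" "p \<in> U"
  obtains r F where "r > 0" "holo_on (ball (cvec p) r) F" "\<forall>q\<in>ball p r. F (cvec q) = of_real (f q)"
  using assms unfolding real_analytic_on_def by blast

lemma real_analytic_onI:
  assumes "\<And>p. p \<in> U \<Longrightarrow> \<exists>r>0. \<exists>F. holo_on (ball (cvec p) r) F \<and> (\<forall>q\<in>ball p r. F (cvec q) = of_real (f q))"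
  shows "real_analytic_on U f"
  using assms unfolding real_analytic_on_def by blast

lemma real_analytic_on_subset: "real_analytic_on U f \<Longrightarrow> V \<subseteq> U \<Longrightarrow> real_analytic_on V f"
  by (auto simp: real_analytic_on_def)

lemma real_analytic_on_local:
  assumes "\<And>p. p \<in> U \<Longrightarrow> \<exists>V g. open V \<and> p \<in> V \<and> real_analytic_on V g \<and> (\<forall>q\<in>V. g q = f q)"
  shows "real_analytic_on U f"
proof (rule real_analytic_onI)
  fix p assume "p \<in> U"
  from assms[OF this] obtain V g where V: "open V" "p \<in> V" "real_analytic_on V g" "\<forall>q\<in>V. g q = f q"
    by (elim exE conjE)
  obtain r F where rF: "r > 0" "holo_on (ball (cvec p) r) F" "\<forall>q\<in>ball p r. F (cvec q) = of_real (g q)"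
    by (rule real_analytic_onE[OF V(3,2)])
  obtain e where e: "e > 0" "ball p e \<subseteq> V" using openE[OF V(1,2)] .
  show "\<exists>r>0. \<exists>F. holo_on (ball (cvec p) r) F \<and> (\<forall>q\<in>ball p r. F (cvec q) = of_real (f q))"
  proof (intro exI[of _ "min r e"] exI[of _ F] conjI holo_on_subset[OF rF(2)] ballI)
    fix q assume q: "q \<in> ball p (min r e)"
    then have "q \<in> V" using e(2) by auto
    then show "F (cvec q) = of_real (f q)" using rF(3) q V(4) by simp
  qed (use rF(1) e(1) in auto)
qed

lemma real_analytic_on_cong:
  assumes "open U" "real_analytic_on U f" "\<And>q. q \<in> U \<Longrightarrow> f q = g q"
  shows "real_analytic_on U g"
  by (rule real_analytic_on_local, intro exI[of _ U] exI[of _ f]) (use assms in simp)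

lemma real_analytic_on_const: "real_analytic_on U (\<lambda>p. c)"
  by (intro real_analytic_onI exI[of _ 1] exI[of _ "\<lambda>z. of_real c"]) (auto intro: holo_on_const)

lemma real_analytic_on_nth: "real_analytic_on U (\<lambda>p. p $ i)"
  by (intro real_analytic_onI exI[of _ 1] exI[of _ "\<lambda>z. z $ i"]) (auto intro: holo_on_nth)

lemma real_analytic_on_binary:
  fixes f g :: "real^'n \<Rightarrow> real"
  assumes "real_analytic_on U f" "real_analytic_on U g"
    and H: "\<And>(V :: (complex^'n) set) F G. holo_on V F \<Longrightarrow> holo_on V G \<Longrightarrow> holo_on V (\<lambda>z. H (F z) (G z))"
    and H_real: "\<And>a b. H (complex_of_real a) (of_real b) = of_real (h a b)"
  shows "real_analytic_on U (\<lambda>p. h (f p) (g p))"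
proof (rule real_analytic_onI)
  fix p assume p: "p \<in> U"
  obtain r F where rF: "r > 0" "holo_on (ball (cvec p) r) F" "\<forall>q\<in>ball p r. F (cvec q) = of_real (f q)"
    by (rule real_analytic_onE[OF assms(1) p])
  obtain s G where sG: "s > 0" "holo_on (ball (cvec p) s) G" "\<forall>q\<in>ball p s. G (cvec q) = of_real (g q)"
    by (rule real_analytic_onE[OF assms(2) p])
  show "\<exists>r>0. \<exists>F. holo_on (ball (cvec p) r) F \<and> (\<forall>q\<in>ball p r. F (cvec q) = of_real (h (f q) (g q)))"
  proof (intro exI[of _ "min r s"] exI[of _ "\<lambda>z. H (F z) (G z)"] conjI ballI)
    show "holo_on (ball (cvec p) (min r s)) (\<lambda>z. H (F z) (G z))"
      by (intro H holo_on_subset[OF rF(2)] holo_on_subset[OF sG(2)]) auto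
  qed (use rF sG H_real in auto)
qed

lemma real_analytic_on_add: "real_analytic_on U f \<Longrightarrow> real_analytic_on U g \<Longrightarrow> real_analytic_on U (\<lambda>p. f p + g p)"
  by (erule (1) real_analytic_on_binary[where H="(+)"]) (auto intro: holo_on_add)

lemma real_analytic_on_diff: "real_analytic_on U f \<Longrightarrow> real_analytic_on U g \<Longrightarrow> real_analytic_on U (\<lambda>p. f p - g p)"
  by (erule (1) real_analytic_on_binary[where H="(-)"]) (auto intro: holo_on_diff)

lemma real_analytic_on_mult: "real_analytic_on U f \<Longrightarrow> real_analytic_on U g \<Longrightarrow> real_analytic_on U (\<lambda>p. f p * g p)"
  by (erule (1) real_analytic_on_binary[where H="(*)"]) (auto intro: holo_on_mult)

lemma real_analytic_on_minus: "real_analytic_on U f \<Longrightarrow> real_analytic_on U (\<lambda>p. - f p)"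
  using real_analytic_on_mult[OF real_analytic_on_const[of U "-1"]] by simp

lemma real_analytic_on_power: "real_analytic_on U f \<Longrightarrow> real_analytic_on U (\<lambda>p. f p ^ n)"
  by (induction n) (simp_all add: real_analytic_on_const real_analytic_on_mult)

lemma real_analytic_on_compose_holomorphic:
  assumes f: "real_analytic_on U f" and h: "h holomorphic_on A" "open A"
    and A: "\<And>p. p \<in> U \<Longrightarrow> complex_of_real (f p) \<in> A"
    and k: "\<And>x. complex_of_real x \<in> A \<Longrightarrow> h (of_real x) = of_real (k x)"
  shows "real_analytic_on U (\<lambda>p. k (f p))"
proof (rule real_analytic_onI)
  fix p assume p: "p \<in> U"
  obtain r F where rF: "r > 0" "holo_on (ball (cvec p) r) F" "\<forall>q\<in>ball p r. F (cvec q) = of_real (f q)"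
    by (rule real_analytic_onE[OF f p])
  have "open (ball (cvec p) r \<inter> F -` A)"
    using continuous_open_preimage[OF holo_on_continuous[OF rF(2)] _ h(2)] by simp
  moreover have "cvec p \<in> ball (cvec p) r \<inter> F -` A" using rF A[OF p] by simp
  ultimately obtain e where e: "e > 0" "ball (cvec p) e \<subseteq> ball (cvec p) r \<inter> F -` A"
    by (meson openE)
  have cq: "F (cvec q) \<in> A \<and> q \<in> ball p r" if "q \<in> ball p e" for q
  proof -
    have "cvec q \<in> ball (cvec p) e" using that by simp
    then have "cvec q \<in> ball (cvec p) r \<inter> F -` A" using e(2) by blast
    then show ?thesis by simp
  qed
  show "\<exists>r>0. \<exists>F. holo_on (ball (cvec p) r) F \<and> (\<forall>q\<in>ball p r. F (cvec q) = of_real (k (f q)))"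
  proof (intro exI conjI ballI)
    show "e > 0" by fact
    show "holo_on (ball (cvec p) e) (\<lambda>z. h (F z))"
      by (rule holo_on_compose_holomorphic[OF _ h]) (use e holo_on_subset[OF rF(2)] in auto)
    show "h (F (cvec q)) = of_real (k (f q))" if "q \<in> ball p e" for q
      using cq[OF that] rF(3) k by auto
  qed
qed

lemma real_analytic_on_sin: "real_analytic_on U f \<Longrightarrow> real_analytic_on U (\<lambda>p. sin (f p))"
  by (erule real_analytic_on_compose_holomorphic[where A=UNIV and h=sin]) (simp_all add: holomorphic_on_sin sin_of_real)

lemma real_analytic_on_cos: "real_analytic_on U f \<Longrightarrow> real_analytic_on U (\<lambda>p. cos (f p))"
  by (erule real_analytic_on_compose_holomorphic[where A=UNIV and h=cos]) (simp_all add: holomorphic_on_cos cos_of_real)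

lemma real_analytic_on_divide:
  assumes "real_analytic_on U f" "real_analytic_on U g" "\<And>p. p \<in> U \<Longrightarrow> g p \<noteq> 0"
  shows "real_analytic_on U (\<lambda>p. f p / g p)"
proof -
  have "real_analytic_on U (\<lambda>p. inverse (g p))"
    by (rule real_analytic_on_compose_holomorphic[OF assms(2), where A="- {0}" and h=inverse])
      (use assms(3) in \<open>auto intro: holomorphic_on_inverse[OF holomorphic_on_ident]\<close>)
  from real_analytic_on_mult[OF assms(1) this] show ?thesis by (simp add: field_simps)
qed

lemma real_analytic_on_sqrt:
  assumes "real_analytic_on U f" "\<And>p. p \<in> U \<Longrightarrow> f p > 0"
  shows "real_analytic_on U (\<lambda>p. sqrt (f p))"
  by (rule real_analytic_on_compose_holomorphic[OF assms(1), where A="- \<real>\<^sub>\<le>\<^sub>0" and h=csqrt])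
    (use assms(2) in \<open>auto intro: holomorphic_on_csqrt simp: complex_nonpos_Reals_iff not_le\<close>)

lemma real_analytic_on_compose:
  fixes f :: "real^'n \<Rightarrow> real^'m"
  assumes g: "real_analytic_on V g" and f: "\<And>i. real_analytic_on U (\<lambda>p. f p $ i)" and fU: "f ` U \<subseteq> V"
  shows "real_analytic_on U (\<lambda>p. g (f p))"
proof (rule real_analytic_onI)
  fix p assume p: "p \<in> U"
  then have fp: "f p \<in> V" using fU by auto
  obtain s G where sG: "s > 0" "holo_on (ball (cvec (f p)) s) G" "\<forall>q\<in>ball (f p) s. G (cvec q) = of_real (g q)"
    by (rule real_analytic_onE[OF g fp])
  have "\<forall>i. \<exists>r>0. \<exists>F. holo_on (ball (cvec p) r) F \<and> (\<forall>q\<in>ball p r. F (cvec q) = of_real (f q $ i))"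
    using f p unfolding real_analytic_on_def by blast
  then obtain r F where r: "\<And>i. r i > 0" and F: "\<And>i. holo_on (ball (cvec p) (r i)) (F i)"
    "\<And>i q. q \<in> ball p (r i) \<Longrightarrow> F i (cvec q) = of_real (f q $ i)" by metis
  define e where "e = Min (range r)"
  have e: "e > 0" "\<And>i. e \<le> r i" using r by (auto simp: e_def)
  let ?F = "\<lambda>z. \<chi> i. F i z"
  have Fh: "holo_on (ball (cvec p) e) (\<lambda>z. ?F z $ i)" for i
    using holo_on_subset[OF F(1)[of i], of "ball (cvec p) e"] e(2)[of i] by (simp add: ball_subset_ball_iff)
  have Fr: "?F (cvec q) = cvec (f q)" if "q \<in> ball p e" for q
  proof -
    have "q \<in> ball p (r i)" for i using that e(2)[of i] by auto
    then show ?thesis by (simp add: vec_eq_iff F(2))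
  qed
  have "continuous_on (ball (cvec p) e) ?F"
    using holo_on_continuous[OF Fh] by (simp add: continuous_on_vec_lambda)
  then have "open (ball (cvec p) e \<inter> ?F -` ball (cvec (f p)) s)"
    by (intro continuous_open_preimage) auto
  moreover have "cvec p \<in> ball (cvec p) e \<inter> ?F -` ball (cvec (f p)) s" using sG(1) e Fr[of p] by simp
  ultimately obtain d where d: "d > 0" "ball (cvec p) d \<subseteq> ball (cvec p) e \<inter> ?F -` ball (cvec (f p)) s"
    by (meson openE)
  have cq: "f q \<in> ball (f p) s \<and> q \<in> ball p e" if "q \<in> ball p d" for q
  proof -
    have "cvec q \<in> ball (cvec p) d" using that by simp
    then have *: "cvec q \<in> ball (cvec p) e \<inter> ?F -` ball (cvec (f p)) s" using d(2) by blast
    then have "q \<in> ball p e" by simp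
    with Fr[OF this] * show ?thesis by simp
  qed
  show "\<exists>r>0. \<exists>F. holo_on (ball (cvec p) r) F \<and> (\<forall>q\<in>ball p r. F (cvec q) = of_real (g (f q)))"
  proof (intro exI conjI ballI)
    show "d > 0" by fact
    show "holo_on (ball (cvec p) d) (\<lambda>z. G (?F z))"
    proof (rule holo_on_compose[OF sG(2)])
      show "holo_on (ball (cvec p) d) (\<lambda>z. ?F z $ i)" for i
        by (rule holo_on_subset[OF Fh]) (use d(2) in blast)
      show "?F ` ball (cvec p) d \<subseteq> ball (cvec (f p)) s" using d(2) by blast
    qed
    show "G (?F (cvec q)) = of_real (g (f q))" if "q \<in> ball p d" for q
      using cq[OF that] sG(3) Fr by auto
  qed
qed

text \<open>The derivative of the extension extends the derivative. It is real on real vectors because the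
  extension has real values on real points.\<close>

lemma real_analytic_on_derivative_extension:
  assumes "r > 0" "holo_on (ball (cvec p) r) F" "\<forall>q\<in>ball p r. F (cvec q) = of_real (f q)"
    and q: "q \<in> ball p r"
  shows "f differentiable (at q)"
    "frechet_derivative F (at (cvec q)) (cvec v) = of_real (frechet_derivative f (at q) v)"
proof -
  let ?F' = "frechet_derivative F (at (cvec q))"
  have cq: "cvec q \<in> ball (cvec p) r" using q by simp
  have "((\<lambda>q. F (cvec q)) has_derivative (\<lambda>v. ?F' (cvec v))) (at q)"
    using diff_chain_at[OF bounded_linear_imp_has_derivative[OF bounded_linear_cvec] holo_on_frechet(1)[OF assms(2) cq]]
    by (simp add: o_def)
  then have c: "((\<lambda>q. complex_of_real (f q)) has_derivative (\<lambda>v. ?F' (cvec v))) (at q)"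
    by (rule has_derivative_transform_within_open[OF _ open_ball q]) (use assms(3) in auto)
  have R: "(f has_derivative (\<lambda>v. Re (?F' (cvec v)))) (at q)"
    using bounded_linear.has_derivative[OF bounded_linear_Re c] by simp
  then show "f differentiable (at q)" unfolding differentiable_def by blast
  have fr: "frechet_derivative f (at q) = (\<lambda>v. Re (?F' (cvec v)))" by (rule frechet_derivative_at[OF R, symmetric])
  have "((\<lambda>q. complex_of_real (f q)) has_derivative (\<lambda>v. of_real (Re (?F' (cvec v))))) (at q)"
    by (rule bounded_linear.has_derivative[OF bounded_linear_of_real R])
  from fun_cong[OF has_derivative_unique[OF c this], of v]
  show "?F' (cvec v) = of_real (frechet_derivative f (at q) v)" unfolding fr .
qed

lemma real_analytic_on_differentiable:
  assumes "real_analytic_on U f" "p \<in> U"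
  shows "f differentiable (at p)"
proof -
  obtain r F where rF: "r > 0" "holo_on (ball (cvec p) r) F" "\<forall>q\<in>ball p r. F (cvec q) = of_real (f q)"
    by (rule real_analytic_onE[OF assms])
  have "p \<in> ball p r" using rF(1) by simp
  show ?thesis by (rule real_analytic_on_derivative_extension(1)[OF rF \<open>p \<in> ball p r\<close>])
qed

lemma real_analytic_on_has_derivative:
  assumes "real_analytic_on U f" "p \<in> U"
  shows "(f has_derivative frechet_derivative f (at p)) (at p)"
  using real_analytic_on_differentiable[OF assms] frechet_derivative_works by blast

lemma real_analytic_on_continuous: "real_analytic_on U f \<Longrightarrow> continuous_on U f"
  by (intro continuous_at_imp_continuous_on ballI differentiable_imp_continuous_within real_analytic_on_differentiable)

theorem real_analytic_on_directional_derivative: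
  assumes "real_analytic_on U f"
  shows "real_analytic_on U (\<lambda>p. frechet_derivative f (at p) v)"
proof (rule real_analytic_onI)
  fix p assume p: "p \<in> U"
  obtain r F where rF: "r > 0" "holo_on (ball (cvec p) r) F" "\<forall>q\<in>ball p r. F (cvec q) = of_real (f q)"
    by (rule real_analytic_onE[OF assms p])
  show "\<exists>r>0. \<exists>F. holo_on (ball (cvec p) r) F \<and> (\<forall>q\<in>ball p r. F (cvec q) = of_real (frechet_derivative f (at q) v))"
  proof (intro exI conjI ballI)
    show "holo_on (ball (cvec p) r) (\<lambda>z. frechet_derivative F (at z) (cvec v))"
      by (rule holo_on_directional_derivative[OF open_ball rF(2)])
    show "frechet_derivative F (at (cvec q)) (cvec v) = of_real (frechet_derivative f (at q) v)"
      if "q \<in> ball p r" for q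
      by (rule real_analytic_on_derivative_extension(2)[OF rF that])
  qed (rule rF(1))
qed

lemma real_analytic_vec_continuous:
  fixes f :: "real^'n \<Rightarrow> real^'m"
  assumes "\<And>i. real_analytic_on U (\<lambda>p. f p $ i)"
  shows "continuous_on U f"
proof -
  have "continuous_on U (\<lambda>p. \<chi> i. f p $ i)"
    by (rule continuous_on_vec_lambda) (rule real_analytic_on_continuous[OF assms])
  then show ?thesis by simp
qed

lemma real_analytic_vec_has_derivative:
  fixes f :: "real^'n \<Rightarrow> real^'m"
  assumes "\<And>i. real_analytic_on U (\<lambda>p. f p $ i)" "p \<in> U"
  shows "(f has_derivative frechet_derivative f (at p)) (at p)"
proof -
  have "(f has_derivative (\<lambda>v. \<chi> j. frechet_derivative (\<lambda>p. f p $ j) (at p) v)) (at p)"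
    unfolding has_derivative_vec_nth_iff using real_analytic_on_has_derivative[OF assms] by simp
  then show ?thesis using frechet_derivative_at by metis
qed

text \<open>Analytic functions are differentiable with analytic directional derivatives, so the recursion in
  \<^const>\<open>higher_differentiable_on\<close> never leaves the class.\<close>

theorem real_analytic_imp_smooth:
  fixes f :: "real^'n \<Rightarrow> 'b::euclidean_space"
  assumes U: "open U" and "\<And>b. b \<in> Basis \<Longrightarrow> real_analytic_on U (\<lambda>x. f x \<bullet> b)"
  shows "smooth_on U f"
proof -
  have "higher_differentiable_on U f n" for n
    using assms(2)
  proof (induction n arbitrary: f)
    case 0
    have "continuous_on U (\<lambda>x. f x \<bullet> b)" if "b \<in> Basis" for b
      by (rule real_analytic_on_continuous[OF 0[OF that]])
    then show ?case by (simp add: continuous_on_componentwise[of U f])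
  next
    case (Suc n)
    have d: "f differentiable (at x)" if "x \<in> U" for x
      unfolding differentiable_componentwise_within[of f x UNIV]
      using real_analytic_on_differentiable[OF Suc.prems that] by blast
    have fr: "frechet_derivative f (at x) v \<bullet> b = frechet_derivative (\<lambda>x. f x \<bullet> b) (at x) v"
      if "x \<in> U" for x v b
    proof -
      have "(f has_derivative frechet_derivative f (at x)) (at x)"
        using d[OF that] frechet_derivative_works by blast
      then have "((\<lambda>x. f x \<bullet> b) has_derivative (\<lambda>v. frechet_derivative f (at x) v \<bullet> b)) (at x)"
        by (rule has_derivative_inner_left)
      from frechet_derivative_at[OF this] show ?thesis by metis
    qed
    show ?case
      unfolding higher_differentiable_on.simps
    proof (intro conjI ballI allI d Suc.IH)
      fix v b :: 'b and w assume b: "b \<in> Basis"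
      have *: "real_analytic_on U (\<lambda>x. frechet_derivative (\<lambda>x. f x \<bullet> b) (at x) w)"
        by (rule real_analytic_on_directional_derivative[OF Suc.prems[OF b]])
      show "real_analytic_on U (\<lambda>x. frechet_derivative f (at x) w \<bullet> b)"
        by (rule real_analytic_on_cong[OF U *]) (simp add: fr)
    qed
  qed
  then show ?thesis by (simp add: smooth_on_def)
qed

section \<open>Lipschitz vector fields and the Euler scheme\<close>

text \<open>The function \<open>\<bar>d\<bar>\<^sup>2 exp (- 2 L u)\<close> does not increase.\<close>

lemma gronwall_forward:
  fixes d :: "real \<Rightarrow> 'a::real_inner"
  assumes "a \<le> b"
    and d: "\<And>u. u \<in> {a..b} \<Longrightarrow> (d has_vector_derivative d' u) (at u within {a..b})"
    and L: "\<And>u. u \<in> {a..b} \<Longrightarrow> norm (d' u) \<le> L * norm (d u)"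
  shows "norm (d b) \<le> exp (L * (b - a)) * norm (d a)"
proof -
  let ?w = "\<lambda>u. (d u \<bullet> d u) * exp (- 2 * L * (u - a))"
  have "?w b \<le> ?w a"
  proof (rule DERIV_nonpos_imp_decreasing_open[OF \<open>a \<le> b\<close>])
    have "continuous_on {a..b} d"
      using d by (meson continuous_on_vector_derivative)
    then show "continuous_on {a..b} ?w" by (intro continuous_intros)
    fix u assume u: "a < u" "u < b"
    then have "(d has_vector_derivative d' u) (at u)"
      using d[of u] by (simp add: at_within_Icc_at)
    then have dd: "(d has_derivative (\<lambda>h. h *\<^sub>R d' u)) (at u)" by (simp add: has_vector_derivative_def)
    have "((\<lambda>u. d u \<bullet> d u) has_derivative (\<lambda>h. d u \<bullet> (h *\<^sub>R d' u) + (h *\<^sub>R d' u) \<bullet> d u)) (at u)"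
      by (rule has_derivative_inner[OF dd dd])
    then have "((\<lambda>u. d u \<bullet> d u) has_real_derivative 2 * (d u \<bullet> d' u)) (at u)"
      unfolding has_field_derivative_def
      by (rule has_derivative_eq_rhs) (auto simp: fun_eq_iff inner_commute)
    then have D: "(?w has_real_derivative 2 * (d u \<bullet> d' u) * exp (- 2 * L * (u - a)) +
         (d u \<bullet> d u) * (exp (- 2 * L * (u - a)) * (- 2 * L))) (at u)"
      by (auto intro!: derivative_eq_intros)
    have "d u \<bullet> d' u \<le> norm (d u) * norm (d' u)" by (rule norm_cauchy_schwarz)
    also have "\<dots> \<le> norm (d u) * (L * norm (d u))"
      using L[of u] u by (intro mult_left_mono) auto
    also have "\<dots> = L * (d u \<bullet> d u)" by (simp add: power2_norm_eq_inner[symmetric] power2_eq_square)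
    finally have "(2 * (d u \<bullet> d' u) - 2 * L * (d u \<bullet> d u)) * exp (- 2 * L * (u - a)) \<le> 0"
      by (intro mult_nonpos_nonneg) auto
    then show "\<exists>y. (?w has_real_derivative y) (at u) \<and> y \<le> 0"
      using D by (intro exI conjI) (auto simp: algebra_simps)
  qed
  then have "(norm (d b))\<^sup>2 * exp (- 2 * L * (b - a)) \<le> (norm (d a))\<^sup>2"
    by (simp add: power2_norm_eq_inner)
  then have "((norm (d b))\<^sup>2 * exp (- 2 * L * (b - a))) * exp (2 * L * (b - a)) \<le> (norm (d a))\<^sup>2 * exp (2 * L * (b - a))"
    by (rule mult_right_mono) simp
  also have "((norm (d b))\<^sup>2 * exp (- 2 * L * (b - a))) * exp (2 * L * (b - a)) = (norm (d b))\<^sup>2"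
    by (simp add: mult.assoc flip: exp_add)
  also have "(norm (d a))\<^sup>2 * exp (2 * L * (b - a)) = (exp (L * (b - a)) * norm (d a))\<^sup>2"
    by (simp add: power_mult_distrib exp_double[symmetric] mult.assoc mult.commute)
  finally show ?thesis by (rule power2_le_imp_le) simp
qed

lemma gronwall:
  fixes d :: "real \<Rightarrow> 'a::real_inner"
  assumes J: "is_interval J" "s \<in> J" "t \<in> J"
    and d: "\<And>u. u \<in> J \<Longrightarrow> (d has_vector_derivative d' u) (at u within J)"
    and L: "\<And>u. u \<in> J \<Longrightarrow> norm (d' u) \<le> L * norm (d u)"
  shows "norm (d t) \<le> exp (L * \<bar>t - s\<bar>) * norm (d s)"
proof (cases "s \<le> t")
  case True
  have sub: "{s..t} \<subseteq> J" using J by (meson atLeastAtMost_iff is_interval_1 subsetI)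
  have "norm (d t) \<le> exp (L * (t - s)) * norm (d s)"
    by (rule gronwall_forward[OF True, where d'=d'])
      (use sub in \<open>auto intro!: L has_vector_derivative_within_subset[OF d]\<close>)
  then show ?thesis using True by simp
next
  case False
  have sub: "{t..s} \<subseteq> J" using J by (meson atLeastAtMost_iff is_interval_1 subsetI)
  have "norm (d (- (- t))) \<le> exp (L * (- t - (- s))) * norm (d (- (- s)))"
  proof (rule gronwall_forward[where d="\<lambda>u. d (- u)" and d'="\<lambda>u. - d' (- u)"])
    fix u assume u: "u \<in> {- s..- t}"
    have im: "uminus ` {- s..- t} = {t..s}" by auto
    have "(d has_vector_derivative d' (- u)) (at (- u) within uminus ` {- s..- t})"
      unfolding im by (rule has_vector_derivative_within_subset[OF d]) (use u sub in auto)
    moreover have "(uminus has_vector_derivative (-1)) (at u within {- s..- t})"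
      by (auto intro!: derivative_eq_intros)
    ultimately show "((\<lambda>u. d (- u)) has_vector_derivative - d' (- u)) (at u within {- s..- t})"
      using vector_diff_chain_within[of uminus "-1" u "{- s..- t}" d "d' (- u)"] by (simp add: o_def)
    show "norm (- d' (- u)) \<le> L * norm (d (- u))"
      using L[OF subsetD[OF sub, of "- u"]] u by simp
  qed (use False in auto)
  then show ?thesis using False by simp
qed

text \<open>A mean value inequality in which the bound depends on the distance to time zero, in both
  directions of time; the majorant \<open>P\<close> is exponential in the proof of global existence and linear
  elsewhere.\<close>

lemma two_sided_mvt_bound:
  fixes f :: "real \<Rightarrow> 'a::real_normed_vector"
  assumes f: "\<And>u. \<bar>u\<bar> \<le> \<bar>t\<bar> \<Longrightarrow> (f has_vector_derivative f' u) (at u)"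
    and P: "\<And>u. u \<ge> 0 \<Longrightarrow> (P has_vector_derivative P' u) (at u)"
    and B: "\<And>u. \<bar>u\<bar> \<le> \<bar>t\<bar> \<Longrightarrow> norm (f' u) \<le> P' \<bar>u\<bar>"
  shows "norm (f t - f 0) \<le> P \<bar>t\<bar> - P 0"
proof -
  have *: "norm (g \<bar>t\<bar> - g 0) \<le> P \<bar>t\<bar> - P 0"
    if g: "\<And>u. 0 \<le> u \<Longrightarrow> u \<le> \<bar>t\<bar> \<Longrightarrow> (g has_vector_derivative g' u) (at u)"
      and Bg: "\<And>u. 0 \<le> u \<Longrightarrow> u \<le> \<bar>t\<bar> \<Longrightarrow> norm (g' u) \<le> P' u" for g g' :: "real \<Rightarrow> 'a"
  proof (cases "t = 0")
    case False
    show ?thesis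
    proof (rule differentiable_bound_general[where f'=g' and \<phi>'=P'])
      show "continuous_on {0..\<bar>t\<bar>} g"
        by (intro continuous_at_imp_continuous_on ballI has_vector_derivative_continuous) (use g in auto)
      show "continuous_on {0..\<bar>t\<bar>} P"
        by (intro continuous_at_imp_continuous_on ballI has_vector_derivative_continuous) (use P in auto)
    qed (use False g P Bg in auto)
  qed simp
  show ?thesis
  proof (cases "t \<ge> 0")
    case True
    have "norm (f \<bar>t\<bar> - f 0) \<le> P \<bar>t\<bar> - P 0"
    proof (rule *[of f f'])
      show "norm (f' u) \<le> P' u" if "0 \<le> u" "u \<le> \<bar>t\<bar>" for u using B[of u] that by simp
    qed (use f in auto)
    then show ?thesis using True by simp
  next
    case False
    have "norm (f (- \<bar>t\<bar>) - f (- 0)) \<le> P \<bar>t\<bar> - P 0"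
    proof (rule *[of "\<lambda>u. f (- u)" "\<lambda>u. - f' (- u)"])
      fix u assume u: "0 \<le> u" "u \<le> \<bar>t\<bar>"
      have "(f has_vector_derivative f' (- u)) (at (- u))" by (rule f) (use u in auto)
      moreover have "(uminus has_vector_derivative (-1)) (at u)"
        by (auto intro!: derivative_eq_intros)
      ultimately show "((\<lambda>u. f (- u)) has_vector_derivative - f' (- u)) (at u)"
        using vector_diff_chain_at[of uminus "-1" u f "f' (- u)"] by (simp add: o_def)
      show "norm (- f' (- u)) \<le> P' u" using B[of "- u"] u by simp
    qed
    then show ?thesis using False by simp
  qed
qed

lemma antiderivative_exists:
  fixes h :: "real \<Rightarrow> 'a::euclidean_space"
  assumes "continuous_on UNIV h"
  obtains I where "I 0 = 0" "\<And>t. (I has_vector_derivative h t) (at t)"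
proof (rule that[of "\<lambda>u. LBINT y=ereal 0..ereal u. h y"])
  let ?I = "\<lambda>u. LBINT y=ereal 0..ereal u. h y"
  show "?I 0 = 0" by (simp add: interval_integral_endpoints_same)
  fix t :: real
  have "(?I has_vector_derivative h t) (at t within {- \<bar>t\<bar> - 1..\<bar>t\<bar> + 1})"
    by (rule interval_integral_FTC2) (use assms continuous_on_subset in auto)
  then show "(?I has_vector_derivative h t) (at t)" by (simp add: at_within_Icc_at)
qed

text \<open>For a globally Lipschitz field the Picard operator is a contraction on the whole time axis if growth
  like \<open>exp (K \<bar>t\<bar>)\<close> with \<open>K > 2 L\<close> is divided out. The fixed point is therefore sought as
  \<open>p + exp (K \<bar>t\<bar>) g(t)\<close> with \<open>g\<close> bounded and continuous.\<close>

lemma Picard_global: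
  fixes F :: "'a::euclidean_space \<Rightarrow> 'a"
  assumes lip: "\<And>x y. norm (F x - F y) \<le> L * norm (x - y)"
  shows "\<exists>x. x 0 = p \<and> (\<forall>t. (x has_vector_derivative F (x t)) (at t))"
proof -
  define K where "K = 2 * (\<bar>L\<bar> + 1)"
  have K: "K > 0" "\<bar>L\<bar> / K \<le> 1/2" by (auto simp: K_def field_simps)
  have lip': "norm (F x - F y) \<le> \<bar>L\<bar> * norm (x - y)" for x y
    using lip[of x y] by (smt (verit) mult_right_mono norm_ge_zero abs_ge_self)
  have "\<bar>L\<bar>-lipschitz_on UNIV F"
    by (rule lipschitz_onI) (use lip' in \<open>auto simp: dist_norm\<close>)
  then have contF: "continuous_on UNIV F" by (rule lipschitz_on_continuous_on)
  define X :: "(real \<Rightarrow>\<^sub>C 'a) \<Rightarrow> real \<Rightarrow> 'a" where "X g s = p + exp (K * \<bar>s\<bar>) *\<^sub>R apply_bcontfun g s" for g s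
  have contX: "continuous_on UNIV (\<lambda>s. F (X g s))" for g
    unfolding X_def by (intro continuous_on_compose2[OF contF] continuous_intros) auto
  have "\<exists>I. I 0 = 0 \<and> (\<forall>t. (I has_vector_derivative F (X g t)) (at t))" for g
    using antiderivative_exists[OF contX] by metis
  then obtain I where I: "\<And>g. I g 0 = 0" "\<And>g t. (I g has_vector_derivative F (X g t)) (at t)" by metis
  have Pd: "((\<lambda>u. C / K * exp (K * u)) has_vector_derivative C * exp (K * u)) (at u)" for C u
    using K by (auto intro!: derivative_eq_intros simp: has_real_derivative_iff_has_vector_derivative[symmetric])
  have Ibound: "norm (I g t) \<le> (norm (F p) + \<bar>L\<bar> * norm g) / K * exp (K * \<bar>t\<bar>)" for g t
  proof -
    let ?C = "norm (F p) + \<bar>L\<bar> * norm g"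
    have "norm (I g t - I g 0) \<le> ?C / K * exp (K * \<bar>t\<bar>) - ?C / K * exp (K * 0)"
    proof (rule two_sided_mvt_bound[OF I(2) Pd])
      fix u :: real
      have "norm (F (X g u)) \<le> norm (F p) + norm (F (X g u) - F p)" by (metis add.commute norm_triangle_sub)
      also have "\<dots> \<le> norm (F p) + \<bar>L\<bar> * (exp (K * \<bar>u\<bar>) * norm (apply_bcontfun g u))"
        using lip'[of "X g u" p] by (simp add: X_def)
      also have "\<dots> \<le> norm (F p) * exp (K * \<bar>u\<bar>) + \<bar>L\<bar> * (exp (K * \<bar>u\<bar>) * norm g)"
      proof (intro add_mono mult_left_mono)
        show "norm (F p) \<le> norm (F p) * exp (K * \<bar>u\<bar>)"
          using mult_left_mono[of 1 "exp (K * \<bar>u\<bar>)" "norm (F p)"] K by simp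
        show "norm (apply_bcontfun g u) \<le> norm g" by (rule norm_bounded)
      qed auto
      finally show "norm (F (X g u)) \<le> ?C * exp (K * \<bar>u\<bar>)" by (simp add: algebra_simps)
    qed
    moreover have "?C / K * exp (K * 0) \<ge> 0" using K by simp
    ultimately show ?thesis using I(1) by simp
  qed
  have cancel: "exp (- K * a) * (C * exp (K * a)) = C" for C a :: real by (simp add: exp_minus)
  define T where "T g = Bcontfun (\<lambda>t. exp (- K * \<bar>t\<bar>) *\<^sub>R I g t)" for g
  have Tb: "(\<lambda>t. exp (- K * \<bar>t\<bar>) *\<^sub>R I g t) \<in> bcontfun" for g
  proof (rule bcontfun_normI)
    have "continuous_on UNIV (I g)"
      by (intro continuous_at_imp_continuous_on ballI has_vector_derivative_continuous[OF I(2)])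
    then show "continuous_on UNIV (\<lambda>t. exp (- K * \<bar>t\<bar>) *\<^sub>R I g t)" by (intro continuous_intros)
    fix t
    have "exp (- K * \<bar>t\<bar>) * norm (I g t) \<le> exp (- K * \<bar>t\<bar>) * ((norm (F p) + \<bar>L\<bar> * norm g) / K * exp (K * \<bar>t\<bar>))"
      by (rule mult_left_mono[OF Ibound]) simp
    also have "\<dots> = (norm (F p) + \<bar>L\<bar> * norm g) / K" by (rule cancel)
    finally show "norm (exp (- K * \<bar>t\<bar>) *\<^sub>R I g t) \<le> (norm (F p) + \<bar>L\<bar> * norm g) / K" by simp
  qed
  have Tapp: "apply_bcontfun (T g) t = exp (- K * \<bar>t\<bar>) *\<^sub>R I g t" for g t
    unfolding T_def Bcontfun_inverse[OF Tb] ..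
  have "dist (T g) (T g') \<le> 1/2 * dist g g'" for g g'
  proof (rule dist_bound)
    fix t
    let ?C = "\<bar>L\<bar> * dist g g'"
    have "norm ((I g t - I g' t) - (I g 0 - I g' 0)) \<le> ?C / K * exp (K * \<bar>t\<bar>) - ?C / K * exp (K * 0)"
    proof (rule two_sided_mvt_bound[where f="\<lambda>t. I g t - I g' t", OF has_vector_derivative_diff[OF I(2) I(2)] Pd])
      fix u :: real
      have "norm (F (X g u) - F (X g' u)) \<le> \<bar>L\<bar> * norm (X g u - X g' u)" by (rule lip')
      also have "X g u - X g' u = exp (K * \<bar>u\<bar>) *\<^sub>R (apply_bcontfun g u - apply_bcontfun g' u)"
        by (simp add: X_def algebra_simps)
      also have "norm \<dots> = exp (K * \<bar>u\<bar>) * dist (apply_bcontfun g u) (apply_bcontfun g' u)" by (simp add: dist_norm)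
      also have "\<bar>L\<bar> * (exp (K * \<bar>u\<bar>) * dist (apply_bcontfun g u) (apply_bcontfun g' u))
         \<le> \<bar>L\<bar> * (exp (K * \<bar>u\<bar>) * dist g g')"
        by (intro mult_left_mono dist_bounded) auto
      finally show "norm (F (X g u) - F (X g' u)) \<le> ?C * exp (K * \<bar>u\<bar>)" by (simp add: algebra_simps)
    qed
    moreover have "?C / K * exp (K * 0) \<ge> 0" using K by simp
    ultimately have "norm (I g t - I g' t) \<le> ?C / K * exp (K * \<bar>t\<bar>)" using I(1) by simp
    then have "exp (- K * \<bar>t\<bar>) * norm (I g t - I g' t) \<le> exp (- K * \<bar>t\<bar>) * (?C / K * exp (K * \<bar>t\<bar>))"
      by (rule mult_left_mono) simp
    also have "\<dots> = \<bar>L\<bar> / K * dist g g'" by (simp add: exp_minus field_simps)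
    also have "\<dots> \<le> 1/2 * dist g g'" by (rule mult_right_mono[OF K(2)]) simp
    finally show "dist (apply_bcontfun (T g) t) (apply_bcontfun (T g') t) \<le> 1/2 * dist g g'"
      unfolding Tapp dist_norm by (simp flip: scaleR_diff_right)
  qed
  then have "\<exists>!g. T g = g" by (intro banach_fix_type[of "1/2"]) auto
  then obtain g where g: "T g = g" by blast
  have X: "X g t = p + I g t" for t
    unfolding X_def using Tapp[of g t] g by (simp add: exp_minus)
  show ?thesis
  proof (intro exI conjI allI)
    show "X g 0 = p" using X[of 0] I(1) by simp
    fix t
    have "((\<lambda>t. p + I g t) has_vector_derivative F (X g t)) (at t)"
      using has_vector_derivative_add[OF has_vector_derivative_const I(2)] by simp
    moreover have "X g = (\<lambda>t. p + I g t)" using X by (simp add: fun_eq_iff)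
    ultimately show "(X g has_vector_derivative F (X g t)) (at t)" by simp
  qed
qed

lemma lipschitz_flow:
  fixes F :: "'a::euclidean_space \<Rightarrow> 'a"
  assumes lip: "\<And>x y. norm (F x - F y) \<le> L * norm (x - y)"
  obtains \<Phi> where "\<And>p. \<Phi> 0 p = p" "\<And>t p. ((\<lambda>t. \<Phi> t p) has_vector_derivative F (\<Phi> t p)) (at t)"
    "\<And>s t p. \<Phi> (s + t) p = \<Phi> s (\<Phi> t p)"
    "\<And>t p q. norm (\<Phi> t p - \<Phi> t q) \<le> exp (L * \<bar>t\<bar>) * norm (p - q)"
proof -
  have "\<exists>x. x 0 = p \<and> (\<forall>t. (x has_vector_derivative F (x t)) (at t))" for p
    by (rule Picard_global[OF lip])
  then obtain \<Phi>' where \<Phi>': "\<And>p. \<Phi>' p 0 = p" "\<And>p t. (\<Phi>' p has_vector_derivative F (\<Phi>' p t)) (at t)" by metis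
  have stab: "norm (x t - y t) \<le> exp (L * \<bar>t\<bar>) * norm (x 0 - y 0)"
    if "\<And>t. (x has_vector_derivative F (x t)) (at t)" "\<And>t. (y has_vector_derivative F (y t)) (at t)" for x y t
  proof -
    have "norm (x t - y t) \<le> exp (L * \<bar>t - 0\<bar>) * norm (x 0 - y 0)"
      by (rule gronwall[of UNIV 0 t "\<lambda>t. x t - y t" "\<lambda>t. F (x t) - F (y t)"])
        (auto intro: has_vector_derivative_diff that lip)
    then show ?thesis by simp
  qed
  show ?thesis
  proof (rule that[of "\<lambda>t p. \<Phi>' p t"])
    fix s t p
    have sh: "((\<lambda>s. \<Phi>' p (s + t)) has_vector_derivative F (\<Phi>' p (s + t))) (at s)" for s
    proof -
      have "((\<lambda>s. s + t) has_vector_derivative 1) (at s)" by (auto intro!: derivative_eq_intros)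
      from vector_diff_chain_at[OF this \<Phi>'(2)] show ?thesis by (simp add: o_def)
    qed
    have "norm (\<Phi>' p (s + t) - \<Phi>' (\<Phi>' p t) s) \<le> exp (L * \<bar>s\<bar>) * norm (\<Phi>' p (0 + t) - \<Phi>' (\<Phi>' p t) 0)"
      by (rule stab[of "\<lambda>s. \<Phi>' p (s + t)" "\<Phi>' (\<Phi>' p t)" s, OF sh \<Phi>'(2)])
    then show "\<Phi>' p (s + t) = \<Phi>' (\<Phi>' p t) s" by (simp add: \<Phi>'(1))
  next
    fix t p q
    show "norm (\<Phi>' p t - \<Phi>' q t) \<le> exp (L * \<bar>t\<bar>) * norm (p - q)"
      using stab[OF \<Phi>'(2) \<Phi>'(2), of p t q] by (simp add: \<Phi>'(1))
  qed (rule \<Phi>')+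
qed

lemma vector_derivative_bound_line:
  fixes x :: "real \<Rightarrow> 'a::real_normed_vector"
  assumes "\<And>u. \<bar>u\<bar> \<le> \<bar>h\<bar> \<Longrightarrow> (x has_vector_derivative x' u) (at u)" "\<And>u. \<bar>u\<bar> \<le> \<bar>h\<bar> \<Longrightarrow> norm (x' u) \<le> B"
  shows "norm (x h - x 0) \<le> B * \<bar>h\<bar>"
proof -
  have "((\<lambda>u. B * u) has_vector_derivative B) (at u)" for u
    by (auto intro!: derivative_eq_intros simp: has_real_derivative_iff_has_vector_derivative[symmetric])
  from two_sided_mvt_bound[OF assms(1) this assms(2)] show ?thesis by simp
qed

lemma Euler_step_bound:
  fixes F :: "'a::euclidean_space \<Rightarrow> 'a"
  assumes lip: "\<And>x y. norm (F x - F y) \<le> L * norm (x - y)" and L: "L \<ge> 0"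
    and M: "\<And>x. norm (F x) \<le> M"
    and x: "\<And>t. (x has_vector_derivative F (x t)) (at t)"
  shows "norm (x h - x 0 - h *\<^sub>R F (x 0)) \<le> L * M * h\<^sup>2"
proof -
  have 1: "norm (x u - x 0) \<le> M * \<bar>u\<bar>" for u
    by (rule vector_derivative_bound_line[OF x]) (rule M)
  have d: "((\<lambda>u. x u - u *\<^sub>R F (x 0)) has_vector_derivative F (x u) - F (x 0)) (at u)" for u
    by (auto intro!: derivative_eq_intros x)
  have M0: "M \<ge> 0" using M[of 0] norm_ge_zero order_trans by blast
  have "norm ((x h - h *\<^sub>R F (x 0)) - (x 0 - 0 *\<^sub>R F (x 0))) \<le> (L * (M * \<bar>h\<bar>)) * \<bar>h\<bar>"
  proof (rule vector_derivative_bound_line[where x="\<lambda>u. x u - u *\<^sub>R F (x 0)", OF d])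
    fix u assume u: "\<bar>u\<bar> \<le> \<bar>h\<bar>"
    have "norm (F (x u) - F (x 0)) \<le> L * norm (x u - x 0)" by (rule lip)
    also have "\<dots> \<le> L * (M * \<bar>h\<bar>)"
      using 1[of u] u M0 L by (intro mult_left_mono) (auto intro: order_trans mult_left_mono)
    finally show "norm (F (x u) - F (x 0)) \<le> L * (M * \<bar>h\<bar>)" .
  qed
  then show ?thesis by (simp add: algebra_simps power2_eq_square abs_mult_self_eq)
qed

text \<open>Convergence at rate \<open>1 / k\<close>, uniformly in the initial value. Uniformity is the point: the Euler
  iterates are explicit compositions, and a uniform limit inherits holomorphy from them.\<close>

lemma Euler_converges:
  fixes F :: "'a::euclidean_space \<Rightarrow> 'a"
  assumes lip: "\<And>x y. norm (F x - F y) \<le> L * norm (x - y)" and L: "L \<ge> 0"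
    and M: "\<And>x. norm (F x) \<le> M"
    and x: "\<And>p. x p 0 = p" "\<And>p t. (x p has_vector_derivative F (x p t)) (at t)"
  shows "uniform_limit UNIV (\<lambda>k p. ((\<lambda>z. z + (s / real k) *\<^sub>R F z) ^^ k) p) (\<lambda>p. x p s) sequentially"
proof -
  have M0: "M \<ge> 0" using M[of 0] norm_ge_zero order_trans by blast
  have stab: "norm (x p (a + h) - x p a - h *\<^sub>R F (x p a)) \<le> L * M * h\<^sup>2" for p a h
  proof -
    have "((\<lambda>t. x p (a + t)) has_vector_derivative F (x p (a + t))) (at t)" for t
    proof -
      have "((\<lambda>t. a + t) has_vector_derivative 1) (at t)" by (auto intro!: derivative_eq_intros)
      from vector_diff_chain_at[OF this x(2)] show ?thesis by (simp add: o_def)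
    qed
    from Euler_step_bound[OF lip L M this, of h] show ?thesis by simp
  qed
  have main: "norm (x p (real j * h) - ((\<lambda>z. z + h *\<^sub>R F z) ^^ j) p)
     \<le> real j * (L * M * h\<^sup>2) * exp (L * \<bar>h\<bar> * real j)" for p h j
  proof (induction j)
    case 0 then show ?case by (simp add: x(1))
  next
    case (Suc j)
    let ?E = "((\<lambda>z. z + h *\<^sub>R F z) ^^ j) p" and ?y = "x p (real j * h)"
    let ?C = "L * M * h\<^sup>2" and ?e = "exp (L * \<bar>h\<bar> * real j)" and ?d = "exp (L * \<bar>h\<bar>)"
    have C: "?C \<ge> 0" using L M0 by simp
    have e1: "1 \<le> ?e * ?d" using L by (simp flip: exp_add)
    have d1: "1 + L * \<bar>h\<bar> \<le> ?d" by (rule exp_ge_add_one_self)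
    have "x p (real (Suc j) * h) - ((\<lambda>z. z + h *\<^sub>R F z) ^^ Suc j) p =
      (x p (real j * h + h) - ?y - h *\<^sub>R F ?y) + ((?y - ?E) + h *\<^sub>R (F ?y - F ?E))"
      by (simp add: algebra_simps)
    also have "norm \<dots> \<le> norm (x p (real j * h + h) - ?y - h *\<^sub>R F ?y) + (norm (?y - ?E) + norm (h *\<^sub>R (F ?y - F ?E)))"
      by (rule order_trans[OF norm_triangle_ineq add_left_mono[OF norm_triangle_ineq]])
    also have "\<dots> \<le> ?C + (norm (?y - ?E) + \<bar>h\<bar> * (L * norm (?y - ?E)))"
      using stab[of p "real j * h" h] lip[of ?y ?E] by (intro add_mono) (auto intro: mult_left_mono)
    also have "\<dots> = ?C + (1 + L * \<bar>h\<bar>) * norm (?y - ?E)" by (simp add: algebra_simps)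
    also have "\<dots> \<le> ?C + ?d * (real j * ?C * ?e)"
      using d1 Suc.IH by (intro add_left_mono mult_mono) auto
    also have "\<dots> \<le> ?C * (?e * ?d) + ?d * (real j * ?C * ?e)"
      using mult_left_mono[OF e1 C] by simp
    also have "\<dots> = real (Suc j) * ?C * (?e * ?d)" by (simp add: algebra_simps)
    also have "?e * ?d = exp (L * \<bar>h\<bar> * real (Suc j))" by (simp add: algebra_simps flip: exp_add)
    finally show ?case .
  qed
  define C where "C = L * M * s\<^sup>2 * exp (L * \<bar>s\<bar>)"
  have C: "C \<ge> 0" using L M0 by (simp add: C_def)
  show ?thesis
  proof (rule uniform_limitI)
    fix e :: real assume e: "e > 0"
    obtain K :: nat where K: "C / e + 1 \<le> real K" using real_arch_simple by blast
    show "\<forall>\<^sub>F k in sequentially. \<forall>p\<in>UNIV. dist (((\<lambda>z. z + (s / real k) *\<^sub>R F z) ^^ k) p) (x p s) < e"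
      using eventually_ge_at_top[of K]
    proof eventually_elim
      case (elim k)
      have k: "C / e + 1 \<le> real k" using K elim by linarith
      have "C / e \<ge> 0" using C e by simp
      then have k0: "real k > 0" using k by linarith
      show ?case
      proof
        fix p
        have "norm (x p (real k * (s / real k)) - ((\<lambda>z. z + (s / real k) *\<^sub>R F z) ^^ k) p)
          \<le> real k * (L * M * (s / real k)\<^sup>2) * exp (L * \<bar>s / real k\<bar> * real k)" by (rule main)
        also have "\<dots> = C / real k" using k0 by (simp add: C_def power2_eq_square)
        also have "\<dots> < e"
        proof -
          have "C / e < real k" using k by linarith
          then show ?thesis using e k0 by (simp add: field_simps)
        qed
        finally show "dist (((\<lambda>z. z + (s / real k) *\<^sub>R F z) ^^ k) p) (x p s) < e"
          using k0 by (simp add: dist_norm norm_minus_commute)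
      qed
    qed
  qed
qed

section \<open>Analytic dependence on the initial value\<close>

lemma norm_vec_le_sum: "norm (v :: complex^'n) \<le> (\<Sum>i\<in>UNIV. norm (v $ i))"
  unfolding norm_vec_def by (rule L2_set_le_sum) simp

text \<open>Cauchy estimates replace a bound on the derivative by boundedness on a compact ball.\<close>

lemma holo_lipschitz:
  fixes H :: "complex^'n \<Rightarrow> complex^'n"
  assumes H: "\<And>i. holo_on (ball b r) (\<lambda>z. H z $ i)" and r: "r > 0"
  obtains L where "L \<ge> 0" "\<And>z w. z \<in> cball b (r/4) \<Longrightarrow> w \<in> cball b (r/4) \<Longrightarrow> norm (H z - H w) \<le> L * norm (z - w)"
proof -
  have sub: "cball b (r/2) \<subseteq> ball b r" using r by auto
  have "\<exists>M. \<forall>w\<in>cball b (r/2). cmod (H w $ i) \<le> M" for i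
  proof -
    have "compact ((\<lambda>w. H w $ i) ` cball b (r/2))"
      by (intro compact_continuous_image continuous_on_subset[OF holo_on_continuous[OF H] sub]) auto
    then show ?thesis using compact_imp_bounded bounded_iff by (metis imageI)
  qed
  then obtain M where M: "\<And>i w. w \<in> cball b (r/2) \<Longrightarrow> cmod (H w $ i) \<le> M i" by metis
  have M0: "M i \<ge> 0" for i using order_trans[OF norm_ge_zero M[of b i]] r by simp
  define C where "C i = 2 * M i / (r/4)" for i
  have lip: "cmod (H z $ i - H w $ i) \<le> C i * norm (z - w)"
    if "z \<in> cball b (r/4)" "w \<in> cball b (r/4)" for z w i
  proof (rule differentiable_bound[OF convex_cball _ _ that, where f="\<lambda>z. H z $ i"])
    fix x assume x: "x \<in> cball b (r/4)"
    have sx: "ball x (r/4) \<subseteq> cball b (r/2)"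
    proof
      fix y assume "y \<in> ball x (r/4)"
      moreover have "dist b y \<le> dist b x + dist x y" by (rule dist_triangle)
      ultimately show "y \<in> cball b (r/2)" using x by simp
    qed
    have hx: "holo_on (ball x (r/4)) (\<lambda>z. H z $ i)" by (rule holo_on_subset[OF H]) (use sx sub in blast)
    show "((\<lambda>z. H z $ i) has_derivative frechet_derivative (\<lambda>z. H z $ i) (at x)) (at x within cball b (r/4))"
      by (rule has_derivative_at_withinI, rule holo_on_frechet(1)[OF hx]) (use r in simp)
    show "onorm (frechet_derivative (\<lambda>z. H z $ i) (at x)) \<le> C i"
      unfolding C_def
      by (rule onorm_le, rule holo_on_Cauchy[OF hx]) (use r M sx in auto)
  qed
  show ?thesis
  proof (rule that[of "\<Sum>i\<in>UNIV. C i"])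
    show "(\<Sum>i\<in>UNIV. C i) \<ge> 0" using M0 r by (auto intro!: sum_nonneg simp: C_def)
    fix z w assume zw: "z \<in> cball b (r/4)" "w \<in> cball b (r/4)"
    have "norm (H z - H w) \<le> (\<Sum>i\<in>UNIV. norm ((H z - H w) $ i))" by (rule norm_vec_le_sum)
    also have "\<dots> \<le> (\<Sum>i\<in>UNIV. C i * norm (z - w))" by (rule sum_mono) (use lip[OF zw] in simp)
    finally show "norm (H z - H w) \<le> (\<Sum>i\<in>UNIV. C i) * norm (z - w)" by (simp add: sum_distrib_right)
  qed
qed

text \<open>Composition with the nearest-point projection onto a ball extends a field from the ball to a globally
  Lipschitz field, which has a global flow. Inside the ball nothing changes.\<close>

lemma lipschitz_cutoff:
  fixes F :: "'a::euclidean_space \<Rightarrow> 'b::real_normed_vector"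
  assumes "R > 0" "L \<ge> 0" and lip: "\<And>z w. z \<in> cball b R \<Longrightarrow> w \<in> cball b R \<Longrightarrow> norm (F z - F w) \<le> L * norm (z - w)"
  shows "norm (F (closest_point (cball b R) x) - F (closest_point (cball b R) y)) \<le> L * norm (x - y)"
proof -
  let ?c = "closest_point (cball b R)"
  have c: "?c x \<in> cball b R" for x using assms(1) by (intro closest_point_in_set) auto
  have "dist (?c x) (?c y) \<le> dist x y" using assms(1) by (intro closest_point_lipschitz) auto
  then have "L * norm (?c x - ?c y) \<le> L * norm (x - y)" using assms(2) by (intro mult_left_mono) (auto simp: dist_norm)
  then show ?thesis using lip[OF c c, of x y] by linarith
qed

text \<open>A field is cut off outside a small ball around its equilibrium \<open>b\<close>, which makes its flow \<open>\<Phi>\<close> global;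
  inside the ball \<open>\<Phi>\<close> follows \<open>G\<close>. The same is done with the holomorphic extension of \<open>G\<close>. Points close
  to \<open>b\<close> do not leave the ball for a prescribed time, since distances to \<open>b\<close> grow at most like
  \<open>exp (L \<bar>t\<bar>)\<close>, and the same bound holds for Euler iterates. On such points all Euler iterates are
  holomorphic, and so is the complex flow; on real points it agrees with \<open>\<Phi>\<close> by uniqueness.\<close>

theorem analytic_flow:
  fixes G :: "real^'n \<Rightarrow> real^'n"
  assumes G: "\<And>i. real_analytic_on (ball b \<rho>) (\<lambda>p. G p $ i)" and Gb: "G b = 0" and \<rho>: "\<rho> > 0"
  obtains R L and \<Phi> :: "real \<Rightarrow> real^'n \<Rightarrow> real^'n" where "0 < R" "R < \<rho>" "0 \<le> L" "\<And>p. \<Phi> 0 p = p"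
    "\<And>s t p. \<Phi> (s + t) p = \<Phi> s (\<Phi> t p)"
    "\<And>t p q. norm (\<Phi> t p - \<Phi> t q) \<le> exp (L * \<bar>t\<bar>) * norm (p - q)"
    "\<And>t. \<Phi> t b = b" "\<And>p. continuous_on UNIV (\<lambda>t. \<Phi> t p)"
    "\<And>t p. \<Phi> t p \<in> cball b R \<Longrightarrow> ((\<lambda>t. \<Phi> t p) has_vector_derivative G (\<Phi> t p)) (at t)"
    "\<And>T. \<exists>r>0. \<forall>s\<in>{-T..T}. \<forall>i. real_analytic_on (ball b r) (\<lambda>p. \<Phi> s p $ i)"
proof -
  have "\<forall>i. \<exists>r>0. \<exists>F. holo_on (ball (cvec b) r) F \<and> (\<forall>q\<in>ball b r. F (cvec q) = of_real (G q $ i))"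
    using G \<rho> unfolding real_analytic_on_def by simp
  then obtain r F where r: "\<And>i. r i > 0" and F: "\<And>i. holo_on (ball (cvec b) (r i)) (F i)"
    "\<And>i q. q \<in> ball b (r i) \<Longrightarrow> F i (cvec q) = of_real (G q $ i)" by metis
  define r0 where "r0 = min \<rho> (Min (range r))"
  have r0: "r0 > 0" "\<And>i. r0 \<le> r i" "r0 \<le> \<rho>" using r \<rho> by (auto simp: r0_def min.coboundedI2)
  define H where "H z = (\<chi> i. F i z)" for z
  have Hh: "holo_on (ball (cvec b) r0) (\<lambda>z. H z $ i)" for i
    unfolding H_def vec_lambda_beta by (rule holo_on_subset[OF F(1)]) (use r0(2)[of i] in auto)
  have Hr: "H (cvec q) = cvec (G q)" if "q \<in> ball b r0" for q
    unfolding vec_eq_iff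
  proof
    fix i
    have "q \<in> ball b (r i)" using that r0(2)[of i] by auto
    then show "H (cvec q) $ i = cvec (G q) $ i" by (simp add: H_def F(2))
  qed
  obtain L where L: "L \<ge> 0" "\<And>z w. z \<in> cball (cvec b) (r0/4) \<Longrightarrow> w \<in> cball (cvec b) (r0/4) \<Longrightarrow> norm (H z - H w) \<le> L * norm (z - w)"
    using holo_lipschitz[OF Hh r0(1)] by blast
  define R where "R = r0/4"
  have R: "0 < R" "R < r0" "R < \<rho>" using r0 by (auto simp: R_def)
  have HL: "norm (H z - H w) \<le> L * norm (z - w)" if "z \<in> cball (cvec b) R" "w \<in> cball (cvec b) R" for z w
    using L(2) that by (simp add: R_def)
  have GL: "norm (G p - G q) \<le> L * norm (p - q)" if "p \<in> cball b R" "q \<in> cball b R" for p q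
  proof -
    have "norm (H (cvec p) - H (cvec q)) \<le> L * norm (cvec p - cvec q)" by (rule HL) (use that in auto)
    moreover have "p \<in> ball b r0" "q \<in> ball b r0" using that R by auto
    ultimately show ?thesis by (simp add: Hr flip: cvec_diff)
  qed
  define FC where "FC z = H (closest_point (cball (cvec b) R) z)" for z
  define FR where "FR p = G (closest_point (cball b R) p)" for p
  have FCL: "norm (FC z - FC w) \<le> L * norm (z - w)" for z w
    unfolding FC_def by (rule lipschitz_cutoff[OF R(1) L(1) HL])
  have FRL: "norm (FR z - FR w) \<le> L * norm (z - w)" for z w
    unfolding FR_def by (rule lipschitz_cutoff[OF R(1) L(1) GL])
  have FC: "FC z = H z" if "z \<in> cball (cvec b) R" for z using that by (simp add: FC_def closest_point_self)
  have FR: "FR z = G z" if "z \<in> cball b R" for z using that by (simp add: FR_def closest_point_self)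
  have FCb: "FC (cvec b) = 0" using FC[of "cvec b"] Hr[of b] r0 R Gb by (simp add: cvec_def vec_eq_iff)
  have FCM: "norm (FC z) \<le> L * R" for z
  proof -
    have c: "closest_point (cball (cvec b) R) z \<in> cball (cvec b) R" using R by (intro closest_point_in_set) auto
    have "norm (FC z) = norm (H (closest_point (cball (cvec b) R) z) - H (cvec b))"
      using FC[of "cvec b"] FCb R by (simp add: FC_def)
    also have "\<dots> \<le> L * norm (closest_point (cball (cvec b) R) z - cvec b)" by (rule HL[OF c]) (use R in auto)
    also have "\<dots> \<le> L * R" using c L(1) by (intro mult_left_mono) (auto simp: dist_norm norm_minus_commute)
    finally show ?thesis .
  qed
  obtain \<Theta> where \<Theta>: "\<And>p. \<Theta> 0 p = p" "\<And>t p. ((\<lambda>t. \<Theta> t p) has_vector_derivative FC (\<Theta> t p)) (at t)"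
    "\<And>s t p. \<Theta> (s + t) p = \<Theta> s (\<Theta> t p)"
    "\<And>t p q. norm (\<Theta> t p - \<Theta> t q) \<le> exp (L * \<bar>t\<bar>) * norm (p - q)"
    by (rule lipschitz_flow[of FC L, OF FCL]) (rule that)
  obtain \<Phi> :: "real \<Rightarrow> real^'n \<Rightarrow> real^'n"
    where \<Phi>: "\<And>p. \<Phi> 0 p = p" "\<And>t p. ((\<lambda>t. \<Phi> t p) has_vector_derivative FR (\<Phi> t p)) (at t)"
    "\<And>s t p. \<Phi> (s + t) p = \<Phi> s (\<Phi> t p)"
    "\<And>t p q. norm (\<Phi> t p - \<Phi> t q) \<le> exp (L * \<bar>t\<bar>) * norm (p - q)"
    by (rule lipschitz_flow[of FR L, OF FRL]) (rule that)
  have \<Phi>b: "\<Phi> t b = b" for t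
  proof -
    have "norm (\<Phi> t b - b) \<le> exp (L * \<bar>t - 0\<bar>) * norm (\<Phi> 0 b - b)"
    proof (rule gronwall[of UNIV 0 t "\<lambda>t. \<Phi> t b - b" "\<lambda>t. FR (\<Phi> t b)"])
      show "((\<lambda>t. \<Phi> t b - b) has_vector_derivative FR (\<Phi> u b)) (at u within UNIV)" for u
        using has_vector_derivative_diff[OF \<Phi>(2) has_vector_derivative_const] by simp
      have "FR b = 0" using FR[of b] R Gb by simp
      then show "norm (FR (\<Phi> u b)) \<le> L * norm (\<Phi> u b - b)" for u using FRL[of "\<Phi> u b" b] by simp
    qed auto
    then show ?thesis by (simp add: \<Phi>(1))
  qed
  have conf: "norm (\<Phi> t p - b) \<le> exp (L * \<bar>t\<bar>) * norm (p - b)" for t p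
    using \<Phi>(4)[of t p b] by (simp add: \<Phi>b)
  have ana: "\<exists>r>0. \<forall>s\<in>{-T..T}. \<forall>i. real_analytic_on (ball b r) (\<lambda>p. \<Phi> s p $ i)" for T
  proof (intro exI conjI allI ballI)
    let ?r = "R * exp (- L * \<bar>T\<bar>)"
    show r: "?r > 0" using R by simp
    fix s i assume "s \<in> {-T..T}"
    then have s: "\<bar>s\<bar> \<le> T" by auto
    have expT: "exp (L * \<bar>u\<bar>) * d \<le> R" if "\<bar>u\<bar> \<le> \<bar>T\<bar>" "d \<le> ?r" "0 \<le> d" for u d
    proof -
      have "exp (L * \<bar>u\<bar>) * d \<le> exp (L * \<bar>T\<bar>) * ?r"
        using that L(1) by (intro mult_mono) (auto intro: mult_left_mono)
      also have "\<dots> = R" by (simp add: exp_minus)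
      finally show ?thesis .
    qed
    \<comment> \<open>Holomorphy of the iterates and their confinement to the ball have to be proved together.\<close>
    have Euler: "\<forall>i. holo_on (ball (cvec b) ?r) (\<lambda>z. ((\<lambda>z. z + (s / real k) *\<^sub>R FC z) ^^ j) z $ i) \<and>
      (\<forall>z\<in>ball (cvec b) ?r. norm (((\<lambda>z. z + (s / real k) *\<^sub>R FC z) ^^ j) z - cvec b) \<le> exp (L * \<bar>s\<bar> * real j / real k) * norm (z - cvec b))"
      if "j \<le> k" for k j
      using that
    proof (induction j)
      case 0 show ?case by (simp add: holo_on_nth)
    next
      case (Suc j)
      let ?E = "(\<lambda>z. z + (s / real k) *\<^sub>R FC z) ^^ j" and ?h = "s / real k"
      have k: "real k > 0" "real j / real k \<le> 1" using Suc.prems by auto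
      have IH: "\<And>i. holo_on (ball (cvec b) ?r) (\<lambda>z. ?E z $ i)"
        "\<And>z. z \<in> ball (cvec b) ?r \<Longrightarrow> norm (?E z - cvec b) \<le> exp (L * \<bar>s\<bar> * real j / real k) * norm (z - cvec b)"
        using Suc by auto
      have inR: "?E z \<in> cball (cvec b) R" if z: "z \<in> ball (cvec b) ?r" for z
      proof -
        have "norm (?E z - cvec b) \<le> exp (L * \<bar>s\<bar> * real j / real k) * norm (z - cvec b)" by (rule IH(2)[OF z])
        also have "exp (L * \<bar>s\<bar> * real j / real k) * norm (z - cvec b) \<le> exp (L * \<bar>s\<bar>) * norm (z - cvec b)"
          using mult_left_mono[OF k(2), of "L * \<bar>s\<bar>"] L(1) by (intro mult_right_mono) auto
        also have "\<dots> \<le> R" by (rule expT) (use s z in \<open>auto simp: dist_norm norm_minus_commute\<close>)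
        finally show ?thesis by (simp add: dist_norm norm_minus_commute)
      qed
      have S: "((\<lambda>z. z + ?h *\<^sub>R FC z) ^^ Suc j) z = ?E z + ?h *\<^sub>R H (?E z)" if "z \<in> ball (cvec b) ?r" for z
        using FC[OF inR[OF that]] by simp
      have "holo_on (ball (cvec b) ?r) (\<lambda>z. H (?E z) $ i)" for i
        by (rule holo_on_compose[OF Hh IH(1)]) (use inR R(2) in force)
      then have 1: "holo_on (ball (cvec b) ?r) (\<lambda>z. ?E z $ i + of_real ?h * H (?E z) $ i)" for i
        by (intro holo_on_add IH(1) holo_on_mult holo_on_const)
      have "holo_on (ball (cvec b) ?r) (\<lambda>z. ((\<lambda>z. z + ?h *\<^sub>R FC z) ^^ Suc j) z $ i)" for i
        unfolding holo_on_def
      proof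
        fix z assume z: "z \<in> ball (cvec b) ?r"
        obtain F' where F': "((\<lambda>z. ?E z $ i + of_real ?h * H (?E z) $ i) has_derivative F') (at z)" "\<forall>c v. F' (c *s v) = c * F' v"
          using 1[of i] z unfolding holo_on_def by blast
        have "((\<lambda>z. ((\<lambda>z. z + ?h *\<^sub>R FC z) ^^ Suc j) z $ i) has_derivative F') (at z)"
          by (rule has_derivative_transform_within_open[OF F'(1) open_ball z])
            (simp only: S vector_add_component vector_scaleR_component scaleR_conv_of_real[where 'a=complex])
        then show "\<exists>F'. ((\<lambda>z. ((\<lambda>z. z + ?h *\<^sub>R FC z) ^^ Suc j) z $ i) has_derivative F') (at z) \<and> (\<forall>c v. F' (c *s v) = c * F' v)"
          using F'(2) by blast
      qed
      moreover have "norm (((\<lambda>z. z + ?h *\<^sub>R FC z) ^^ Suc j) z - cvec b) \<le> exp (L * \<bar>s\<bar> * real (Suc j) / real k) * norm (z - cvec b)"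
        if z: "z \<in> ball (cvec b) ?r" for z
      proof -
        have "((\<lambda>z. z + ?h *\<^sub>R FC z) ^^ Suc j) z - cvec b = (?E z - cvec b) + ?h *\<^sub>R (FC (?E z) - FC (cvec b))"
          by (simp add: FCb)
        also have "norm \<dots> \<le> norm (?E z - cvec b) + norm (?h *\<^sub>R (FC (?E z) - FC (cvec b)))" by (rule norm_triangle_ineq)
        also have "\<dots> \<le> norm (?E z - cvec b) + \<bar>?h\<bar> * (L * norm (?E z - cvec b))"
          using FCL[of "?E z" "cvec b"] by (simp only: norm_scaleR) (intro add_left_mono mult_left_mono, auto)
        also have "\<dots> = (1 + L * \<bar>?h\<bar>) * norm (?E z - cvec b)" by (simp add: algebra_simps)
        also have "\<dots> \<le> exp (L * \<bar>?h\<bar>) * (exp (L * \<bar>s\<bar> * real j / real k) * norm (z - cvec b))"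
          by (intro mult_mono IH(2)[OF z] exp_ge_add_one_self) auto
        also have "\<dots> = exp (L * \<bar>s\<bar> * real (Suc j) / real k) * norm (z - cvec b)"
        proof -
          have "L * \<bar>?h\<bar> + L * \<bar>s\<bar> * real j / real k = L * \<bar>s\<bar> * real (Suc j) / real k"
            using k(1) by (simp add: abs_divide field_simps)
          then show ?thesis by (simp only: mult.assoc[symmetric] exp_add[symmetric])
        qed
        finally show ?thesis .
      qed
      ultimately show ?case by blast
    qed
    have \<Theta>h: "holo_on (ball (cvec b) ?r) (\<lambda>z. \<Theta> s z $ i)"
    proof (rule holo_on_uniform_limit[OF open_ball])
      show "\<forall>\<^sub>F k in sequentially. holo_on (ball (cvec b) ?r) (\<lambda>z. ((\<lambda>z. z + (s / real k) *\<^sub>R FC z) ^^ k) z $ i)"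
        using Euler by (intro always_eventually) blast
      have "uniform_limit UNIV (\<lambda>k p. ((\<lambda>z. z + (s / real k) *\<^sub>R FC z) ^^ k) p) (\<lambda>p. \<Theta> s p) sequentially"
        by (rule Euler_converges[where x="\<lambda>p t. \<Theta> t p", OF FCL L(1) FCM \<Theta>(1,2)])
      then have "uniform_limit (ball (cvec b) ?r) (\<lambda>k p. ((\<lambda>z. z + (s / real k) *\<^sub>R FC z) ^^ k) p) (\<lambda>p. \<Theta> s p) sequentially"
        by (rule uniform_limit_on_subset) simp
      then show "uniform_limit (ball (cvec b) ?r) (\<lambda>k z. ((\<lambda>z. z + (s / real k) *\<^sub>R FC z) ^^ k) z $ i) (\<lambda>z. \<Theta> s z $ i) sequentially"
        by (rule bounded_linear.uniform_limit[OF bounded_linear_vec_nth])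
    qed
    have real: "\<Theta> s (cvec p) = cvec (\<Phi> s p)" if p: "p \<in> ball b ?r" for p
    proof -
      have inR: "\<Phi> u p \<in> cball b R" if u: "\<bar>u\<bar> \<le> \<bar>T\<bar>" for u
      proof -
        have "norm (\<Phi> u p - b) \<le> R"
          using conf[of u p] expT[OF u, of "norm (p - b)"] p by (simp add: dist_norm norm_minus_commute)
        then show ?thesis by (simp add: dist_norm norm_minus_commute)
      qed
      have "norm (\<Theta> s (cvec p) - cvec (\<Phi> s p)) \<le> exp (L * \<bar>s - 0\<bar>) * norm (\<Theta> 0 (cvec p) - cvec (\<Phi> 0 p))"
      proof (rule gronwall[of "{- \<bar>T\<bar>..\<bar>T\<bar>}" 0 s "\<lambda>t. \<Theta> t (cvec p) - cvec (\<Phi> t p)" "\<lambda>t. FC (\<Theta> t (cvec p)) - cvec (FR (\<Phi> t p))"])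
        fix u assume "u \<in> {- \<bar>T\<bar>..\<bar>T\<bar>}"
        then have u: "\<Phi> u p \<in> cball b R" by (intro inR) auto
        show "((\<lambda>t. \<Theta> t (cvec p) - cvec (\<Phi> t p)) has_vector_derivative FC (\<Theta> u (cvec p)) - cvec (FR (\<Phi> u p)))
           (at u within {- \<bar>T\<bar>..\<bar>T\<bar>})"
          by (rule has_vector_derivative_at_within[OF has_vector_derivative_diff[OF \<Theta>(2)
              bounded_linear.has_vector_derivative[OF bounded_linear_cvec \<Phi>(2)]]])
        have "\<Phi> u p \<in> ball b r0" using u R by auto
        then have "cvec (FR (\<Phi> u p)) = FC (cvec (\<Phi> u p))"
          using FR[OF u] FC[of "cvec (\<Phi> u p)"] u by (simp add: Hr)
        then show "norm (FC (\<Theta> u (cvec p)) - cvec (FR (\<Phi> u p))) \<le> L * norm (\<Theta> u (cvec p) - cvec (\<Phi> u p))"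
          using FCL by simp
      qed (use s in \<open>auto simp: is_interval_cc\<close>)
      then show ?thesis by (simp add: \<Theta>(1) \<Phi>(1))
    qed
    show "real_analytic_on (ball b ?r) (\<lambda>p. \<Phi> s p $ i)"
    proof (rule real_analytic_onI)
      fix p assume p: "p \<in> ball b ?r"
      define e where "e = ?r - dist b p"
      have e: "e > 0" using p by (simp add: e_def)
      show "\<exists>r>0. \<exists>F. holo_on (ball (cvec p) r) F \<and> (\<forall>q\<in>ball p r. F (cvec q) = of_real (\<Phi> s q $ i))"
      proof (intro exI conjI ballI)
        show "holo_on (ball (cvec p) e) (\<lambda>z. \<Theta> s z $ i)"
        proof (rule holo_on_subset[OF \<Theta>h], rule subsetI)
          fix z assume "z \<in> ball (cvec p) e"
          then show "z \<in> ball (cvec b) ?r"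
            using dist_triangle[of "cvec b" z "cvec p"] by (simp add: e_def)
        qed
        fix q assume "q \<in> ball p e"
        then have "q \<in> ball b ?r" using dist_triangle[of b q p] by (simp add: e_def)
        then show "\<Theta> s (cvec q) $ i = of_real (\<Phi> s q $ i)" by (simp add: real)
      qed (rule e)
    qed
  qed
  show ?thesis
  proof (rule that[OF R(1,3) L(1) \<Phi>(1) \<Phi>(3) \<Phi>(4) \<Phi>b _ _ ana])
    show "continuous_on UNIV (\<lambda>t. \<Phi> t p)" for p
      by (intro continuous_at_imp_continuous_on ballI has_vector_derivative_continuous[OF \<Phi>(2)])
    show "((\<lambda>t. \<Phi> t p) has_vector_derivative G (\<Phi> t p)) (at t)" if "\<Phi> t p \<in> cball b R" for t p
      using \<Phi>(2)[where t=t and p=p] FR[OF that] by simp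
  qed
qed

section \<open>Uniqueness of solutions\<close>

text \<open>The partial derivatives are continuous, hence bounded on the compact ball.\<close>

lemma real_analytic_bounded_derivative:
  assumes "real_analytic_on UNIV (f :: real^'n \<Rightarrow> real)"
  obtains C where "C \<ge> 0" "\<And>p q. p \<in> cball 0 B \<Longrightarrow> q \<in> cball 0 B \<Longrightarrow> \<bar>f p - f q\<bar> \<le> C * norm (p - q)"
proof -
  let ?D = "\<lambda>j p. frechet_derivative f (at p) (axis j 1)"
  have "\<exists>M. \<forall>p\<in>cball 0 B. \<bar>?D j p\<bar> \<le> M" for j
  proof -
    have "continuous_on (cball 0 B) (?D j)"
      by (rule continuous_on_subset[OF real_analytic_on_continuous[OF
            real_analytic_on_directional_derivative[OF assms]]]) simp
    then have "compact (?D j ` cball 0 B)" by (rule compact_continuous_image) simp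
    then obtain M where "\<forall>y\<in>?D j ` cball 0 B. norm y \<le> M" using compact_imp_bounded bounded_iff by blast
    then show ?thesis by auto
  qed
  then obtain M where M: "\<And>j p. p \<in> cball 0 B \<Longrightarrow> \<bar>?D j p\<bar> \<le> M j" by metis
  let ?C = "\<Sum>j\<in>UNIV. \<bar>M j\<bar>"
  show ?thesis
  proof (rule that[of ?C])
    show "?C \<ge> 0" by (simp add: sum_nonneg)
    fix p q :: "real^'n" assume pq: "p \<in> cball 0 B" "q \<in> cball 0 B"
    have "norm (f p - f q) \<le> ?C * norm (p - q)"
    proof (rule differentiable_bound[OF convex_cball _ _ pq])
      fix x :: "real^'n" assume x: "x \<in> cball 0 B"
      have d: "(f has_derivative frechet_derivative f (at x)) (at x)"
        by (rule real_analytic_on_has_derivative[OF assms]) simp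
      then show "(f has_derivative frechet_derivative f (at x)) (at x within cball 0 B)"
        by (rule has_derivative_at_withinI)
      have lin: "linear (frechet_derivative f (at x))" using d by (rule has_derivative_linear)
      show "onorm (frechet_derivative f (at x)) \<le> ?C"
      proof (rule onorm_le)
        fix v :: "real^'n"
        have "(\<Sum>j\<in>UNIV. (v $ j) *\<^sub>R axis j 1) = v"
          using basis_expansion[of v] by (simp add: scalar_mult_eq_scaleR)
        then have "frechet_derivative f (at x) v = frechet_derivative f (at x) (\<Sum>j\<in>UNIV. (v $ j) *\<^sub>R axis j 1)"
          by simp
        also have "\<dots> = (\<Sum>j\<in>UNIV. v $ j * ?D j x)" by (simp add: linear_sum[OF lin] linear_scale[OF lin])
        also have "norm \<dots> \<le> (\<Sum>j\<in>UNIV. \<bar>v $ j * ?D j x\<bar>)" by (simp add: sum_abs)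
        also have "\<dots> \<le> (\<Sum>j\<in>UNIV. norm v * \<bar>M j\<bar>)"
        proof (rule sum_mono)
          fix j
          have "\<bar>?D j x\<bar> \<le> \<bar>M j\<bar>" using M[OF x, of j] by linarith
          then show "\<bar>v $ j * ?D j x\<bar> \<le> norm v * \<bar>M j\<bar>"
            using component_le_norm_cart[of v j] by (simp add: abs_mult mult_mono)
        qed
        finally show "norm (frechet_derivative f (at x) v) \<le> ?C * norm v"
          by (simp add: sum_distrib_left mult.commute)
      qed
    qed
    then show "\<bar>f p - f q\<bar> \<le> ?C * norm (p - q)" by simp
  qed
qed

lemma real_analytic_lipschitz_cball:
  fixes X :: "real^'n \<Rightarrow> real^'n"
  assumes "\<And>i. real_analytic_on UNIV (\<lambda>z. X z $ i)"
  obtains L where "L \<ge> 0" "\<And>p q. p \<in> cball 0 B \<Longrightarrow> q \<in> cball 0 B \<Longrightarrow> norm (X p - X q) \<le> L * norm (p - q)"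
proof -
  have "\<exists>C\<ge>0. \<forall>p\<in>cball 0 B. \<forall>q\<in>cball 0 B. \<bar>X p $ i - X q $ i\<bar> \<le> C * norm (p - q)" for i
    using real_analytic_bounded_derivative[OF assms[of i], of B] by metis
  then obtain C where C: "\<And>i. C i \<ge> 0"
    "\<And>i p q. p \<in> cball 0 B \<Longrightarrow> q \<in> cball 0 B \<Longrightarrow> \<bar>X p $ i - X q $ i\<bar> \<le> C i * norm (p - q)" by metis
  show ?thesis
  proof (rule that[of "\<Sum>i\<in>UNIV. C i"])
    show "(\<Sum>i\<in>UNIV. C i) \<ge> 0" using C(1) by (simp add: sum_nonneg)
    fix p q :: "real^'n" assume pq: "p \<in> cball 0 B" "q \<in> cball 0 B"
    have "norm (X p - X q) \<le> (\<Sum>i\<in>UNIV. \<bar>(X p - X q) $ i\<bar>)" by (rule norm_le_l1_cart)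
    also have "\<dots> \<le> (\<Sum>i\<in>UNIV. C i * norm (p - q))" by (rule sum_mono) (use C(2)[OF pq] in simp)
    finally show "norm (X p - X q) \<le> (\<Sum>i\<in>UNIV. C i) * norm (p - q)" by (simp add: sum_distrib_right)
  qed
qed

theorem solution_unique:
  fixes X :: "real^'n \<Rightarrow> real^'n"
  assumes X: "\<And>i. real_analytic_on UNIV (\<lambda>z. X z $ i)"
    and x: "solution_on X J x" and y: "solution_on X J y"
    and st: "s \<in> J" "t \<in> J" and eq: "x s = y s"
  shows "x t = y t"
proof -
  let ?K = "closed_segment s t"
  have J: "is_interval J" using x by (simp add: solution_on_def)
  have K: "?K \<subseteq> J" using st J by (simp add: closed_segment_subset is_interval_convex)
  have dx: "(x has_vector_derivative X (x u)) (at u within ?K)" if "u \<in> ?K" for u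
    using x that K unfolding solution_on_def by (meson has_vector_derivative_within_subset subsetD)
  have dy: "(y has_vector_derivative X (y u)) (at u within ?K)" if "u \<in> ?K" for u
    using y that K unfolding solution_on_def by (meson has_vector_derivative_within_subset subsetD)
  have "compact (x ` ?K \<union> y ` ?K)"
    by (intro compact_Un compact_continuous_image continuous_on_vector_derivative[OF dx]
        continuous_on_vector_derivative[OF dy] compact_segment)
  then obtain B where B: "\<forall>z\<in>x ` ?K \<union> y ` ?K. norm z \<le> B" using compact_imp_bounded bounded_iff by blast
  obtain L where L: "L \<ge> 0" "\<And>p q. p \<in> cball 0 B \<Longrightarrow> q \<in> cball 0 B \<Longrightarrow> norm (X p - X q) \<le> L * norm (p - q)"
    using real_analytic_lipschitz_cball[OF X, of B] by blast
  have "norm (x t - y t) \<le> exp (L * \<bar>t - s\<bar>) * norm (x s - y s)"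
  proof (rule gronwall[where J="?K" and d="\<lambda>u. x u - y u" and d'="\<lambda>u. X (x u) - X (y u)"])
    show "is_interval ?K" using is_interval_convex_1 by blast
    show "((\<lambda>u. x u - y u) has_vector_derivative X (x u) - X (y u)) (at u within ?K)" if "u \<in> ?K" for u
      by (rule has_vector_derivative_diff[OF dx[OF that] dy[OF that]])
    show "norm (X (x u) - X (y u)) \<le> L * norm (x u - y u)" if "u \<in> ?K" for u
      by (rule L(2)) (use B that in auto)
  qed auto
  then show ?thesis using eq by simp
qed

lemma solution_on_UNIV_imp: "(\<And>t. (x has_vector_derivative X (x t)) (at t)) \<Longrightarrow> is_interval J \<Longrightarrow> solution_on X J x"
  by (auto simp: solution_on_def intro: has_vector_derivative_at_within)

lemma has_vector_derivative_vec_nth: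
  "(x has_vector_derivative x') F \<Longrightarrow> ((\<lambda>t. x t $ i) has_vector_derivative x' $ i) F"
  by (rule bounded_linear.has_vector_derivative[OF bounded_linear_vec_nth])

lemma has_real_derivative_vec_nth:
  fixes x :: "real \<Rightarrow> real^'n"
  shows "(x has_vector_derivative x') (at t within S) \<Longrightarrow> ((\<lambda>t. x t $ i) has_real_derivative x' $ i) (at t within S)"
  by (simp add: has_real_derivative_iff_has_vector_derivative has_vector_derivative_vec_nth)

lemma has_vector_derivative_shift:
  assumes "(x has_vector_derivative x') (at (t + a))"
  shows "((\<lambda>t. x (t + a)) has_vector_derivative x') (at t)"
proof -
  have "((\<lambda>t. t + a) has_vector_derivative 1) (at t)" by (auto intro!: derivative_eq_intros)
  from vector_diff_chain_at[OF this assms] show ?thesis by (simp add: o_def)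
qed

section \<open>Reversible centres\<close>

text \<open>The reversing symmetry. Its fixed plane \<open>\<phi>\<^sub>1 = 0\<close> is where the closed orbits are cut.\<close>

definition mirror :: "real^3 \<Rightarrow> real^3" where
  "mirror z = vector [- z $ 1, z $ 2, z $ 3]"

lemma linear_mirror: "linear mirror"
  by (auto simp: linear_iff vec_eq_iff forall_3 mirror_def)

text \<open>The field \<open>X\<close> anticommutes with the reflection (\<open>X_odd\<close>, together with \<open>X1\<close>) and pushes back
  towards the plane near the origin (\<open>restoring\<close>). The flow \<open>\<Phi>\<close> belongs to a cut-off of \<open>X\<close>; it
  is the flow of \<open>X\<close> as long as it stays in the ball of radius \<open>R\<close>.\<close>

locale reversible_center =
  fixes X :: "real^3 \<Rightarrow> real^3" and \<kappa> R L r0 :: real and \<Phi> :: "real \<Rightarrow> real^3 \<Rightarrow> real^3"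
  assumes analytic: "\<And>i. real_analytic_on UNIV (\<lambda>z. X z $ i)"
    and X1: "\<And>z. X z $ 1 = z $ 2"
    and X_odd: "\<And>z. X (mirror z) $ 2 = - X z $ 2" "\<And>z. X (mirror z) $ 3 = - X z $ 3"
    and \<kappa>: "\<kappa> > 0" and L: "L \<ge> 0"
    and restoring: "\<And>z. norm z < R \<Longrightarrow> z $ 1 > 0 \<Longrightarrow> X z $ 2 \<le> - \<kappa>\<^sup>2 * z $ 1"
    and \<Phi>0: "\<And>p. \<Phi> 0 p = p"
    and \<Phi>_add: "\<And>s t p. \<Phi> (s + t) p = \<Phi> s (\<Phi> t p)"
    and \<Phi>_lip: "\<And>t p q. norm (\<Phi> t p - \<Phi> t q) \<le> exp (L * \<bar>t\<bar>) * norm (p - q)"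
    and \<Phi>_0: "\<And>t. \<Phi> t 0 = 0"
    and \<Phi>_deriv: "\<And>t p. norm (\<Phi> t p) \<le> R \<Longrightarrow> ((\<lambda>t. \<Phi> t p) has_vector_derivative X (\<Phi> t p)) (at t)"
    and r0: "r0 > 0" "r0 \<le> R"
    and \<Phi>_analytic: "\<And>s i. s \<in> {-1..1} \<Longrightarrow> real_analytic_on (ball 0 r0) (\<lambda>p. \<Phi> s p $ i)"
begin

text \<open>\<open>T0\<close> is half the period of the comparison oscillator and bounds the time between crossings of the
  plane. The radius \<open>\<eta>\<close> is so small that trajectories starting within it stay in the ball of radius
  \<open>r0\<close> for that time.\<close>

definition "T0 = pi / \<kappa>"
definition "\<eta> = r0 * exp (- L * T0)"
definition "S = {z :: real^3. z $ 1 = 0 \<and> z $ 2 > 0 \<and> norm z < \<eta>}"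
definition "W = {\<Phi> t p |t p. p \<in> S}"

lemma T0: "T0 > 0" using \<kappa> by (simp add: T0_def)

lemma \<eta>: "\<eta> > 0" using r0 by (simp add: \<eta>_def)

lemma S_D: "q \<in> S \<Longrightarrow> q $ 1 = 0" "q \<in> S \<Longrightarrow> q $ 2 > 0" "q \<in> S \<Longrightarrow> norm q < \<eta>"
  by (auto simp: S_def)

lemma \<Phi>_inverse: "\<Phi> (- t) (\<Phi> t p) = p" "\<Phi> t (\<Phi> (- t) p) = p"
  using \<Phi>_add[of "- t" t p] \<Phi>_add[of t "- t" p] \<Phi>0 by auto

lemma \<Phi>_continuous: "continuous_on UNIV (\<Phi> t)"
proof -
  have "lipschitz_on (exp (L * \<bar>t\<bar>)) UNIV (\<Phi> t)"
    by (rule lipschitz_onI) (use \<Phi>_lip in \<open>auto simp: dist_norm\<close>)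
  then show ?thesis by (rule lipschitz_on_continuous_on)
qed

lemma confined_short:
  assumes "norm p < \<eta>" "\<bar>t\<bar> \<le> T0"
  shows "norm (\<Phi> t p) < r0"
proof -
  have "norm (\<Phi> t p) \<le> exp (L * \<bar>t\<bar>) * norm p" using \<Phi>_lip[of t p 0] by (simp add: \<Phi>_0)
  also have "\<dots> \<le> exp (L * T0) * norm p"
    using assms(2) L by (intro mult_right_mono) (auto intro: mult_left_mono)
  also have "\<dots> < exp (L * T0) * \<eta>" using assms(1) by simp
  also have "\<dots> = r0" by (simp add: \<eta>_def exp_minus)
  finally show ?thesis .
qed

lemma \<Phi>_deriv_short:
  assumes "norm p < \<eta>" "\<bar>t\<bar> \<le> T0"
  shows "((\<lambda>t. \<Phi> t p) has_vector_derivative X (\<Phi> t p)) (at t)"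
  using \<Phi>_deriv confined_short[OF assms] r0 by simp

lemma X_mirror: "X (mirror z) = - mirror (X z)"
  using X_odd[of z] X1[of z] X1[of "mirror z"] by (simp add: vec_eq_iff forall_3 mirror_def)

text \<open>Both sides solve the same equation with the same initial value, which the reflection fixes.\<close>

lemma \<Phi>_mirror:
  assumes q: "q \<in> S" and t: "\<bar>t\<bar> \<le> T0"
  shows "mirror (\<Phi> (- t) q) = \<Phi> t q"
proof -
  have bl: "bounded_linear mirror" using linear_mirror by (simp add: linear_conv_bounded_linear)
  have "solution_on X {-T0..T0} (\<lambda>t. mirror (\<Phi> (- t) q))"
    unfolding solution_on_def
  proof (intro conjI ballI)
    fix u assume u: "u \<in> {-T0..T0}"
    have "((\<lambda>t. \<Phi> t q) has_vector_derivative X (\<Phi> (- u) q)) (at (- u))"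
      by (rule \<Phi>_deriv_short) (use u S_D(3)[OF q] in auto)
    moreover have "(uminus has_vector_derivative (-1)) (at u)" by (auto intro!: derivative_eq_intros)
    ultimately have "((\<lambda>u. \<Phi> (- u) q) has_vector_derivative - X (\<Phi> (- u) q)) (at u)"
      using vector_diff_chain_at[of uminus "-1" u "\<lambda>t. \<Phi> t q" "X (\<Phi> (- u) q)"] by (simp add: o_def)
    from bounded_linear.has_vector_derivative[OF bl this]
    have "((\<lambda>u. mirror (\<Phi> (- u) q)) has_vector_derivative X (mirror (\<Phi> (- u) q))) (at u)"
      by (simp add: X_mirror linear_neg[OF linear_mirror])
    then show "((\<lambda>u. mirror (\<Phi> (- u) q)) has_vector_derivative X (mirror (\<Phi> (- u) q))) (at u within {-T0..T0})"
      by (rule has_vector_derivative_at_within)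
  qed (simp add: is_interval_cc)
  moreover have "solution_on X {-T0..T0} (\<lambda>t. \<Phi> t q)"
    unfolding solution_on_def
  proof (intro conjI ballI)
    fix u assume "u \<in> {-T0..T0}"
    then have "\<bar>u\<bar> \<le> T0" by auto
    from \<Phi>_deriv_short[OF S_D(3)[OF q] this]
    show "((\<lambda>t. \<Phi> t q) has_vector_derivative X (\<Phi> u q)) (at u within {-T0..T0})"
      by (rule has_vector_derivative_at_within)
  qed (simp add: is_interval_cc)
  moreover have "mirror (\<Phi> (- 0) q) = \<Phi> 0 q"
    using S_D(1)[OF q] by (simp add: \<Phi>0 mirror_def vec_eq_iff forall_3)
  moreover have "0 \<in> {-T0..T0}" "t \<in> {-T0..T0}" using t T0 by auto
  ultimately show ?thesis
    using solution_unique[OF analytic, of "{-T0..T0}" "\<lambda>t. mirror (\<Phi> (- t) q)" "\<lambda>t. \<Phi> t q" 0 t] by blast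
qed

text \<open>If \<open>u = \<phi>\<^sub>1\<close> were positive up to time \<open>T0\<close>, then the Wronskian \<open>u' sin (\<kappa> t) - u \<kappa> cos (\<kappa> t)\<close>,
  which vanishes at time zero, would not increase, but at \<open>T0\<close> it equals \<open>\<kappa> u(T0) > 0\<close>.\<close>

lemma Sturm_crossing:
  assumes q: "q \<in> S"
  shows "\<exists>t. 0 < t \<and> t \<le> T0 \<and> \<Phi> t q $ 1 \<le> 0"
proof (rule ccontr)
  assume "\<not> ?thesis"
  then have pos: "\<Phi> t q $ 1 > 0" if "0 < t" "t \<le> T0" for t using that by force
  let ?g = "\<lambda>t. \<Phi> t q $ 2 * sin (\<kappa> * t) - \<Phi> t q $ 1 * (\<kappa> * cos (\<kappa> * t))"
  have d: "((\<lambda>t. \<Phi> t q $ i) has_real_derivative X (\<Phi> t q) $ i) (at t)" if "\<bar>t\<bar> \<le> T0" for t i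
    by (rule has_real_derivative_vec_nth[OF \<Phi>_deriv_short[OF S_D(3)[OF q] that]])
  have dg: "(?g has_real_derivative (X (\<Phi> t q) $ 2 + \<kappa>\<^sup>2 * \<Phi> t q $ 1) * sin (\<kappa> * t)) (at t)"
    if "\<bar>t\<bar> \<le> T0" for t
    using d[OF that, of 1] d[OF that, of 2]
    by (auto intro!: derivative_eq_intros simp: X1 power2_eq_square algebra_simps)
  have "?g T0 \<le> ?g 0"
  proof (rule DERIV_nonpos_imp_decreasing_open[where f="?g" and a=0 and b=T0])
    show "0 \<le> T0" using T0 by simp
    show "continuous_on {0..T0} ?g"
      by (intro continuous_at_imp_continuous_on ballI) (rule DERIV_isCont[OF dg], simp)
    fix t assume t: "0 < t" "t < T0"
    have "norm (\<Phi> t q) < R" using confined_short[OF S_D(3)[OF q], of t] t r0 by simp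
    then have "X (\<Phi> t q) $ 2 \<le> - \<kappa>\<^sup>2 * \<Phi> t q $ 1" using restoring pos t by simp
    moreover have "sin (\<kappa> * t) \<ge> 0"
    proof (rule sin_ge_zero)
      show "0 \<le> \<kappa> * t" using \<kappa> t by simp
      show "\<kappa> * t \<le> pi" using t \<kappa> by (simp add: T0_def field_simps)
    qed
    ultimately have "(X (\<Phi> t q) $ 2 + \<kappa>\<^sup>2 * \<Phi> t q $ 1) * sin (\<kappa> * t) \<le> 0"
      by (intro mult_nonpos_nonneg) auto
    then show "\<exists>y. (?g has_real_derivative y) (at t) \<and> y \<le> 0" using dg[of t] t by auto
  qed
  moreover have "\<kappa> * T0 = pi" using \<kappa> by (simp add: T0_def)
  ultimately have "\<Phi> T0 q $ 1 * \<kappa> \<le> 0" using S_D(1)[OF q] by (simp add: \<Phi>0)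
  then show False using pos[of T0] T0 \<kappa> by (simp add: mult_le_0_iff)
qed

text \<open>At the first zero \<open>\<tau>\<close> of \<open>\<phi>\<^sub>1\<close> the point \<open>\<Phi> \<tau> q\<close> is fixed by the reflection and so equals its
  mirror image \<open>\<Phi> (- \<tau>) q\<close>: the orbit closes after time \<open>2 \<tau>\<close>.\<close>

lemma half_period:
  assumes q: "q \<in> S"
  obtains \<tau> where "0 < \<tau>" "\<tau> \<le> T0" "\<Phi> \<tau> q $ 1 = 0" "\<And>t. 0 < t \<Longrightarrow> t < \<tau> \<Longrightarrow> \<Phi> t q $ 1 > 0" "\<Phi> \<tau> q $ 2 \<le> 0"
    "\<Phi> (2 * \<tau>) q = q"
proof -
  let ?u = "\<lambda>t. \<Phi> t q $ 1"
  have d: "(?u has_real_derivative \<Phi> t q $ 2) (at t)" if "\<bar>t\<bar> \<le> T0" for t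
    using has_real_derivative_vec_nth[OF \<Phi>_deriv_short[OF S_D(3)[OF q] that], of 1] by (simp add: X1)
  obtain t1 where t1: "0 < t1" "t1 \<le> T0" "?u t1 \<le> 0" using Sturm_crossing[OF q] by blast
  obtain \<delta> where \<delta>: "\<delta> > 0" "\<And>h. 0 < h \<Longrightarrow> h < \<delta> \<Longrightarrow> ?u h > 0"
    using DERIV_pos_inc_right[OF d[of 0]] T0 S_D[OF q] by (auto simp: \<Phi>0)
  have cont: "continuous_on {a..T0} ?u" if "a \<ge> 0" for a
    by (intro continuous_at_imp_continuous_on ballI) (rule DERIV_isCont[OF d], use that in simp)
  \<comment> \<open>The first zero is the least element of a compact set that avoids a neighbourhood of time zero, where
    \<open>\<phi>\<^sub>1\<close> vanishes as well.\<close>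
  define Z where "Z = {\<delta>..T0} \<inter> ?u -` {..0}"
  have "closed Z" unfolding Z_def
    by (rule continuous_closed_preimage[OF cont]) (use \<delta> in auto)
  moreover have "bounded Z" unfolding Z_def by (rule bounded_subset[of "{\<delta>..T0}"]) auto
  ultimately have "compact Z" by (simp add: compact_eq_bounded_closed)
  moreover have "t1 \<in> Z" using t1 \<delta>(2)[of t1] by (force simp: Z_def)
  ultimately obtain \<tau> where \<tau>: "\<tau> \<in> Z" "\<And>t. t \<in> Z \<Longrightarrow> \<tau> \<le> t"
    using compact_attains_inf[of Z] by blast
  have \<tau>0: "0 < \<tau>" "\<tau> \<le> T0" "?u \<tau> \<le> 0" using \<tau>(1) \<delta> by (auto simp: Z_def)
  have pos: "?u t > 0" if "0 < t" "t < \<tau>" for t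
  proof (cases "t < \<delta>")
    case True then show ?thesis using \<delta>(2) that by blast
  next
    case False
    then have "t \<notin> Z" using \<tau>(2)[of t] that by auto
    then show ?thesis using False that \<tau>0 by (auto simp: Z_def)
  qed
  have u\<tau>: "?u \<tau> = 0"
  proof (rule ccontr)
    assume "?u \<tau> \<noteq> 0"
    then have neg: "?u \<tau> < 0" using \<tau>0 by simp
    have "\<exists>x. \<tau>/2 \<le> x \<and> x \<le> \<tau> \<and> ?u x = 0"
      by (rule IVT2') (use neg pos[of "\<tau>/2"] \<tau>0 cont[of "\<tau>/2"] in \<open>auto intro: continuous_on_subset\<close>)
    then obtain x where x: "\<tau>/2 \<le> x" "x \<le> \<tau>" "?u x = 0" by blast
    then have "x < \<tau>" using neg by (cases "x = \<tau>") auto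
    then show False using pos[of x] x \<tau>0 by simp
  qed
  have w: "\<Phi> \<tau> q $ 2 \<le> 0"
  proof (rule ccontr)
    assume "\<not> ?thesis"
    then obtain d' where d': "d' > 0" "\<And>h. h > 0 \<Longrightarrow> h < d' \<Longrightarrow> ?u (\<tau> - h) < ?u \<tau>"
      using DERIV_pos_inc_left[OF d[of \<tau>]] \<tau>0 by auto
    define h where "h = min d' \<tau> / 2"
    have "0 < h" "h < d'" "h < \<tau>" using d'(1) \<tau>0 by (auto simp: h_def)
    then show False using d'(2)[of h] pos[of "\<tau> - h"] u\<tau> by simp
  qed
  have "\<Phi> (- \<tau>) q = \<Phi> \<tau> q"
  proof -
    have "mirror (\<Phi> \<tau> q) = \<Phi> (- \<tau>) q" using \<Phi>_mirror[OF q, of "- \<tau>"] \<tau>0 by simp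
    moreover have "mirror (\<Phi> \<tau> q) = \<Phi> \<tau> q" using u\<tau> by (simp add: mirror_def vec_eq_iff forall_3)
    ultimately show ?thesis by simp
  qed
  then have "\<Phi> (2 * \<tau>) q = q" using \<Phi>_add[of \<tau> \<tau> q] \<Phi>_inverse(2)[of \<tau> q] by simp
  then show ?thesis using that \<tau>0 u\<tau> pos w by blast
qed

lemma period_reduction:
  assumes \<tau>: "\<tau> > 0" "\<Phi> (2 * \<tau>) q = q"
  obtains t' where "- \<tau> < t'" "t' \<le> \<tau>" "\<Phi> t q = \<Phi> t' q"
proof -
  have nat: "\<Phi> (2 * \<tau> * real n) q = q" for n
  proof (induction n)
    case (Suc n)
    have "\<Phi> (2 * \<tau> + 2 * \<tau> * real n) q = q" unfolding \<Phi>_add Suc by (rule \<tau>(2))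
    then show ?case by (simp add: algebra_simps)
  qed (simp add: \<Phi>0)
  have int: "\<Phi> (2 * \<tau> * real_of_int k) q = q" for k
  proof (cases "k \<ge> 0")
    case True
    then show ?thesis using nat[of "nat k"] by simp
  next
    case False
    then have "\<Phi> (- (2 * \<tau> * real_of_int k)) q = q" using nat[of "nat (- k)"] by simp
    then show ?thesis using \<Phi>_inverse(2)[of "2 * \<tau> * real_of_int k" q] by simp
  qed
  define k where "k = \<lceil>(t - \<tau>) / (2 * \<tau>)\<rceil>"
  have k: "real_of_int k - 1 < (t - \<tau>) / (2 * \<tau>)" "(t - \<tau>) / (2 * \<tau>) \<le> real_of_int k"
    unfolding k_def by linarith+
  have k': "(real_of_int k - 1) * (2 * \<tau>) < t - \<tau>" "t - \<tau> \<le> real_of_int k * (2 * \<tau>)"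
    using k \<tau>(1) by (simp_all add: pos_less_divide_eq pos_divide_le_eq)
  show ?thesis
  proof (rule that[of "t - 2 * \<tau> * real_of_int k"])
    show "\<Phi> t q = \<Phi> (t - 2 * \<tau> * real_of_int k) q"
      using \<Phi>_add[of "t - 2 * \<tau> * real_of_int k" "2 * \<tau> * real_of_int k" q] int[of k] by simp
  qed (use k' in \<open>auto simp: algebra_simps\<close>)
qed

lemma orbit_confined:
  assumes "q \<in> S" shows "norm (\<Phi> t q) < r0"
proof -
  obtain \<tau> where \<tau>: "0 < \<tau>" "\<tau> \<le> T0" "\<Phi> (2 * \<tau>) q = q" using half_period[OF assms] by blast
  obtain t' where "- \<tau> < t'" "t' \<le> \<tau>" "\<Phi> t q = \<Phi> t' q" using period_reduction[OF \<tau>(1,3)] by blast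
  then show ?thesis using confined_short[OF S_D(3)[OF assms], of t'] \<tau> by simp
qed

text \<open>Over one period \<open>(- \<tau>, \<tau>]\<close> the coordinate \<open>\<phi>\<^sub>1\<close> is negative, then zero with positive velocity, then
  positive, then zero with nonpositive velocity.\<close>

lemma first_return:
  assumes q: "q \<in> S" and t: "\<Phi> t q $ 1 = 0" "\<Phi> t q $ 2 > 0"
  shows "\<Phi> t q = q"
proof -
  obtain \<tau> where \<tau>: "0 < \<tau>" "\<tau> \<le> T0" "\<Phi> \<tau> q $ 1 = 0" "\<And>t. 0 < t \<Longrightarrow> t < \<tau> \<Longrightarrow> \<Phi> t q $ 1 > 0" "\<Phi> \<tau> q $ 2 \<le> 0"
    "\<Phi> (2 * \<tau>) q = q" using half_period[OF q] by blast
  obtain t' where t': "- \<tau> < t'" "t' \<le> \<tau>" "\<Phi> t q = \<Phi> t' q" using period_reduction[OF \<tau>(1,6)] by blast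
  consider "t' < 0" | "t' = 0" | "0 < t'" "t' < \<tau>" | "t' = \<tau>" using t' by linarith
  then show ?thesis
  proof cases
    case 1
    have "mirror (\<Phi> (- t') q) = \<Phi> t' q" by (rule \<Phi>_mirror[OF q]) (use t' \<tau> 1 in auto)
    then have "\<Phi> t' q $ 1 = - (\<Phi> (- t') q $ 1)" by (metis mirror_def vector_3(1))
    then show ?thesis using \<tau>(4)[of "- t'"] t t' 1 by simp
  qed (use t t' \<tau> \<Phi>0 \<tau>(4)[of t'] in auto)
qed

lemma W_I: "q \<in> S \<Longrightarrow> \<Phi> t q \<in> W" by (auto simp: W_def)

lemma S_W: "q \<in> S \<Longrightarrow> q \<in> W" using W_I[of q 0] by (simp add: \<Phi>0)

lemma W_E: assumes "p \<in> W" obtains t q where "q \<in> S" "p = \<Phi> t q" using assms by (auto simp: W_def)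

lemma W_invariant: "p \<in> W \<Longrightarrow> \<Phi> t p \<in> W"
  by (erule W_E) (simp add: W_I flip: \<Phi>_add)

lemma W_ball: "W \<subseteq> ball 0 r0"
  using orbit_confined by (auto simp: W_def)

lemma \<Phi>_solution:
  assumes "p \<in> W" shows "((\<lambda>t. \<Phi> t p) has_vector_derivative X (\<Phi> t p)) (at t)"
  using \<Phi>_deriv[of t p] W_invariant[OF assms, of t] W_ball r0 by force

text \<open>Uniqueness holds for the original field without restriction to the ball, so an arbitrary solution
  that meets \<open>W\<close> coincides with a periodic orbit.\<close>

lemma solution_eq_flow:
  assumes x: "solution_on X J x" and s: "s \<in> J" "x s \<in> W" and t: "t \<in> J"
  shows "x t = \<Phi> (t - s) (x s)"
proof -
  have "((\<lambda>t. \<Phi> (t + - s) (x s)) has_vector_derivative X (\<Phi> (t + - s) (x s))) (at t)" for t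
    by (rule has_vector_derivative_shift[OF \<Phi>_solution[OF s(2)]])
  moreover have "is_interval J" using x by (simp add: solution_on_def)
  ultimately have "solution_on X J (\<lambda>t. \<Phi> (t + - s) (x s))" by (rule solution_on_UNIV_imp)
  from solution_unique[OF analytic x this s(1) t] show ?thesis by (simp add: \<Phi>0)
qed

lemma W_flow_invariant: "flow_invariant X W"
  unfolding flow_invariant_def
proof (intro allI impI subsetI)
  fix J x p assume x: "solution_on X J x" "\<exists>s\<in>J. x s \<in> W" "p \<in> x ` J"
  then obtain s t where "s \<in> J" "x s \<in> W" "t \<in> J" "p = x t" by blast
  then show "p \<in> W" using solution_eq_flow[OF x(1)] W_invariant by metis
qed

lemma orbit_not_constant:
  assumes "p \<in> W" shows "\<exists>t. \<Phi> t p \<noteq> p"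
proof (rule ccontr)
  assume "\<not> ?thesis"
  then have c: "\<Phi> t p = p" for t by blast
  obtain t q where q: "q \<in> S" "p = \<Phi> t q" using assms by (rule W_E)
  then have "p = q" using c[of "- t"] \<Phi>_inverse by simp
  obtain \<tau> where \<tau>: "0 < \<tau>" "\<And>t. 0 < t \<Longrightarrow> t < \<tau> \<Longrightarrow> \<Phi> t q $ 1 > 0" using half_period[OF q(1)] by blast
  show False using \<tau>(2)[of "\<tau>/2"] \<tau>(1) c[of "\<tau>/2"] \<open>p = q\<close> S_D(1)[OF q(1)] by simp
qed

lemma X_nonzero: assumes "p \<in> W" shows "X p \<noteq> 0"
proof
  assume 0: "X p = 0"
  have "solution_on X UNIV (\<lambda>t. p)" by (rule solution_on_UNIV_imp) (auto simp: 0)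
  moreover have "solution_on X UNIV (\<lambda>t. \<Phi> t p)" by (rule solution_on_UNIV_imp[OF \<Phi>_solution[OF assms]]) simp
  ultimately have "p = \<Phi> t p" for t
    using solution_unique[OF analytic, of UNIV "\<lambda>t. p" "\<lambda>t. \<Phi> t p" 0 t] by (simp add: \<Phi>0)
  then show False using orbit_not_constant[OF assms] by metis
qed

lemma W_periodic: "filled_by_nonconstant_periodic X W"
  unfolding filled_by_nonconstant_periodic_def
proof
  fix p assume p: "p \<in> W"
  then obtain t q where q: "q \<in> S" "p = \<Phi> t q" by (rule W_E)
  obtain \<tau> where \<tau>: "0 < \<tau>" "\<Phi> (2 * \<tau>) q = q" using half_period[OF q(1)] by blast
  show "\<exists>x T. solution_on X UNIV x \<and> x 0 = p \<and> T > 0 \<and> (\<forall>t. x (t + T) = x t) \<and> (\<exists>t. x t \<noteq> p)"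
  proof (intro exI conjI allI)
    show "solution_on X UNIV (\<lambda>t. \<Phi> t p)" by (rule solution_on_UNIV_imp[OF \<Phi>_solution[OF p]]) simp
    show "\<Phi> 0 p = p" by (rule \<Phi>0)
    show "2 * \<tau> > 0" using \<tau> by simp
    fix s
    have "\<Phi> (2 * \<tau>) p = \<Phi> (t + 2 * \<tau>) q" by (simp add: q(2) add.commute flip: \<Phi>_add)
    also have "\<dots> = p" by (simp add: \<Phi>_add \<tau>(2) q(2))
    finally show "\<Phi> (s + 2 * \<tau>) p = \<Phi> s p" by (simp add: \<Phi>_add)
    show "\<Phi> (SOME t. \<Phi> t p \<noteq> p) p \<noteq> p" using someI_ex[OF orbit_not_constant[OF p]] .
  qed
qed

lemma S_nonempty: "S \<noteq> {}"
proof -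
  have "norm ((\<eta>/2) *\<^sub>R axis 2 1 :: real^3) < \<eta>" using \<eta> by simp
  then have "(\<eta>/2) *\<^sub>R axis 2 1 \<in> S" using \<eta> by (simp add: S_def axis_def)
  then show ?thesis by blast
qed

end

section \<open>First integrals from the first return\<close>

lemma vector_4 [simp]:
  "(vector [w,x,y,z] :: ('a::zero)^4) $ 1 = w"
  "(vector [w,x,y,z] :: ('a::zero)^4) $ 2 = x"
  "(vector [w,x,y,z] :: ('a::zero)^4) $ 3 = y"
  "(vector [w,x,y,z] :: ('a::zero)^4) $ 4 = z"
  unfolding vector_def by simp_all

lemma has_vector_derivative_vec_iff:
  fixes x :: "real \<Rightarrow> real^'n"
  shows "(x has_vector_derivative x') F \<longleftrightarrow> (\<forall>i. ((\<lambda>t. x t $ i) has_vector_derivative x' $ i) F)"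
  unfolding has_vector_derivative_def has_derivative_vec_nth_iff by simp

context reversible_center begin

text \<open>Near the section the field \<open>X / v\<^sub>1\<close> has \<open>\<phi>\<^sub>1\<close> as its time, so following it for time \<open>- \<phi>\<^sub>1\<close> leads from
  a point \<open>p\<close> to the section along the orbit of \<open>p\<close>. This is the time-one map of the field
  \<open>(t, z) \<mapsto> (0, t X z / v\<^sub>1)\<close> started at \<open>(- \<phi>\<^sub>1, p)\<close>. The augmented field vanishes where \<open>t = 0\<close>, in
  particular at the base point \<open>(0, q)\<close>, and so \<open>analytic_flow\<close> applies.\<close>

lemma section_projection:
  assumes q: "q \<in> S"
  obtains e Q where "e > 0" "\<And>i. real_analytic_on (ball q e) (\<lambda>p. Q p $ i)"
    "\<And>p. p \<in> ball q e \<Longrightarrow> Q p \<in> S \<and> (\<exists>t. p = \<Phi> t (Q p))"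
proof -
  define a where "a = q $ 2"
  have a: "a > 0" using S_D(2)[OF q] by (simp add: a_def)
  define emb :: "real^3 \<Rightarrow> real^4" where "emb p = vector [- (p $ 1), p $ 1, p $ 2, p $ 3]" for p
  define prj :: "real^4 \<Rightarrow> real^3" where "prj w = vector [w $ 2, w $ 3, w $ 4]" for w
  define G :: "real^4 \<Rightarrow> real^4" where
    "G w = vector [0, w $ 1, w $ 1 * X (prj w) $ 2 / w $ 3, w $ 1 * X (prj w) $ 3 / w $ 3]" for w
  define b where "b = emb q"
  have emb_ana: "real_analytic_on U (\<lambda>p. emb p $ i)" for i U
    using exhaust_4[of i] by (elim disjE) (simp_all add: emb_def real_analytic_on_nth real_analytic_on_minus[OF real_analytic_on_nth])
  have prj_ana: "real_analytic_on U (\<lambda>p. prj p $ i)" for i U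
    using exhaust_3[of i] by (auto simp: prj_def intro: real_analytic_on_nth)
  have w3: "w $ 3 \<ge> a / 2" "w $ 3 > 0" if "w \<in> ball b (a/2)" for w
  proof -
    have "\<bar>(w - b) $ 3\<bar> \<le> norm (w - b)" by (rule component_le_norm_cart)
    also have "\<dots> < a/2" using that by (simp add: dist_norm norm_minus_commute)
    finally have "\<bar>w $ 3 - a\<bar> < a / 2" by (simp add: b_def emb_def a_def)
    then show "w $ 3 \<ge> a / 2" by linarith
    then show "w $ 3 > 0" using a by simp
  qed
  have XG: "real_analytic_on (ball b (a/2)) (\<lambda>w. w $ 1 * X (prj w) $ j / w $ 3)" for j
    by (intro real_analytic_on_mult real_analytic_on_divide real_analytic_on_nth
        real_analytic_on_compose[OF analytic prj_ana]) (use w3(2) in force)+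
  have G_ana: "real_analytic_on (ball b (a/2)) (\<lambda>w. G w $ i)" for i
    using exhaust_4[of i] by (auto simp: G_def intro: real_analytic_on_nth real_analytic_on_const XG)
  have Gb: "G b = 0" using S_D(1)[OF q] by (simp add: G_def b_def emb_def vec_eq_iff forall_4)
  have a2: "a / 2 > 0" using a by simp
  obtain R' L' and \<Psi> :: "real \<Rightarrow> real^4 \<Rightarrow> real^4" where \<Psi>: "0 < R'" "R' < a/2" "0 \<le> L'" "\<And>p. \<Psi> 0 p = p"
    "\<And>s t p. \<Psi> (s + t) p = \<Psi> s (\<Psi> t p)"
    "\<And>t p q. norm (\<Psi> t p - \<Psi> t q) \<le> exp (L' * \<bar>t\<bar>) * norm (p - q)"
    "\<And>t. \<Psi> t b = b" "\<And>p. continuous_on UNIV (\<lambda>t. \<Psi> t p)"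
    "\<And>t p. \<Psi> t p \<in> cball b R' \<Longrightarrow> ((\<lambda>t. \<Psi> t p) has_vector_derivative G (\<Psi> t p)) (at t)"
    "\<And>T. \<exists>r>0. \<forall>s\<in>{-T..T}. \<forall>i. real_analytic_on (ball b r) (\<lambda>p. \<Psi> s p $ i)"
    by (rule analytic_flow[OF G_ana Gb a2]) (rule that)
  obtain r where r: "r > 0" "\<And>s i. s \<in> {-1..1} \<Longrightarrow> real_analytic_on (ball b r) (\<lambda>p. \<Psi> s p $ i)"
    using \<Psi>(10)[of 1] by blast
  define e1 where "e1 = min r (R' * exp (- L'))"
  have e1: "e1 > 0" "e1 \<le> r" "e1 \<le> R' * exp (- L')" using r(1) \<Psi>(1) by (auto simp: e1_def)
  have conf: "\<Psi> s w \<in> cball b R'" if "w \<in> ball b e1" "\<bar>s\<bar> \<le> 1" for w s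
  proof -
    have "norm (\<Psi> s w - b) \<le> exp (L' * \<bar>s\<bar>) * norm (w - b)" using \<Psi>(6)[of s w b] \<Psi>(7) by simp
    also have "\<dots> \<le> exp L' * (R' * exp (- L'))"
    proof (rule mult_mono)
      show "exp (L' * \<bar>s\<bar>) \<le> exp L'" using mult_left_mono[OF that(2) \<Psi>(3)] by simp
      show "norm (w - b) \<le> R' * exp (- L')" using that(1) e1(3) by (simp add: dist_norm norm_minus_commute)
    qed auto
    also have "\<dots> = R'" by (simp add: exp_minus)
    finally show ?thesis by (simp add: dist_norm norm_minus_commute)
  qed
  define Q where "Q p = prj (\<Psi> 1 (emb p))" for p
  define V where "V = emb -` ball b e1"
  have "continuous_on UNIV emb"
    by (rule real_analytic_vec_continuous[OF emb_ana])
  then have V: "open V" unfolding V_def by (rule open_vimage[OF open_ball])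
  have Q_ana: "real_analytic_on V (\<lambda>p. Q p $ i)" for i
    unfolding Q_def
  proof (rule real_analytic_on_compose[OF prj_ana[of UNIV]])
    show "real_analytic_on V (\<lambda>p. \<Psi> 1 (emb p) $ j)" for j
      by (rule real_analytic_on_compose[OF r(2)[of 1 j] emb_ana]) (use e1(2) in \<open>auto simp: V_def\<close>)
  qed simp
  have main: "Q p $ 1 = 0 \<and> (\<exists>t. p = \<Phi> t (Q p))"
    if p: "p \<in> V" "norm p < \<eta>" "\<bar>p $ 1\<bar> \<le> T0 * (a/2)" for p
  proof -
    define w where "w s = \<Psi> s (emb p)" for s
    have w0: "w 0 = emb p" by (simp add: w_def \<Psi>(4))
    have wR: "w s \<in> cball b R'" if "\<bar>s\<bar> \<le> 1" for s
      unfolding w_def by (rule conf) (use p(1) that in \<open>auto simp: V_def\<close>)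
    have wd: "(w has_vector_derivative G (w s)) (at s)" if "\<bar>s\<bar> \<le> 1" for s
      unfolding w_def by (rule \<Psi>(9)) (use wR[OF that] in \<open>simp add: w_def\<close>)
    have wb: "w s \<in> ball b (a/2)" if "\<bar>s\<bar> \<le> 1" for s using wR[OF that] \<Psi>(2) by auto
    note wdi = has_vector_derivative_vec_nth[OF wd]
    have w1: "w s $ 1 = - (p $ 1)" if "\<bar>s\<bar> \<le> 1" for s
    proof -
      have "norm (w s $ 1 - w 0 $ 1) \<le> 0 * \<bar>s\<bar>"
        by (rule vector_derivative_bound_line[where x="\<lambda>s. w s $ 1", OF wdi]) (use that in \<open>auto simp: G_def\<close>)
      then show ?thesis by (simp add: w0 emb_def)
    qed
    have "norm ((w 1 $ 2 + 1 * p $ 1) - (w 0 $ 2 + 0 * p $ 1)) \<le> 0 * \<bar>1\<bar>"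
    proof (rule vector_derivative_bound_line[where x="\<lambda>s. w s $ 2 + s * p $ 1"])
      fix s :: real assume s: "\<bar>s\<bar> \<le> \<bar>1\<bar>"
      show "((\<lambda>s. w s $ 2 + s * p $ 1) has_vector_derivative G (w s) $ 2 + p $ 1) (at s)"
        using wdi[of s 2] s by (auto intro!: derivative_eq_intros has_vector_derivative_add
            simp: has_real_derivative_iff_has_vector_derivative[symmetric])
      show "norm (G (w s) $ 2 + p $ 1) \<le> 0" using w1[of s] s by (simp add: G_def)
    qed
    then have "w 1 $ 2 = 0" by (simp add: w0 emb_def)
    then have Q1: "Q p $ 1 = 0" by (simp add: Q_def prj_def w_def)
    \<comment> \<open>The change of time between the rescaled field and \<open>X\<close>. The maximum equals the third coordinate of
      \<open>w s\<close>, the velocity \<open>v\<^sub>1\<close>, for the times in use and keeps \<open>h\<close> continuous for all others.\<close>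
    define h where "h s = - (p $ 1) / max (w s $ 3) (a/2)" for s
    have cw: "continuous_on UNIV w" unfolding w_def by (rule \<Psi>(8))
    have "continuous_on UNIV (\<lambda>s. - (p $ 1) / max (w s $ 3) (a/2))"
      by (intro continuous_intros cw ballI) (use a in \<open>auto simp: max_def\<close>)
    then obtain \<sigma> where \<sigma>: "\<sigma> 0 = 0" "\<And>s. (\<sigma> has_vector_derivative h s) (at s)"
      using antiderivative_exists[of h] unfolding h_def by blast
    have hb: "\<bar>h s\<bar> \<le> T0" for s
    proof -
      have m: "max (w s $ 3) (a/2) \<ge> a/2" "max (w s $ 3) (a/2) > 0" using a by (auto simp: max_def)
      have "T0 * (a/2) \<le> T0 * max (w s $ 3) (a/2)" using m(1) T0 by (intro mult_left_mono) auto
      then show ?thesis using p(3) m(2) by (simp add: h_def abs_divide pos_divide_le_eq)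
    qed
    have \<sigma>b: "\<bar>\<sigma> s\<bar> \<le> T0" if "\<bar>s\<bar> \<le> 1" for s
    proof -
      have "norm (\<sigma> s - \<sigma> 0) \<le> T0 * \<bar>s\<bar>" by (rule vector_derivative_bound_line[OF \<sigma>(2)]) (use hb in simp)
      also have "\<dots> \<le> T0 * 1" using that T0 by (intro mult_left_mono) auto
      finally show ?thesis by (simp add: \<sigma>(1))
    qed
    define z where "z s = prj (w s)" for s
    define y where "y s = \<Phi> (\<sigma> s) p" for s
    have zd: "(z has_vector_derivative h s *\<^sub>R X (z s)) (at s)" if s: "\<bar>s\<bar> \<le> 1" for s
    proof -
      have h: "h s = w s $ 1 / w s $ 3" "w s $ 3 \<noteq> 0" using w3[OF wb[OF s]] w1[OF s] by (auto simp: h_def max_def)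
      show ?thesis
        unfolding has_vector_derivative_vec_iff forall_3
        using wdi[OF s, of 2] wdi[OF s, of 3] wdi[OF s, of 4] h
        by (simp add: z_def[abs_def] prj_def G_def X1)
    qed
    have yr: "norm (y s) < r0" if "\<bar>s\<bar> \<le> 1" for s
      unfolding y_def by (rule confined_short[OF p(2) \<sigma>b[OF that]])
    have yd: "(y has_vector_derivative h s *\<^sub>R X (y s)) (at s)" if s: "\<bar>s\<bar> \<le> 1" for s
      using vector_diff_chain_at[OF \<sigma>(2) \<Phi>_deriv_short[OF p(2) \<sigma>b[OF s]]] by (simp add: y_def[abs_def] o_def)
    have "compact (z ` {0..1})"
      by (intro compact_continuous_image continuous_at_imp_continuous_on ballI has_vector_derivative_continuous[OF zd]) auto
    then obtain B where B: "\<forall>v\<in>z ` {0..1}. norm v \<le> B" using compact_imp_bounded bounded_iff by blast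
    obtain LX where LX: "LX \<ge> 0" "\<And>p q. p \<in> cball 0 (max B r0) \<Longrightarrow> q \<in> cball 0 (max B r0) \<Longrightarrow> norm (X p - X q) \<le> LX * norm (p - q)"
      using real_analytic_lipschitz_cball[OF analytic, of "max B r0"] by blast
    have "norm (z 1 - y 1) \<le> exp ((T0 * LX) * \<bar>1 - 0\<bar>) * norm (z 0 - y 0)"
    proof (rule gronwall[where J="{0..1}" and d="\<lambda>s. z s - y s" and d'="\<lambda>s. h s *\<^sub>R X (z s) - h s *\<^sub>R X (y s)"])
      fix s :: real assume s: "s \<in> {0..1}"
      show "((\<lambda>s. z s - y s) has_vector_derivative h s *\<^sub>R X (z s) - h s *\<^sub>R X (y s)) (at s within {0..1})"
        by (rule has_vector_derivative_at_within[OF has_vector_derivative_diff[OF zd yd]]) (use s in auto)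
      have "z s \<in> cball 0 (max B r0)" using B s by (auto simp: le_max_iff_disj)
      moreover have "y s \<in> cball 0 (max B r0)" using yr[of s] s by auto
      ultimately have "norm (X (z s) - X (y s)) \<le> LX * norm (z s - y s)" by (rule LX(2))
      then have "\<bar>h s\<bar> * norm (X (z s) - X (y s)) \<le> T0 * (LX * norm (z s - y s))"
        using T0 by (intro mult_mono hb) auto
      then show "norm (h s *\<^sub>R X (z s) - h s *\<^sub>R X (y s)) \<le> T0 * LX * norm (z s - y s)"
        by (simp flip: scaleR_diff_right)
    qed (auto simp: is_interval_cc)
    moreover have "z 0 = y 0" by (simp add: z_def y_def w0 \<sigma>(1) \<Phi>0 emb_def prj_def vec_eq_iff forall_3)
    ultimately have "Q p = \<Phi> (\<sigma> 1) p" by (simp add: Q_def z_def y_def w_def)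
    then have "p = \<Phi> (- \<sigma> 1) (Q p)" by (simp add: \<Phi>_inverse)
    with Q1 show ?thesis by blast
  qed
  have contQ: "continuous_on V Q"
    by (rule real_analytic_vec_continuous[OF Q_ana])
  have Qq: "Q q = q" using S_D(1)[OF q] \<Psi>(7)[of 1]
    by (simp add: Q_def flip: b_def) (simp add: b_def emb_def prj_def vec_eq_iff forall_3)
  define A where "A = {z :: real^3. z $ 2 > 0} \<inter> ball 0 \<eta>"
  define A' where "A' = ball (0::real^3) \<eta> \<inter> {p. \<bar>p $ 1\<bar> < T0 * (a/2)}"
  have "open A" unfolding A_def
    by (intro open_Int open_ball) (auto simp: continuous_on_component intro!: open_Collect_less continuous_intros)
  then have "open (V \<inter> Q -` A)" by (rule continuous_open_preimage[OF contQ V])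
  moreover have "open A'" unfolding A'_def
    by (intro open_Int open_ball) (auto simp: continuous_on_component intro!: open_Collect_less continuous_intros)
  ultimately have "open (V \<inter> Q -` A \<inter> A')" by (rule open_Int)
  moreover have "q \<in> V \<inter> Q -` A \<inter> A'"
    using S_D[OF q] e1 T0 a by (auto simp: A_def A'_def V_def Qq simp flip: b_def)
  ultimately obtain e where e: "e > 0" "ball q e \<subseteq> V \<inter> Q -` A \<inter> A'" by (rule openE)
  show ?thesis
  proof (rule that[OF e(1)])
    show "real_analytic_on (ball q e) (\<lambda>p. Q p $ i)" for i
      by (rule real_analytic_on_subset[OF Q_ana]) (use e(2) in blast)
    fix p assume "p \<in> ball q e"
    then have p: "p \<in> V" "Q p \<in> A" "p \<in> A'" using e(2) by auto
    then have "Q p $ 1 = 0 \<and> (\<exists>t. p = \<Phi> t (Q p))" by (intro main) (auto simp: A'_def)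
    then show "Q p \<in> S \<and> (\<exists>t. p = \<Phi> t (Q p))" using p(2) by (auto simp: S_def A_def)
  qed
qed

lemma W_open: "open W"
  unfolding open_subopen[of W]
proof
  fix p assume "p \<in> W"
  then obtain t q where q: "q \<in> S" "p = \<Phi> t q" by (rule W_E)
  obtain e Q where eQ: "e > 0" "\<And>i. real_analytic_on (ball q e) (\<lambda>p. Q p $ i)"
    "\<And>p. p \<in> ball q e \<Longrightarrow> Q p \<in> S \<and> (\<exists>t. p = \<Phi> t (Q p))" using section_projection[OF q(1)] by blast
  show "\<exists>T. open T \<and> p \<in> T \<and> T \<subseteq> W"
  proof (intro exI conjI subsetI)
    show "open (\<Phi> (- t) -` ball q e)" by (rule open_vimage[OF open_ball \<Phi>_continuous])
    show "p \<in> \<Phi> (- t) -` ball q e" using eQ(1) by (simp add: q(2) \<Phi>_inverse)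
    fix p' assume "p' \<in> \<Phi> (- t) -` ball q e"
    then obtain u where u: "Q (\<Phi> (- t) p') \<in> S" "\<Phi> (- t) p' = \<Phi> u (Q (\<Phi> (- t) p'))" using eQ(3) by auto
    have "\<Phi> (- t) p' \<in> W" by (subst u(2)) (rule W_I[OF u(1)])
    from W_invariant[OF this, of t] show "p' \<in> W" by (simp add: \<Phi>_inverse)
  qed
qed

text \<open>Analyticity of short-time maps near the origin extends to all times because \<open>W\<close> is invariant and lies
  near the origin: long times are compositions of short ones.\<close>

lemma \<Phi>_analytic_W: "real_analytic_on W (\<lambda>p. \<Phi> t p $ i)"
proof -
  have "\<forall>t i. \<bar>t\<bar> \<le> real n \<longrightarrow> real_analytic_on W (\<lambda>p. \<Phi> t p $ i)" for n
  proof (induction n)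
    case 0 show ?case by (auto simp: \<Phi>0 real_analytic_on_nth)
  next
    case (Suc n)
    show ?case
    proof (intro allI impI)
      fix t i assume t: "\<bar>t\<bar> \<le> real (Suc n)"
      define s where "s = t / real (Suc n)"
      have s: "s \<in> {-1..1}" using t by (auto simp: s_def field_simps abs_le_iff)
      have "s * real (Suc n) = t" by (simp add: s_def del: of_nat_Suc)
      then have "t = s * real n + s" by (simp add: algebra_simps)
      then have "\<bar>t - s\<bar> = \<bar>s\<bar> * real n" by (simp add: abs_mult)
      also have "\<dots> \<le> 1 * real n" using s by (intro mult_right_mono) auto
      finally have "\<bar>t - s\<bar> \<le> real n" by simp
      then have ts: "real_analytic_on W (\<lambda>p. \<Phi> (t - s) p $ j)" for j using Suc.IH by blast
      have "real_analytic_on W (\<lambda>p. \<Phi> s (\<Phi> (t - s) p) $ i)"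
        by (rule real_analytic_on_compose[OF \<Phi>_analytic[OF s] ts]) (use W_invariant W_ball in blast)
      then show "real_analytic_on W (\<lambda>p. \<Phi> t p $ i)" by (simp flip: \<Phi>_add)
    qed
  qed
  then show ?thesis using real_arch_simple[of "\<bar>t\<bar>"] by blast
qed

text \<open>The crossing of the orbit of \<open>p\<close> with the section.\<close>

definition "P p = (THE q. q \<in> S \<and> (\<exists>t. p = \<Phi> t q))"

lemma P_eq: assumes "q \<in> S" shows "P (\<Phi> t q) = q"
  unfolding P_def
proof (rule the_equality)
  show "q \<in> S \<and> (\<exists>t'. \<Phi> t q = \<Phi> t' q)" using assms by blast
  fix q' assume q': "q' \<in> S \<and> (\<exists>t'. \<Phi> t q = \<Phi> t' q')"
  then obtain t' where t': "\<Phi> t q = \<Phi> t' q'" by blast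
  have "q' = \<Phi> (- t') (\<Phi> t q)" by (simp add: t' \<Phi>_inverse)
  then have q'': "q' = \<Phi> (- t' + t) q" unfolding \<Phi>_add .
  then show "q' = q" using first_return[OF assms, of "- t' + t"] q' S_D by metis
qed

lemma P_S: "q \<in> S \<Longrightarrow> P q = q" using P_eq[of q 0] by (simp add: \<Phi>0)

lemma P_flow: "p \<in> W \<Longrightarrow> P (\<Phi> t p) = P p"
  by (erule W_E) (simp add: P_eq flip: \<Phi>_add)

text \<open>Around \<open>\<Phi> t q\<close> the map \<open>P\<close> is the local projection near \<open>q\<close> after the backward flow.\<close>

lemma P_analytic: "real_analytic_on W (\<lambda>p. P p $ i)"
proof (rule real_analytic_on_local)
  fix p assume p: "p \<in> W"
  then obtain t q where q: "q \<in> S" "p = \<Phi> t q" by (rule W_E)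
  obtain e Q where eQ: "e > 0" "\<And>i. real_analytic_on (ball q e) (\<lambda>p. Q p $ i)"
    "\<And>p. p \<in> ball q e \<Longrightarrow> Q p \<in> S \<and> (\<exists>t. p = \<Phi> t (Q p))" using section_projection[OF q(1)] by blast
  let ?V = "W \<inter> \<Phi> (- t) -` ball q e"
  show "\<exists>V g. open V \<and> p \<in> V \<and> real_analytic_on V g \<and> (\<forall>q\<in>V. g q = P q $ i)"
  proof (intro exI conjI ballI)
    show "open ?V" by (intro open_Int W_open open_vimage[OF open_ball \<Phi>_continuous])
    show "p \<in> ?V" using eQ(1) p by (simp add: q(2) \<Phi>_inverse)
    show "real_analytic_on ?V (\<lambda>p. Q (\<Phi> (- t) p) $ i)"
      by (rule real_analytic_on_compose[OF eQ(2) real_analytic_on_subset[OF \<Phi>_analytic_W]]) auto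
    fix p' assume p': "p' \<in> ?V"
    then obtain u where u: "Q (\<Phi> (- t) p') \<in> S" "\<Phi> (- t) p' = \<Phi> u (Q (\<Phi> (- t) p'))" using eQ(3) by auto
    have "P p' = P (\<Phi> (- t) p')" using p' by (simp add: P_flow)
    also have "\<dots> = Q (\<Phi> (- t) p')" by (subst u(2)) (rule P_eq[OF u(1)])
    finally show "Q (\<Phi> (- t) p') $ i = P p' $ i" by simp
  qed
qed

lemma P_derivative_section:
  assumes q: "q \<in> S" and v: "v $ 1 = 0"
  shows "frechet_derivative (\<lambda>p. P p $ i) (at q) v = v $ i"
proof -
  have d: "((\<lambda>p. P p $ i) has_derivative frechet_derivative (\<lambda>p. P p $ i) (at q)) (at q)"
    by (rule real_analytic_on_has_derivative[OF P_analytic S_W[OF q]])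
  have lin: "linear (frechet_derivative (\<lambda>p. P p $ i) (at q))" using d by (rule has_derivative_linear)
  have "((\<lambda>s. q + s *\<^sub>R v) has_derivative (\<lambda>s. s *\<^sub>R v)) (at 0)" by (auto intro!: derivative_eq_intros)
  from diff_chain_at[OF this, of "\<lambda>p. P p $ i"] d
  have 1: "((\<lambda>s. P (q + s *\<^sub>R v) $ i) has_derivative (\<lambda>s. frechet_derivative (\<lambda>p. P p $ i) (at q) (s *\<^sub>R v))) (at 0)"
    by (simp add: o_def)
  let ?U = "{s. (q + s *\<^sub>R v) $ 2 > 0} \<inter> {s. norm (q + s *\<^sub>R v) < \<eta>}"
  have "open ?U" by (intro open_Int open_Collect_less continuous_intros)
  moreover have "0 \<in> ?U" using S_D[OF q] by simp
  moreover have "P (q + s *\<^sub>R v) $ i = q $ i + s * v $ i" if "s \<in> ?U" for s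
  proof -
    have "q + s *\<^sub>R v \<in> S" using that v S_D(1)[OF q] by (auto simp: S_def)
    then show ?thesis by (simp add: P_S)
  qed
  ultimately have "((\<lambda>s. q $ i + s * v $ i) has_derivative (\<lambda>s. frechet_derivative (\<lambda>p. P p $ i) (at q) (s *\<^sub>R v))) (at 0)"
    by (rule has_derivative_transform_within_open[OF 1])
  moreover have "((\<lambda>s. q $ i + s * v $ i) has_derivative (\<lambda>s. s * v $ i)) (at 0)"
    by (auto intro!: derivative_eq_intros)
  ultimately have "(\<lambda>s. frechet_derivative (\<lambda>p. P p $ i) (at q) (s *\<^sub>R v)) = (\<lambda>s. s * v $ i)"
    by (rule has_derivative_unique)
  from fun_cong[OF this, of 1] show ?thesis by simp
qed

lemma \<Phi>_has_derivative: "p \<in> W \<Longrightarrow> (\<Phi> t has_derivative frechet_derivative (\<Phi> t) (at p)) (at p)"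
  by (rule real_analytic_vec_has_derivative[OF \<Phi>_analytic_W])

lemma P_derivative_flow:
  assumes p: "p \<in> W"
  shows "frechet_derivative (\<lambda>p. P p $ i) (at (\<Phi> t p)) (frechet_derivative (\<Phi> t) (at p) v)
     = frechet_derivative (\<lambda>p. P p $ i) (at p) v"
proof -
  note d1 = \<Phi>_has_derivative[OF p, of t]
  have d2: "((\<lambda>p. P p $ i) has_derivative frechet_derivative (\<lambda>p. P p $ i) (at (\<Phi> t p))) (at (\<Phi> t p))"
    by (rule real_analytic_on_has_derivative[OF P_analytic W_invariant[OF p]])
  have "((\<lambda>p. P (\<Phi> t p) $ i) has_derivative (\<lambda>v. frechet_derivative (\<lambda>p. P p $ i) (at (\<Phi> t p)) (frechet_derivative (\<Phi> t) (at p) v))) (at p)"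
    using diff_chain_at[OF d1 d2] by (simp add: o_def)
  then have "((\<lambda>p. P p $ i) has_derivative (\<lambda>v. frechet_derivative (\<lambda>p. P p $ i) (at (\<Phi> t p)) (frechet_derivative (\<Phi> t) (at p) v))) (at p)"
    by (rule has_derivative_transform_within_open[OF _ W_open p]) (simp add: P_flow)
  from fun_cong[OF frechet_derivative_at[OF this], of v] show ?thesis by simp
qed

text \<open>On the section the derivatives of the two coordinates of \<open>P\<close> separate the two directions tangent to
  the section; the derivative of the flow transports this to \<open>p\<close>.\<close>

lemma P_independent:
  assumes p: "p \<in> W"
    and 0: "\<And>h. a * frechet_derivative (\<lambda>p. P p $ 2) (at p) h + b * frechet_derivative (\<lambda>p. P p $ 3) (at p) h = 0"
  shows "a = 0 \<and> b = 0"
proof -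
  obtain t q where q: "q \<in> S" "p = \<Phi> t q" using p by (rule W_E)
  have "a * v $ 2 + b * v $ 3 = 0" if "v $ 1 = 0" for v :: "real^3"
    using 0[of "frechet_derivative (\<Phi> t) (at q) v"] P_derivative_section[OF q(1) that]
      P_derivative_flow[OF S_W[OF q(1)], where t=t and v=v] by (simp add: q(2))
  from this[of "axis 2 1"] this[of "axis 3 1"] show ?thesis by (simp add: axis_def)
qed

lemma P_first_integral: "smooth_first_integral X W (\<lambda>p. P p $ i)"
  unfolding smooth_first_integral_def preserves_function_def
proof (intro conjI allI impI ballI)
  show "smooth_on W (\<lambda>p. P p $ i)"
    by (rule real_analytic_imp_smooth[OF W_open]) (simp add: P_analytic)
  fix J x s t assume x: "solution_on X J x" "x ` J \<subseteq> W" "s \<in> J" "t \<in> J"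
  then have "x s \<in> W" by blast
  then show "P (x s) $ i = P (x t) $ i" using solution_eq_flow[OF x(1,3) _ x(4)] by (simp add: P_flow)
qed

lemma P_independent_first_integrals:
  "independent_first_integrals X W (\<lambda>p. P p $ 2) (\<lambda>p. P p $ 3)"
  unfolding independent_first_integrals_def functionally_independent_def
  using P_first_integral P_independent by blast

end

section \<open>An invariant density\<close>

text \<open>The derivative of the full flow fixes the direction of \<open>\<phi>\<^sub>2\<close>; expansion along that column leaves the
  derivative of the reduced flow.\<close>

lemma det_4_invariant_axis:
  fixes A :: "real^4^4" and B :: "real^3^3"
  assumes col: "A $ 1 $ 2 = 0" "A $ 2 $ 2 = 1" "A $ 3 $ 2 = 0" "A $ 4 $ 2 = 0"
    and B: "B $ 1 $ 1 = A $ 1 $ 1" "B $ 1 $ 2 = A $ 1 $ 3" "B $ 1 $ 3 = A $ 1 $ 4"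
      "B $ 2 $ 1 = A $ 3 $ 1" "B $ 2 $ 2 = A $ 3 $ 3" "B $ 2 $ 3 = A $ 3 $ 4"
      "B $ 3 $ 1 = A $ 4 $ 1" "B $ 3 $ 2 = A $ 4 $ 3" "B $ 3 $ 3 = A $ 4 $ 4"
  shows "det A = det B"
proof -
  have f1: "finite {2::4, 3, 4}" "1 \<notin> {2::4, 3, 4}" by auto
  have f2: "finite {3::4, 4}" "2 \<notin> {3::4, 4}" by auto
  have f3: "finite {4::4}" "3 \<notin> {4::4}" by auto
  show ?thesis
    unfolding det_3 B det_def UNIV_4
    unfolding sum_over_permutations_insert[OF f1]
    unfolding sum_over_permutations_insert[OF f2]
    unfolding sum_over_permutations_insert[OF f3]
    unfolding permutes_sing
    by (simp add: sign_swap_id permutation_swap_id sign_compose sign_id swap_id_eq col algebra_simps)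
qed

lemma linear_eq_inner_gradient:
  fixes D :: "real^'n \<Rightarrow> real"
  assumes "linear D"
  shows "D v = (\<chi> j. D (axis j 1)) \<bullet> v"
proof -
  have "(\<Sum>j\<in>UNIV. (v $ j) *\<^sub>R axis j 1) = v"
    using basis_expansion[of v] by (simp add: scalar_mult_eq_scaleR)
  then have "D v = D (\<Sum>j\<in>UNIV. (v $ j) *\<^sub>R axis j 1)" by simp
  also have "\<dots> = (\<Sum>j\<in>UNIV. v $ j * D (axis j 1))" by (simp add: linear_sum[OF assms] linear_scale[OF assms])
  finally show ?thesis by (simp add: inner_vec_def mult.commute)
qed

lemma cross3_parallel:
  fixes u w x :: "real^3"
  assumes "u \<bullet> x = 0" "w \<bullet> x = 0" "x \<noteq> 0"
  shows "cross3 u w = ((cross3 u w \<bullet> x) / (x \<bullet> x)) *\<^sub>R x"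
proof -
  let ?y = "cross3 u w"
  have "cross3 x ?y = 0" using assms(1,2) by (simp add: Lagrange inner_commute)
  then have "(x \<bullet> ?y) *\<^sub>R x - (x \<bullet> x) *\<^sub>R ?y = 0" using Lagrange[of x x ?y] by simp
  then have "(x \<bullet> x) *\<^sub>R ?y = (?y \<bullet> x) *\<^sub>R x" by (simp add: inner_commute)
  then have "(1 / (x \<bullet> x)) *\<^sub>R ((x \<bullet> x) *\<^sub>R ?y) = (1 / (x \<bullet> x)) *\<^sub>R ((?y \<bullet> x) *\<^sub>R x)" by simp
  then show ?thesis using assms(3) by simp
qed

context reversible_center begin

definition grad :: "3 \<Rightarrow> real^3 \<Rightarrow> real^3" where
  "grad i p = (\<chi> j. frechet_derivative (\<lambda>p. P p $ i) (at p) (axis j 1))"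

lemma grad: "p \<in> W \<Longrightarrow> frechet_derivative (\<lambda>p. P p $ i) (at p) v = grad i p \<bullet> v"
  unfolding grad_def
  by (rule linear_eq_inner_gradient[OF has_derivative_linear[OF real_analytic_on_has_derivative[OF P_analytic]]])

lemma grad_X:
  assumes "p \<in> W" shows "grad i p \<bullet> X p = 0"
proof -
  have 1: "((\<lambda>t. \<Phi> t p) has_derivative (\<lambda>t. t *\<^sub>R X p)) (at 0)"
    using \<Phi>_solution[OF assms, of 0] by (simp add: has_vector_derivative_def \<Phi>0)
  have 2: "((\<lambda>p. P p $ i) has_derivative (\<lambda>v. grad i p \<bullet> v)) (at (\<Phi> 0 p))"
  proof -
    have "frechet_derivative (\<lambda>p. P p $ i) (at p) = (\<lambda>v. grad i p \<bullet> v)" by (simp add: fun_eq_iff grad[OF assms])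
    then show ?thesis using real_analytic_on_has_derivative[OF P_analytic assms, of i] by (simp add: \<Phi>0)
  qed
  have "((\<lambda>t. P p $ i) has_derivative (\<lambda>t. grad i p \<bullet> (t *\<^sub>R X p))) (at 0)"
    using diff_chain_at[OF 1 2] by (simp add: o_def P_flow[OF assms])
  then have "(\<lambda>t::real. grad i p \<bullet> (t *\<^sub>R X p)) = (\<lambda>t. 0)"
    using has_derivative_unique has_derivative_const by blast
  from fun_cong[OF this, of 1] show ?thesis by simp
qed

definition "lam p = (cross3 (grad 2 p) (grad 3 p) \<bullet> X p) / (X p \<bullet> X p)"

text \<open>Both gradients are orthogonal to \<open>X\<close>, and in three dimensions their cross product is then a multiple
  of \<open>X\<close>.\<close>

lemma cross_grad: "p \<in> W \<Longrightarrow> cross3 (grad 2 p) (grad 3 p) = lam p *\<^sub>R X p"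
  unfolding lam_def by (intro cross3_parallel grad_X X_nonzero)

lemma lam_nonzero: assumes "p \<in> W" shows "lam p \<noteq> 0"
proof
  assume "lam p = 0"
  then have "collinear {0, grad 2 p, grad 3 p}" using cross_grad[OF assms] by (simp add: cross_eq_0)
  then consider "grad 2 p = 0" | "grad 3 p = 0" | c where "grad 3 p = c *\<^sub>R grad 2 p"
    unfolding collinear_lemma by blast
  then show False
  proof cases
    case 1 then show ?thesis using P_independent[OF assms, of 1 0] by (simp add: grad[OF assms])
  next
    case 2 then show ?thesis using P_independent[OF assms, of 0 1] by (simp add: grad[OF assms])
  next
    case 3 then show ?thesis using P_independent[OF assms, of "-c" 1] by (simp add: grad[OF assms])
  qed
qed

lemma \<Phi>_derivative_X:
  assumes p: "p \<in> W" shows "frechet_derivative (\<Phi> t) (at p) (X p) = X (\<Phi> t p)"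
proof -
  have 1: "((\<lambda>s. \<Phi> s p) has_derivative (\<lambda>s. s *\<^sub>R X p)) (at 0)"
    using \<Phi>_solution[OF p, of 0] by (simp add: has_vector_derivative_def \<Phi>0)
  have 2: "(\<Phi> t has_derivative frechet_derivative (\<Phi> t) (at p)) (at (\<Phi> 0 p))"
    using \<Phi>_has_derivative[OF p] by (simp add: \<Phi>0)
  have a: "((\<lambda>s. \<Phi> t (\<Phi> s p)) has_derivative (\<lambda>s. frechet_derivative (\<Phi> t) (at p) (s *\<^sub>R X p))) (at 0)"
    using diff_chain_at[OF 1 2] by (simp add: o_def)
  have b: "((\<lambda>s. \<Phi> (s + t) p) has_derivative (\<lambda>s. s *\<^sub>R X (\<Phi> (0 + t) p))) (at 0)"
    unfolding has_vector_derivative_def[symmetric] by (rule has_vector_derivative_shift[OF \<Phi>_solution[OF p]])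
  have c: "(\<lambda>s. \<Phi> t (\<Phi> s p)) = (\<lambda>s. \<Phi> (s + t) p)" by (simp add: add.commute[of _ t] \<Phi>_add)
  from fun_cong[OF has_derivative_unique[OF a[unfolded c] b], of 1] show ?thesis by simp
qed

text \<open>With \<open>M\<close> the derivative of the time-\<open>t\<close> map at \<open>p\<close> and \<open>q = \<Phi> t p\<close>, the gradients at \<open>p\<close> are \<open>M\<^sup>T\<close>
  applied to those at \<open>q\<close>, while \<open>X q = M (X p)\<close>. The identity
  \<open>M (M\<^sup>T u \<times> M\<^sup>T w) = det M (u \<times> w)\<close> compares the two multiples of \<open>X\<close>.\<close>

lemma lam_flow:
  assumes p: "p \<in> W"
  shows "lam p = det (matrix (frechet_derivative (\<Phi> t) (at p))) * lam (\<Phi> t p)"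
proof -
  let ?D = "frechet_derivative (\<Phi> t) (at p)" and ?q = "\<Phi> t p"
  let ?M = "matrix ?D"
  have q: "?q \<in> W" by (rule W_invariant[OF p])
  have lin: "linear ?D" using \<Phi>_has_derivative[OF p] has_derivative_linear by blast
  have M: "?M *v v = ?D v" for v using fun_cong[OF matrix_vector_mul(2)[OF lin], of v] .
  have g: "grad i p = transpose ?M *v grad i ?q" for i
  proof (rule vector_eq_rdot[THEN iffD1], rule allI)
    fix v
    have "grad i p \<bullet> v = frechet_derivative (\<lambda>p. P p $ i) (at p) v" by (simp add: grad[OF p])
    also have "\<dots> = grad i ?q \<bullet> (?M *v v)" by (simp add: M grad[OF q, symmetric] P_derivative_flow[OF p])
    also have "\<dots> = (transpose ?M *v grad i ?q) \<bullet> v" by (simp only: transpose_matrix_vector dot_lmul_matrix)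
    finally show "grad i p \<bullet> v = (transpose ?M *v grad i ?q) \<bullet> v" .
  qed
  have "lam p *\<^sub>R X ?q = ?M *v (lam p *\<^sub>R X p)"
    by (simp add: M linear_scale[OF lin] \<Phi>_derivative_X[OF p])
  also have "\<dots> = ?M *v (cross3 (transpose ?M *v grad 2 ?q) (transpose ?M *v grad 3 ?q))"
    unfolding cross_grad[OF p, symmetric] g[symmetric] ..
  also have "\<dots> = det ?M *\<^sub>R cross3 (grad 2 ?q) (grad 3 ?q)"
    using cross_matrix_mult[of "transpose ?M" "grad 2 ?q" "grad 3 ?q"] by simp
  also have "\<dots> = (det ?M * lam ?q) *\<^sub>R X ?q" by (simp add: cross_grad[OF q])
  finally show ?thesis using X_nonzero[OF q] by simp
qed

lemma lam_analytic: "real_analytic_on W lam"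
proof -
  have g: "real_analytic_on W (\<lambda>p. grad i p $ j)" for i j
    unfolding grad_def vec_lambda_beta by (rule real_analytic_on_directional_derivative[OF P_analytic])
  have x: "real_analytic_on W (\<lambda>p. X p $ j)" for j by (rule real_analytic_on_subset[OF analytic]) simp
  have "real_analytic_on W (\<lambda>p. (cross3 (grad 2 p) (grad 3 p) \<bullet> X p) / (X p \<bullet> X p))"
  proof (rule real_analytic_on_divide)
    show "real_analytic_on W (\<lambda>p. cross3 (grad 2 p) (grad 3 p) \<bullet> X p)"
      unfolding inner_vec_def sum_3 cross_components inner_real_def
      by (intro real_analytic_on_add real_analytic_on_diff real_analytic_on_mult g x)
    show "real_analytic_on W (\<lambda>p. X p \<bullet> X p)"
      unfolding inner_vec_def sum_3 inner_real_def
      by (intro real_analytic_on_add real_analytic_on_mult x)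
    show "X p \<bullet> X p \<noteq> 0" if "p \<in> W" for p using X_nonzero[OF that] by simp
  qed
  then show ?thesis by (simp add: lam_def[abs_def])
qed

text \<open>The absolute value of \<open>\<lambda>\<close>, written as a square root to exhibit it as analytic where \<open>\<lambda>\<close> has no zeros.\<close>

definition "rho p = sqrt ((lam p)\<^sup>2)"

lemma rho: "rho p = \<bar>lam p\<bar>" by (simp add: rho_def)

lemma rho_analytic: "real_analytic_on W rho"
  unfolding rho_def[abs_def]
  by (intro real_analytic_on_sqrt real_analytic_on_power lam_analytic) (simp add: lam_nonzero)

lemma rho_flow: "p \<in> W \<Longrightarrow> \<bar>det (matrix (frechet_derivative (\<Phi> t) (at p)))\<bar> * rho (\<Phi> t p) = rho p"
  unfolding rho by (subst lam_flow[of p t]) (auto simp: abs_mult)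

end

section \<open>Change of variables for nonnegative integrands\<close>

lemma absolutely_integrable_vec1:
  "(\<lambda>x. vec (h x) :: real^1) absolutely_integrable_on S \<longleftrightarrow> h absolutely_integrable_on S"
  unfolding absolutely_integrable_componentwise_iff[where f="\<lambda>x. vec (h x) :: real^1"]
  by (simp add: Basis_vec_def inner_axis)

lemma has_integral_vec1:
  "((\<lambda>x. vec (h x) :: real^1) has_integral vec b) S \<longleftrightarrow> (h has_integral b) S"
  unfolding has_integral_componentwise_iff[where f="\<lambda>x. vec (h x) :: real^1"]
  by (simp add: Basis_vec_def inner_axis)

text \<open>Both sides may be infinite: the theorem on absolute integrability shows that finiteness is the same
  on both sides, and equality of the integrals follows.\<close>

lemma change_of_variables_nn_integral:
  fixes g :: "real^'n::{finite,wellorder} \<Rightarrow> real^'n::_" and \<rho> :: "real^'n::_ \<Rightarrow> real"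
  assumes D: "D \<in> sets borel" "g ` D \<in> sets borel" and \<rho>: "\<rho> \<in> borel_measurable borel"
    and nonneg: "\<And>x. \<rho> x \<ge> 0"
    and g': "\<And>x. x \<in> D \<Longrightarrow> (g has_derivative g' x) (at x within D)" and inj: "inj_on g D"
    and jac: "\<And>x. x \<in> D \<Longrightarrow> \<bar>det (matrix (g' x))\<bar> * \<rho> (g x) = \<rho> x"
  shows "(\<integral>\<^sup>+x\<in>g ` D. ennreal (\<rho> x) \<partial>lborel) = (\<integral>\<^sup>+x\<in>D. ennreal (\<rho> x) \<partial>lborel)"
proof -
  have cv: "\<rho> absolutely_integrable_on D \<and> integral D \<rho> = b \<longleftrightarrow>
      \<rho> absolutely_integrable_on (g ` D) \<and> integral (g ` D) \<rho> = b" for b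
  proof -
    have eq: "h absolutely_integrable_on S \<and> integral S h = c \<longleftrightarrow>
       (\<lambda>x. vec (h x) :: real^1) absolutely_integrable_on S \<and> integral S (\<lambda>x. vec (h x) :: real^1) = vec c"
      for h :: "real^'n::_ \<Rightarrow> real" and S c
    proof -
      have "integral S (\<lambda>x. vec (h x) :: real^1) = vec (integral S h)" if "h absolutely_integrable_on S"
      proof -
        have "(h has_integral integral S h) S"
          by (rule integrable_integral[OF set_lebesgue_integral_eq_integral(1)[OF that]])
        then have "((\<lambda>x. vec (h x) :: real^1) has_integral vec (integral S h)) S" by (simp only: has_integral_vec1)
        then show ?thesis by (rule integral_unique)
      qed
      then show ?thesis unfolding absolutely_integrable_vec1 by (auto simp: vec_eq_iff)
    qed
    have "(\<lambda>x. \<bar>det (matrix (g' x))\<bar> *\<^sub>R (vec (\<rho> (g x)) :: real^1)) absolutely_integrable_on D \<and>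
        integral D (\<lambda>x. \<bar>det (matrix (g' x))\<bar> *\<^sub>R (vec (\<rho> (g x)) :: real^1)) = vec b \<longleftrightarrow>
      (\<lambda>x. vec (\<rho> x) :: real^1) absolutely_integrable_on (g ` D) \<and> integral (g ` D) (\<lambda>x. vec (\<rho> x) :: real^1) = vec b"
      by (rule has_absolute_integral_change_of_variables[OF _ g' inj]) (use D in auto)
    moreover have s: "\<bar>det (matrix (g' x))\<bar> *\<^sub>R (vec (\<rho> (g x)) :: real^1) = vec (\<rho> x)" if "x \<in> D" for x
      using jac[OF that] by (simp add: vec_eq_iff)
    moreover have "(\<lambda>x. \<bar>det (matrix (g' x))\<bar> *\<^sub>R (vec (\<rho> (g x)) :: real^1)) absolutely_integrable_on D \<longleftrightarrow>
      (\<lambda>x. vec (\<rho> x) :: real^1) absolutely_integrable_on D"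
      unfolding set_integrable_def by (rule Bochner_Integration.integrable_cong) (auto simp: s indicator_def)
    moreover have "integral D (\<lambda>x. \<bar>det (matrix (g' x))\<bar> *\<^sub>R (vec (\<rho> (g x)) :: real^1)) = integral D (\<lambda>x. vec (\<rho> x))"
      by (rule integral_cong) (rule s)
    ultimately show ?thesis unfolding eq by simp
  qed
  have nn: "(\<integral>\<^sup>+x\<in>E. ennreal (\<rho> x) \<partial>lborel) =
      (if \<rho> absolutely_integrable_on E then ennreal (integral E \<rho>) else \<infinity>)" if E: "E \<in> sets borel" for E
  proof -
    let ?f = "\<lambda>x. indicator E x *\<^sub>R \<rho> x"
    have m: "?f \<in> borel_measurable lborel" using E \<rho> by simp
    have ai: "\<rho> absolutely_integrable_on E \<longleftrightarrow> integrable lborel ?f"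
      unfolding set_integrable_def using integrable_completion[OF m] by simp
    have eq: "(\<integral>\<^sup>+x\<in>E. ennreal (\<rho> x) \<partial>lborel) = (\<integral>\<^sup>+x. ennreal (?f x) \<partial>lborel)"
      by (rule nn_integral_cong) (auto simp: indicator_def)
    show ?thesis
    proof (cases "\<rho> absolutely_integrable_on E")
      case True
      then have "(\<integral>\<^sup>+x. ennreal (?f x) \<partial>lborel) = ennreal (integral\<^sup>L lborel ?f)"
        using ai by (intro nn_integral_eq_integral) (auto simp: nonneg)
      also have "integral\<^sup>L lborel ?f = integral E \<rho>"
        using set_lebesgue_integral_eq_integral(2)[OF True] integral_completion[OF m]
        by (simp add: set_lebesgue_integral_def)
      finally show ?thesis using True eq by simp
    next
      case False
      have "(\<integral>\<^sup>+x. ennreal (?f x) \<partial>lborel) = \<infinity>"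
      proof (rule ccontr)
        assume "\<not> ?thesis"
        then have "(\<integral>\<^sup>+x. ennreal (?f x) \<partial>lborel) < \<infinity>" by (simp add: top.not_eq_extremum)
        then have "integrable lborel ?f" using m by (intro integrableI_nonneg) (auto simp: nonneg)
        then show False using False ai by simp
      qed
      then show ?thesis using False eq by simp
    qed
  qed
  show ?thesis
    unfolding nn[OF D(1)] nn[OF D(2)]
    using cv[of "integral D \<rho>"] cv[of "integral (g ` D) \<rho>"] by auto
qed

section \<open>The lift to the full phase space\<close>

definition lift_field :: "(real^3 \<Rightarrow> real^3) \<Rightarrow> real^4 \<Rightarrow> real^4" where
  "lift_field X z = vector [X (forget_phi2 z) $ 1, z $ 4, X (forget_phi2 z) $ 2, X (forget_phi2 z) $ 3]"

lemma forget_phi2_nth [simp]: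
  "forget_phi2 z $ 1 = z $ 1" "forget_phi2 z $ 2 = z $ 3" "forget_phi2 z $ 3 = z $ 4"
  by (simp_all add: forget_phi2_def)

lemma linear_forget_phi2: "linear forget_phi2"
  by (simp add: linear_iff vec_eq_iff forall_3)

lemmas bounded_linear_forget_phi2 = linear_forget_phi2[unfolded linear_conv_bounded_linear]

lemma forget_phi2_axis_2 [simp]: "forget_phi2 (axis 2 c) = 0"
  by (simp add: vec_eq_iff forall_3 axis_def)

lemma forget_phi2_shift [simp]: "forget_phi2 (z + axis 2 c) = forget_phi2 z"
  by (simp add: linear_add[OF linear_forget_phi2])

lemma forget_phi2_analytic: "real_analytic_on U (\<lambda>z. forget_phi2 z $ i)"
  using exhaust_3[of i] by (elim disjE) (simp_all add: real_analytic_on_nth)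

lemma forget_phi2_lift: "X (forget_phi2 z) $ 1 = z $ 3 \<Longrightarrow> forget_phi2 (lift_field X z) = X (forget_phi2 z)"
  by (simp add: vec_eq_iff forall_3 lift_field_def)

lemma lift_field_shift: "lift_field X (z + axis 2 c) = lift_field X z"
proof -
  have "(z + axis 2 c) $ 4 = z $ 4" by (simp add: axis_def)
  then show ?thesis unfolding lift_field_def forget_phi2_shift by simp
qed

lemma lift_field_analytic:
  assumes "\<And>i. real_analytic_on UNIV (\<lambda>z. X z $ i)"
  shows "real_analytic_on U (\<lambda>z. lift_field X z $ i)"
proof -
  have "real_analytic_on U (\<lambda>z. X (forget_phi2 z) $ j)" for j
    by (rule real_analytic_on_compose[OF assms forget_phi2_analytic]) simp
  then show ?thesis
    using exhaust_4[of i] by (elim disjE) (simp_all add: lift_field_def real_analytic_on_nth)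
qed

text \<open>The angle \<open>\<phi>\<^sub>2\<close> is unbounded on the region over \<open>W\<close>. Resetting it to zero brings a point close to the
  origin, where analyticity of the full flow is available.\<close>

definition base :: "real^4 \<Rightarrow> real^4" where
  "base p = vector [p $ 1, 0, p $ 3, p $ 4]"

lemma base_shift: "base p + axis 2 (p $ 2) = p"
  by (simp add: base_def vec_eq_iff forall_4 axis_def)

lemma base_add_axis: "base (p + axis 2 c) = base p"
  by (simp add: base_def axis_def)

lemma base_analytic: "real_analytic_on U (\<lambda>z. base z $ i)"
  using exhaust_4[of i] by (elim disjE) (simp_all add: base_def real_analytic_on_nth real_analytic_on_const)

lemma norm_base: "norm (base p) = norm (forget_phi2 p)"
  by (simp add: norm_vec_def L2_set_def sum_3 sum_4 base_def)

lemma frechet_derivative_shift_invariant: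
  assumes d: "(f has_derivative f') (at p)" and inv: "\<And>c::real. f (p + c *\<^sub>R v) = f p + c *\<^sub>R w"
  shows "f' v = w"
proof -
  have "((\<lambda>c. p + c *\<^sub>R v) has_derivative (\<lambda>c. c *\<^sub>R v)) (at 0)" by (auto intro!: derivative_eq_intros)
  from diff_chain_at[OF this, of f f'] d
  have "((\<lambda>c. f p + c *\<^sub>R w) has_derivative (\<lambda>c. f' (c *\<^sub>R v))) (at 0)" by (simp add: o_def inv)
  moreover have "((\<lambda>c. f p + c *\<^sub>R w) has_derivative (\<lambda>c. c *\<^sub>R w)) (at 0)" by (auto intro!: derivative_eq_intros)
  ultimately have "(\<lambda>c. f' (c *\<^sub>R v)) = (\<lambda>c. c *\<^sub>R w)" by (rule has_derivative_unique)
  from fun_cong[OF this, of 1] show ?thesis by simp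
qed

text \<open>\<open>\<Gamma>\<close> is the flow of the full system near the origin, for times up to one.\<close>

locale reversible_center_full = reversible_center +
  fixes \<Gamma> :: "real \<Rightarrow> real^4 \<Rightarrow> real^4"
  assumes \<Gamma>0: "\<And>p. \<Gamma> 0 p = p"
    and \<Gamma>_deriv: "\<And>s p. norm p < r0 \<Longrightarrow> \<bar>s\<bar> \<le> 1 \<Longrightarrow> ((\<lambda>t. \<Gamma> t p) has_vector_derivative lift_field X (\<Gamma> s p)) (at s)"
    and \<Gamma>_analytic: "\<And>s i. s \<in> {-1..1} \<Longrightarrow> real_analytic_on (ball 0 r0) (\<lambda>p. \<Gamma> s p $ i)"
begin

definition "U = {z. forget_phi2 z \<in> W}"

lemma U_open: "open U"
proof -
  have "U = forget_phi2 -` W" by (auto simp: U_def)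
  then show ?thesis
    using open_vimage[OF W_open linear_continuous_on[OF bounded_linear_forget_phi2]] by simp
qed

text \<open>The short-time flow on all of \<open>U\<close>, by translation in \<open>\<phi>\<^sub>2\<close>.\<close>

definition "\<gamma> s p = \<Gamma> s (base p) + axis 2 (p $ 2)"

lemma \<gamma>0: "\<gamma> 0 p = p" by (simp add: \<gamma>_def \<Gamma>0 base_shift)

lemma \<gamma>_shift: "\<gamma> s (p + axis 2 c) = \<gamma> s p + axis 2 c"
  by (simp add: \<gamma>_def base_add_axis) (simp add: vec_eq_iff axis_def)

lemma base_ball: assumes "p \<in> U" shows "norm (base p) < r0"
  using assms W_ball by (auto simp: U_def norm_base)

lemma \<gamma>_solution:
  assumes "p \<in> U" "\<bar>s\<bar> \<le> 1"
  shows "((\<lambda>t. \<gamma> t p) has_vector_derivative lift_field X (\<gamma> s p)) (at s)"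
  using has_vector_derivative_add[OF \<Gamma>_deriv[OF base_ball[OF assms(1)] assms(2)] has_vector_derivative_const[of "axis 2 (p $ 2)"]]
  by (simp add: \<gamma>_def[abs_def] lift_field_shift)

lemma \<gamma>_solution_on: "p \<in> U \<Longrightarrow> solution_on (lift_field X) {-1..1} (\<lambda>t. \<gamma> t p)"
  by (auto simp: solution_on_def is_interval_cc intro!: has_vector_derivative_at_within[OF \<gamma>_solution])

lemma solution_forget:
  assumes "solution_on (lift_field X) J x"
  shows "solution_on X J (\<lambda>t. forget_phi2 (x t))"
  unfolding solution_on_def
proof (intro conjI ballI)
  show "is_interval J" using assms by (simp add: solution_on_def)
  fix t assume "t \<in> J"
  then have "(x has_vector_derivative lift_field X (x t)) (at t within J)" using assms by (simp add: solution_on_def)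
  from bounded_linear.has_vector_derivative[OF bounded_linear_forget_phi2 this]
  show "((\<lambda>t. forget_phi2 (x t)) has_vector_derivative X (forget_phi2 (x t))) (at t within J)"
    by (simp add: forget_phi2_lift X1)
qed

lemma forget_\<gamma>:
  assumes "p \<in> U" "\<bar>s\<bar> \<le> 1" shows "forget_phi2 (\<gamma> s p) = \<Phi> s (forget_phi2 p)"
proof -
  have "s \<in> {-1..1}" using assms(2) by auto
  then show ?thesis
    using solution_eq_flow[OF solution_forget[OF \<gamma>_solution_on[OF assms(1)]], of 0 s] assms(1)
    by (simp add: \<gamma>0 U_def)
qed

lemma \<gamma>_U: "p \<in> U \<Longrightarrow> \<bar>s\<bar> \<le> 1 \<Longrightarrow> \<gamma> s p \<in> U"
  using forget_\<gamma>[of p s] W_invariant by (simp add: U_def)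

lemma full_unique:
  assumes "solution_on (lift_field X) J x" "solution_on (lift_field X) J y" "s \<in> J" "t \<in> J" "x s = y s"
  shows "x t = y t"
  by (rule solution_unique[OF lift_field_analytic[OF analytic] assms])

lemma \<gamma>_inverse:
  assumes p: "p \<in> U" and s: "\<bar>s\<bar> \<le> 1" shows "\<gamma> (- s) (\<gamma> s p) = p"
proof -
  let ?J = "closed_segment 0 s"
  have J: "is_interval ?J" using is_interval_convex_1 by blast
  have J1: "\<bar>t\<bar> \<le> 1" "\<bar>t - s\<bar> \<le> 1" if "t \<in> ?J" for t
    using that s by (auto simp: closed_segment_eq_real_ivl split: if_splits)
  have "solution_on (lift_field X) ?J (\<lambda>t. \<gamma> (t + - s) (\<gamma> s p))"
    unfolding solution_on_def
  proof (intro conjI ballI J)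
    fix t assume t: "t \<in> ?J"
    have "\<bar>t + - s\<bar> \<le> 1" using J1(2)[OF t] by simp
    from has_vector_derivative_shift[OF \<gamma>_solution[OF \<gamma>_U[OF p s] this]]
    show "((\<lambda>t. \<gamma> (t + - s) (\<gamma> s p)) has_vector_derivative lift_field X (\<gamma> (t + - s) (\<gamma> s p))) (at t within ?J)"
      by (rule has_vector_derivative_at_within)
  qed
  moreover have "solution_on (lift_field X) ?J (\<lambda>t. \<gamma> t p)"
    unfolding solution_on_def
    by (intro conjI ballI J has_vector_derivative_at_within[OF \<gamma>_solution[OF p J1(1)]])
  ultimately have "\<gamma> (0 + - s) (\<gamma> s p) = \<gamma> 0 p"
    by (rule full_unique[of ?J "\<lambda>t. \<gamma> (t + - s) (\<gamma> s p)" "\<lambda>t. \<gamma> t p" s 0]) (simp_all add: \<gamma>0)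
  then show ?thesis by (simp add: \<gamma>0)
qed

lemma \<gamma>_analytic:
  assumes "\<bar>s\<bar> \<le> 1" shows "real_analytic_on U (\<lambda>p. \<gamma> s p $ i)"
proof -
  have s: "s \<in> {-1..1}" using assms by auto
  have "real_analytic_on U (\<lambda>p. \<Gamma> s (base p) $ i)"
    by (rule real_analytic_on_compose[OF \<Gamma>_analytic[OF s] base_analytic]) (use base_ball in auto)
  moreover have "real_analytic_on U (\<lambda>p. (axis 2 (p $ 2) :: real^4) $ i)"
    by (cases "i = 2") (simp_all add: axis_def real_analytic_on_nth real_analytic_on_const)
  ultimately show ?thesis by (simp add: \<gamma>_def real_analytic_on_add)
qed

lemma \<gamma>_has_derivative:
  "\<bar>s\<bar> \<le> 1 \<Longrightarrow> p \<in> U \<Longrightarrow> (\<gamma> s has_derivative frechet_derivative (\<gamma> s) (at p)) (at p)"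
  by (rule real_analytic_vec_has_derivative[OF \<gamma>_analytic])

lemma det_\<gamma>:
  assumes s: "\<bar>s\<bar> \<le> 1" and p: "p \<in> U"
  shows "det (matrix (frechet_derivative (\<gamma> s) (at p))) = det (matrix (frechet_derivative (\<Phi> s) (at (forget_phi2 p))))"
proof -
  let ?D = "frechet_derivative (\<gamma> s) (at p)" and ?E = "frechet_derivative (\<Phi> s) (at (forget_phi2 p))"
  have pW: "forget_phi2 p \<in> W" using p by (simp add: U_def)
  note D = \<gamma>_has_derivative[OF s p]
  have "((\<lambda>p. forget_phi2 (\<gamma> s p)) has_derivative (\<lambda>v. forget_phi2 (?D v))) (at p)"
    by (rule bounded_linear.has_derivative[OF bounded_linear_forget_phi2 D])
  then have 1: "((\<lambda>p. \<Phi> s (forget_phi2 p)) has_derivative (\<lambda>v. forget_phi2 (?D v))) (at p)"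
    by (rule has_derivative_transform_within_open[OF _ U_open p]) (simp add: forget_\<gamma>[OF _ s])
  have 2: "((\<lambda>p. \<Phi> s (forget_phi2 p)) has_derivative (\<lambda>v. ?E (forget_phi2 v))) (at p)"
    using diff_chain_at[OF bounded_linear_imp_has_derivative[OF bounded_linear_forget_phi2] \<Phi>_has_derivative[OF pW]]
    by (simp add: o_def)
  have fD: "forget_phi2 (?D v) = ?E (forget_phi2 v)" for v
    using fun_cong[OF has_derivative_unique[OF 1 2], of v] .
  have D2: "?D (axis 2 1) = axis 2 1"
  proof (rule frechet_derivative_shift_invariant[OF D])
    have a: "c *\<^sub>R axis 2 1 = (axis 2 c :: real^4)" for c by (simp add: vec_eq_iff axis_def)
    show "\<gamma> s (p + c *\<^sub>R axis 2 1) = \<gamma> s p + c *\<^sub>R axis 2 1" for c by (simp add: a \<gamma>_shift)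
  qed
  have f1: "forget_phi2 (axis 1 1) = axis 1 1" "forget_phi2 (axis 3 1) = axis 2 1" "forget_phi2 (axis 4 1) = axis 3 1"
    by (simp_all add: vec_eq_iff forall_3 axis_def)
  have E: "?E (axis 1 1) = forget_phi2 (?D (axis 1 1))" "?E (axis 2 1) = forget_phi2 (?D (axis 3 1))"
    "?E (axis 3 1) = forget_phi2 (?D (axis 4 1))" by (simp_all add: fD f1)
  show ?thesis
    by (rule det_4_invariant_axis) (simp_all add: matrix_def D2 E, simp_all add: axis_def)
qed

definition "rho4 p = rho (forget_phi2 p)"

lemma rho4_analytic: "real_analytic_on U rho4"
  unfolding rho4_def[abs_def]
  by (rule real_analytic_on_compose[OF rho_analytic forget_phi2_analytic]) (auto simp: U_def)

text \<open>The image is a Borel set because it is a preimage under the continuous inverse \<open>\<gamma> (- s)\<close>; the Jacobian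
  of \<open>\<gamma> s\<close> is that of the reduced flow, which \<open>rho_flow\<close> relates to the density.\<close>

lemma \<gamma>_preserves_measure:
  assumes s: "\<bar>s\<bar> \<le> 1" and D: "D \<in> sets borel" "D \<subseteq> U"
  shows "\<gamma> s ` D \<in> sets borel" "\<gamma> s ` D \<subseteq> U"
    "(\<integral>\<^sup>+p\<in>\<gamma> s ` D. ennreal (rho4 p) \<partial>lborel) = (\<integral>\<^sup>+p\<in>D. ennreal (rho4 p) \<partial>lborel)"
proof -
  have s': "\<bar>- s\<bar> \<le> 1" using s by simp
  have inv: "\<gamma> (- s) (\<gamma> s p) = p" if "p \<in> U" for p by (rule \<gamma>_inverse[OF that s])
  have inv': "\<gamma> s (\<gamma> (- s) p) = p" if "p \<in> U" for p using \<gamma>_inverse[OF that s'] by simp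
  show sub: "\<gamma> s ` D \<subseteq> U" using D(2) \<gamma>_U s by auto
  have im: "\<gamma> s ` D = U \<inter> \<gamma> (- s) -` D"
  proof (intro equalityI subsetI)
    fix q assume "q \<in> \<gamma> s ` D"
    then obtain p where p: "p \<in> D" "q = \<gamma> s p" by blast
    then have "p \<in> U" using D(2) by blast
    then show "q \<in> U \<inter> \<gamma> (- s) -` D" using p \<gamma>_U[OF _ s] inv by simp
  next
    fix q assume q: "q \<in> U \<inter> \<gamma> (- s) -` D"
    then have "q = \<gamma> s (\<gamma> (- s) q)" using inv' by simp
    then show "q \<in> \<gamma> s ` D" using q by blast
  qed
  have Ub: "U \<in> sets borel" using U_open by simp
  have "continuous_on U (\<gamma> (- s))" by (rule real_analytic_vec_continuous[OF \<gamma>_analytic[OF s']])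
  then have "\<gamma> (- s) \<in> borel_measurable (restrict_space borel U)" by (rule borel_measurable_continuous_on_restrict)
  from measurable_sets[OF this D(1)] show B: "\<gamma> s ` D \<in> sets borel"
    using Ub by (simp add: im sets_restrict_space_iff space_restrict_space Int_commute)
  \<comment> \<open>Extension by zero makes the density Borel on the whole space.\<close>
  define \<rho> where "\<rho> x = (if x \<in> U then rho4 x else 0)" for x
  have "continuous_on U rho4" by (rule real_analytic_on_continuous[OF rho4_analytic])
  then have "(\<lambda>x. indicator U x *\<^sub>R rho4 x) \<in> borel_measurable borel"
    using Ub by (intro borel_measurable_continuous_on_indicator) auto
  moreover have "(\<lambda>x. indicator U x *\<^sub>R rho4 x) = \<rho>" by (auto simp: \<rho>_def indicator_def fun_eq_iff)
  ultimately have \<rho>m: "\<rho> \<in> borel_measurable borel" by simp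
  have "(\<integral>\<^sup>+p\<in>\<gamma> s ` D. ennreal (\<rho> p) \<partial>lborel) = (\<integral>\<^sup>+p\<in>D. ennreal (\<rho> p) \<partial>lborel)"
  proof (rule change_of_variables_nn_integral[OF D(1) B \<rho>m])
    show "\<rho> x \<ge> 0" for x by (simp add: \<rho>_def rho4_def rho)
    show "(\<gamma> s has_derivative frechet_derivative (\<gamma> s) (at x)) (at x within D)" if "x \<in> D" for x
      by (rule has_derivative_at_withinI[OF \<gamma>_has_derivative[OF s]]) (use that D(2) in blast)
    show "inj_on (\<gamma> s) D" by (rule inj_on_inverseI[of _ "\<gamma> (- s)"]) (use inv D(2) in blast)
    show "\<bar>det (matrix (frechet_derivative (\<gamma> s) (at x)))\<bar> * \<rho> (\<gamma> s x) = \<rho> x" if "x \<in> D" for x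
    proof -
      have x: "x \<in> U" using that D(2) by blast
      then show ?thesis
        using rho_flow[of "forget_phi2 x" s] \<gamma>_U[OF x s]
        by (simp add: \<rho>_def rho4_def det_\<gamma>[OF s x] forget_\<gamma>[OF x s]) (simp add: U_def)
    qed
  qed
  moreover have "(\<integral>\<^sup>+p\<in>E. ennreal (\<rho> p) \<partial>lborel) = (\<integral>\<^sup>+p\<in>E. ennreal (rho4 p) \<partial>lborel)" if "E \<subseteq> U" for E
    by (rule nn_integral_cong) (use that in \<open>auto simp: \<rho>_def indicator_def\<close>)
  ultimately show "(\<integral>\<^sup>+p\<in>\<gamma> s ` D. ennreal (rho4 p) \<partial>lborel) = (\<integral>\<^sup>+p\<in>D. ennreal (rho4 p) \<partial>lborel)"
    using sub D(2) by simp
qed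

text \<open>By uniqueness the time-\<open>t\<close> map of the definition is an iterate of a short-time map \<open>\<gamma> h\<close>, and each
  step preserves the measure.\<close>

lemma rho4_invariant: "smooth_invariant_measure (lift_field X) U rho4"
  unfolding smooth_invariant_measure_def
proof (intro conjI ballI allI impI)
  show "smooth_on U rho4" by (rule real_analytic_imp_smooth[OF U_open]) (simp add: rho4_analytic)
  show "rho4 p > 0" if "p \<in> U" for p
    using lam_nonzero[of "forget_phi2 p"] that by (simp add: rho4_def rho U_def)
  fix D t g
  assume D: "D \<in> sets borel" "D \<subseteq> U" and t: "(0::real) \<le> t"
    and g: "\<forall>p\<in>D. \<exists>x. solution_on (lift_field X) {0..t} x \<and> x 0 = p \<and> x t = g p \<and> x ` {0..t} \<subseteq> U"
  obtain n :: nat where n: "t + 1 \<le> real n" using real_arch_simple by blast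
  define h where "h = t / real n"
  have n0: "real n > 0" using n t by linarith
  have h: "0 \<le> h" "\<bar>h\<bar> \<le> 1" "real n * h = t" using n n0 t by (auto simp: h_def field_simps)
  have gp: "g p = (\<gamma> h ^^ n) p" if p: "p \<in> D" for p
  proof -
    obtain x where x: "solution_on (lift_field X) {0..t} x" "x 0 = p" "x t = g p" "x ` {0..t} \<subseteq> U" using g p by blast
    have "x (real j * h) = (\<gamma> h ^^ j) p" if "j \<le> n" for j
      using that
    proof (induction j)
      case 0 show ?case by (simp add: x(2))
    next
      case (Suc j)
      let ?a = "real j * h"
      have "real (Suc j) * h \<le> real n * h" using Suc.prems h(1) by (intro mult_right_mono) auto
      then have a: "0 \<le> ?a" "?a + h \<le> t" using h(1,3) by (auto simp: algebra_simps)
      have sub: "{?a..?a + h} \<subseteq> {0..t}"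
        using a by (intro subsetI) (meson atLeastAtMost_iff order_trans)
      have xa: "x ?a \<in> U" using x(4) a h(1) by (force simp: image_subset_iff)
      have "solution_on (lift_field X) {?a..?a + h} x"
        unfolding solution_on_def
      proof (intro conjI ballI)
        fix u assume u: "u \<in> {?a..?a + h}"
        then have "u \<in> {0..t}" using sub by blast
        then have "(x has_vector_derivative lift_field X (x u)) (at u within {0..t})"
          using x(1) unfolding solution_on_def by blast
        then show "(x has_vector_derivative lift_field X (x u)) (at u within {?a..?a + h})"
          by (rule has_vector_derivative_within_subset) (rule sub)
      qed (simp add: is_interval_cc)
      moreover have "solution_on (lift_field X) {?a..?a + h} (\<lambda>u. \<gamma> (u + - ?a) (x ?a))"
        unfolding solution_on_def
      proof (intro conjI ballI)
        fix u assume "u \<in> {?a..?a + h}"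
        then have "\<bar>u + - ?a\<bar> \<le> 1" using h by auto
        from has_vector_derivative_shift[OF \<gamma>_solution[OF xa this]]
        show "((\<lambda>u. \<gamma> (u + - ?a) (x ?a)) has_vector_derivative lift_field X (\<gamma> (u + - ?a) (x ?a))) (at u within {?a..?a + h})"
          by (rule has_vector_derivative_at_within)
      qed (simp add: is_interval_cc)
      ultimately have "x (?a + h) = \<gamma> (?a + h + - ?a) (x ?a)"
        by (rule full_unique[of _ _ _ ?a]) (use h(1) in \<open>auto simp: \<gamma>0\<close>)
      then show ?case using Suc by (simp add: algebra_simps)
    qed
    from this[of n] show ?thesis by (simp add: h(3) x(3))
  qed
  have "(\<gamma> h ^^ j) ` D \<in> sets borel \<and> (\<gamma> h ^^ j) ` D \<subseteq> U \<and>
    (\<integral>\<^sup>+p\<in>(\<gamma> h ^^ j) ` D. ennreal (rho4 p) \<partial>lborel) = (\<integral>\<^sup>+p\<in>D. ennreal (rho4 p) \<partial>lborel)" for j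
  proof (induction j)
    case 0 show ?case using D by simp
  next
    case (Suc j)
    have "(\<gamma> h ^^ Suc j) ` D = \<gamma> h ` ((\<gamma> h ^^ j) ` D)" by (simp add: image_comp)
    then show ?case using \<gamma>_preserves_measure[OF h(2), of "(\<gamma> h ^^ j) ` D"] Suc by simp
  qed
  moreover have "g ` D = (\<gamma> h ^^ n) ` D" using gp by (intro image_cong) auto
  ultimately show "(\<integral>\<^sup>+p\<in>g ` D. ennreal (rho4 p) \<partial>lborel) = (\<integral>\<^sup>+p\<in>D. ennreal (rho4 p) \<partial>lborel)" by simp
qed

definition "P4 i p = P (forget_phi2 p) $ i"

lemma P4_first_integral: "smooth_first_integral (lift_field X) U (P4 i)"
  unfolding smooth_first_integral_def preserves_function_def
proof (intro conjI allI impI ballI)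
  have "real_analytic_on U (P4 i)"
    unfolding P4_def[abs_def] by (rule real_analytic_on_compose[OF P_analytic forget_phi2_analytic]) (auto simp: U_def)
  then show "smooth_on U (P4 i)" by (intro real_analytic_imp_smooth[OF U_open]) simp
  fix J x s t assume x: "solution_on (lift_field X) J x" "x ` J \<subseteq> U" "s \<in> J" "t \<in> J"
  then have "forget_phi2 (x s) \<in> W" by (auto simp: U_def)
  then show "P4 i (x s) = P4 i (x t)"
    using solution_eq_flow[OF solution_forget[OF x(1)] x(3) _ x(4)] by (simp add: P4_def P_flow)
qed

lemma P4_derivative:
  assumes "p \<in> U"
  shows "frechet_derivative (P4 i) (at p) v = frechet_derivative (\<lambda>p. P p $ i) (at (forget_phi2 p)) (forget_phi2 v)"
proof -
  have "forget_phi2 p \<in> W" using assms by (simp add: U_def)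
  from diff_chain_at[OF bounded_linear_imp_has_derivative[OF bounded_linear_forget_phi2]
      real_analytic_on_has_derivative[OF P_analytic this, of i]]
  have "(P4 i has_derivative (\<lambda>v. frechet_derivative (\<lambda>p. P p $ i) (at (forget_phi2 p)) (forget_phi2 v))) (at p)"
    by (simp add: o_def P4_def[abs_def])
  from fun_cong[OF frechet_derivative_at[OF this], of v] show ?thesis by simp
qed

lemma P4_independent_first_integrals: "independent_first_integrals (lift_field X) U (P4 2) (P4 3)"
  unfolding independent_first_integrals_def functionally_independent_def
proof (intro conjI ballI allI impI P4_first_integral)
  fix p a b assume p: "p \<in> U"
    and 0: "\<forall>h. a * frechet_derivative (P4 2) (at p) h + b * frechet_derivative (P4 3) (at p) h = 0"
  have pW: "forget_phi2 p \<in> W" using p by (simp add: U_def)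
  have "a * frechet_derivative (\<lambda>p. P p $ 2) (at (forget_phi2 p)) h +
      b * frechet_derivative (\<lambda>p. P p $ 3) (at (forget_phi2 p)) h = 0" for h
  proof -
    have "h = forget_phi2 (vector [h $ 1, 0, h $ 2, h $ 3])" by (simp add: vec_eq_iff forall_3)
    then show ?thesis using 0 P4_derivative[OF p] by metis
  qed
  from P_independent[OF pW this] show "a = 0" "b = 0" by auto
qed

text \<open>Along \<open>\<partial>/\<partial>\<phi>\<^sub>2\<close> the reduced coordinates do not change.\<close>

lemma d_phi2_preserves: "preserves_function d_phi2 U (P4 i)"
  unfolding preserves_function_def
proof (intro allI impI ballI)
  fix J x s t assume x: "solution_on d_phi2 J x" "x ` J \<subseteq> U" "s \<in> J" "t \<in> J"
  have "((\<lambda>t. forget_phi2 (x t)) has_vector_derivative 0) (at u within J)" if "u \<in> J" for u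
  proof -
    have "(x has_vector_derivative d_phi2 (x u)) (at u within J)" using x(1) that by (simp add: solution_on_def)
    from bounded_linear.has_vector_derivative[OF bounded_linear_forget_phi2 this]
    show ?thesis by (simp add: d_phi2_def)
  qed
  moreover have "convex J" using x(1) by (simp add: solution_on_def is_interval_convex)
  ultimately have "forget_phi2 (x s) = forget_phi2 (x t)"
    using has_vector_derivative_zero_constant[of J "\<lambda>t. forget_phi2 (x t)"] x(3,4) by metis
  then show "P4 i (x s) = P4 i (x t)" by (simp add: P4_def)
qed

lemma full_jacobi_integrable: "jacobi_integrable (lift_field X) U"
  unfolding jacobi_integrable_def using P4_independent_first_integrals rho4_invariant by blast

lemma full_broadly_integrable: "broadly_integrable_with d_phi2 (lift_field X) U"
  unfolding broadly_integrable_with_def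
proof (intro conjI ballI allI impI)
  show "smooth_on U (lift_field X)"
    by (rule real_analytic_imp_smooth[OF U_open])
      (auto simp: Basis_vec_def inner_axis intro: lift_field_analytic[OF analytic])
  show "smooth_on U d_phi2"
    unfolding d_phi2_def[abs_def] by (rule real_analytic_imp_smooth[OF U_open]) (rule real_analytic_on_const)
  show "\<exists>f g. independent_first_integrals (lift_field X) U f g \<and> preserves_function d_phi2 U f \<and> preserves_function d_phi2 U g"
    using P4_independent_first_integrals d_phi2_preserves by blast
next
  fix p assume p: "p \<in> U"
  have d: "(lift_field X has_derivative frechet_derivative (lift_field X) (at p)) (at p)"
    by (rule real_analytic_vec_has_derivative[OF lift_field_analytic[OF analytic] p])
  have "frechet_derivative (lift_field X) (at p) (axis 2 1) = 0"
  proof (rule frechet_derivative_shift_invariant[OF d])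
    have a: "c *\<^sub>R axis 2 1 = (axis 2 c :: real^4)" for c by (simp add: vec_eq_iff axis_def)
    show "lift_field X (p + c *\<^sub>R axis 2 1) = lift_field X p + c *\<^sub>R 0" for c
      by (simp add: a lift_field_shift)
  qed
  then show "lie_bracket (lift_field X) d_phi2 p = 0"
    by (simp add: lie_bracket_def d_phi2_def[abs_def])
next
  fix p a b assume p: "p \<in> U" and 0: "a *\<^sub>R lift_field X p + b *\<^sub>R d_phi2 p = 0"
  have "forget_phi2 (a *\<^sub>R lift_field X p + b *\<^sub>R d_phi2 p) = a *\<^sub>R X (forget_phi2 p)"
    by (simp add: linear_add[OF linear_forget_phi2] linear_scale[OF linear_forget_phi2] forget_phi2_lift X1 d_phi2_def)
  then have "a *\<^sub>R X (forget_phi2 p) = 0" using 0 linear_0[OF linear_forget_phi2] by simp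
  then show a: "a = 0" using X_nonzero[of "forget_phi2 p"] p by (simp add: U_def)
  show "b = 0" using 0 a by (simp add: d_phi2_def)
qed

end

text \<open>Both local flows are supplied by \<open>analytic_flow\<close>, at the origin of the reduced and of the full phase
  space; both fields vanish there, because reversibility makes the plane \<open>\<phi>\<^sub>1 = 0\<close> a plane of zero
  acceleration.\<close>

theorem reversible_center_integrable:
  fixes X :: "real^3 \<Rightarrow> real^3"
  assumes analytic: "\<And>i. real_analytic_on UNIV (\<lambda>z. X z $ i)"
    and X1: "\<And>z. X z $ 1 = z $ 2"
    and odd: "\<And>z. X (mirror z) $ 2 = - X z $ 2" "\<And>z. X (mirror z) $ 3 = - X z $ 3"
    and \<kappa>: "\<kappa> > 0" and R0: "R0 > 0"
    and restoring: "\<And>z. norm z < R0 \<Longrightarrow> z $ 1 > 0 \<Longrightarrow> X z $ 2 \<le> - \<kappa>\<^sup>2 * z $ 1"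
  shows "\<exists>W. open W \<and> W \<noteq> {} \<and> flow_invariant X W \<and> filled_by_nonconstant_periodic X W \<and>
    (\<exists>f g. independent_first_integrals X W f g) \<and>
    jacobi_integrable (lift_field X) {x. forget_phi2 x \<in> W} \<and>
    broadly_integrable_with d_phi2 (lift_field X) {x. forget_phi2 x \<in> W}"
proof -
  have m0: "mirror 0 = 0" by (simp add: mirror_def vec_eq_iff forall_3)
  have X0: "X 0 = 0" using X1[of 0] odd[of 0, unfolded m0] by (simp add: vec_eq_iff forall_3)
  have ana: "real_analytic_on (ball 0 R0) (\<lambda>z. X z $ i)" for i by (rule real_analytic_on_subset[OF analytic]) simp
  obtain R L and \<Phi> :: "real \<Rightarrow> real^3 \<Rightarrow> real^3" where \<Phi>: "0 < R" "R < R0" "0 \<le> L" "\<And>p. \<Phi> 0 p = p"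
    "\<And>s t p. \<Phi> (s + t) p = \<Phi> s (\<Phi> t p)"
    "\<And>t p q. norm (\<Phi> t p - \<Phi> t q) \<le> exp (L * \<bar>t\<bar>) * norm (p - q)"
    "\<And>t. \<Phi> t 0 = 0" "\<And>p. continuous_on UNIV (\<lambda>t. \<Phi> t p)"
    "\<And>t p. \<Phi> t p \<in> cball 0 R \<Longrightarrow> ((\<lambda>t. \<Phi> t p) has_vector_derivative X (\<Phi> t p)) (at t)"
    "\<And>T. \<exists>r>0. \<forall>s\<in>{-T..T}. \<forall>i. real_analytic_on (ball 0 r) (\<lambda>p. \<Phi> s p $ i)"
    by (rule analytic_flow[OF ana X0 R0]) (rule that)
  obtain r3 where r3: "r3 > 0" "\<And>s i. s \<in> {-1..1} \<Longrightarrow> real_analytic_on (ball 0 r3) (\<lambda>p. \<Phi> s p $ i)"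
    using \<Phi>(10)[of 1] by blast
  have lift0: "lift_field X 0 = 0"
    unfolding lift_field_def linear_0[OF linear_forget_phi2] X0 by (simp add: vec_eq_iff forall_4)
  obtain R' L' and \<Gamma> :: "real \<Rightarrow> real^4 \<Rightarrow> real^4" where \<Gamma>: "0 < R'" "R' < 1" "0 \<le> L'" "\<And>p. \<Gamma> 0 p = p"
    "\<And>s t p. \<Gamma> (s + t) p = \<Gamma> s (\<Gamma> t p)"
    "\<And>t p q. norm (\<Gamma> t p - \<Gamma> t q) \<le> exp (L' * \<bar>t\<bar>) * norm (p - q)"
    "\<And>t. \<Gamma> t 0 = 0" "\<And>p. continuous_on UNIV (\<lambda>t. \<Gamma> t p)"
    "\<And>t p. \<Gamma> t p \<in> cball 0 R' \<Longrightarrow> ((\<lambda>t. \<Gamma> t p) has_vector_derivative lift_field X (\<Gamma> t p)) (at t)"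
    "\<And>T. \<exists>r>0. \<forall>s\<in>{-T..T}. \<forall>i. real_analytic_on (ball 0 r) (\<lambda>p. \<Gamma> s p $ i)"
    by (rule analytic_flow[OF lift_field_analytic[OF analytic] lift0 zero_less_one]) (rule that)
  obtain r4 where r4: "r4 > 0" "\<And>s i. s \<in> {-1..1} \<Longrightarrow> real_analytic_on (ball 0 r4) (\<lambda>p. \<Gamma> s p $ i)"
    using \<Gamma>(10)[of 1] by blast
  \<comment> \<open>The last entry keeps the full flow inside its ball for times up to one.\<close>
  define r0 where "r0 = min (min R r3) (min r4 (R' * exp (- L')))"
  have r0: "r0 > 0" "r0 \<le> R" "r0 \<le> r3" "r0 \<le> r4" "r0 \<le> R' * exp (- L')"
    using \<Phi>(1) r3(1) r4(1) \<Gamma>(1) by (auto simp: r0_def)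
  interpret reversible_center_full X \<kappa> R L r0 \<Phi> \<Gamma>
  proof
    show "X z $ 2 \<le> - \<kappa>\<^sup>2 * z $ 1" if "norm z < R" "z $ 1 > 0" for z
      using restoring[of z] that \<Phi>(2) by simp
    show "((\<lambda>t. \<Phi> t p) has_vector_derivative X (\<Phi> t p)) (at t)" if "norm (\<Phi> t p) \<le> R" for t p
      by (rule \<Phi>(9)) (use that in simp)
    show "real_analytic_on (ball 0 r0) (\<lambda>p. \<Phi> s p $ i)" if "s \<in> {-1..1}" for s i
      by (rule real_analytic_on_subset[OF r3(2)[OF that]]) (use r0(3) in auto)
    show "real_analytic_on (ball 0 r0) (\<lambda>p. \<Gamma> s p $ i)" if "s \<in> {-1..1}" for s i
      by (rule real_analytic_on_subset[OF r4(2)[OF that]]) (use r0(4) in auto)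
    show "((\<lambda>t. \<Gamma> t p) has_vector_derivative lift_field X (\<Gamma> s p)) (at s)"
      if p: "norm p < r0" and s: "\<bar>s\<bar> \<le> 1" for s p
    proof (rule \<Gamma>(9))
      have "norm (\<Gamma> s p) \<le> exp (L' * \<bar>s\<bar>) * norm p" using \<Gamma>(6)[of s p 0] \<Gamma>(7) by simp
      also have "\<dots> \<le> exp L' * (R' * exp (- L'))"
        using mult_left_mono[OF s \<Gamma>(3)] p r0(5) by (intro mult_mono) auto
      also have "\<dots> = R'" by (simp add: exp_minus)
      finally show "\<Gamma> s p \<in> cball 0 R'" by simp
    qed
  qed (use \<Phi> \<Gamma> r0 \<kappa> analytic X1 odd in auto)
  have "W \<noteq> {}" using S_nonempty S_W by blast
  then show ?thesis
    using W_open W_flow_invariant W_periodic P_independent_first_integrals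
      full_jacobi_integrable full_broadly_integrable unfolding U_def by blast
qed

section \<open>The Ziegler pendulum\<close>

lemma ziegler_full_lift:
  "ziegler_full m1 m2 m3 l1 l2 l3 k1 F = lift_field (ziegler_reduced m1 m2 m3 l1 l2 l3 k1 F)"
  by (simp add: fun_eq_iff ziegler_full_def lift_field_def Let_def)

text \<open>Writing \<open>s = m\<^sub>1 l\<^sub>1\<^sup>2 + m\<^sub>3 l\<^sub>3\<^sup>2\<close> and \<open>d = m\<^sub>1 l\<^sub>1 - m\<^sub>3 l\<^sub>3\<close>, the determinant is
  \<open>l\<^sub>2\<^sup>2 (s (m\<^sub>1 + m\<^sub>2 + m\<^sub>3) - d\<^sup>2 c\<^sup>2)\<close>, and \<open>s (m\<^sub>1 + m\<^sub>3) - d\<^sup>2 = m\<^sub>1 m\<^sub>3 (l\<^sub>1 + l\<^sub>3)\<^sup>2\<close>. The bound for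
  \<open>A\<^sub>2\<^sub>2\<close> comes from completing squares in the terms with \<open>m\<^sub>1\<close> and \<open>m\<^sub>3\<close>.\<close>

lemma ziegler_determinant:
  fixes m1 m2 m3 l1 l2 l3 c :: real
  assumes pos: "m1 > 0" "m2 > 0" "m3 > 0" "l1 > 0" "l2 > 0" "l3 > 0" and c: "\<bar>c\<bar> \<le> 1"
  defines "s \<equiv> m1 * l1^2 + m3 * l3^2" and "d \<equiv> m1 * l1 - m3 * l3"
  defines "\<Delta> \<equiv> s * ((m1 + m2 + m3) * l2^2 + m1 * l1^2 + m3 * l3^2 + 2 * d * l2 * c) - (s + d * l2 * c)^2"
  shows "0 < \<Delta>" "\<Delta> \<le> l2^2 * s * (m1 + m2 + m3)"
    "m2 * l2^2 \<le> (m1 + m2 + m3) * l2^2 + m1 * l1^2 + m3 * l3^2 + 2 * d * l2 * c"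
proof -
  have s: "s > 0" unfolding s_def using pos by (intro add_pos_pos mult_pos_pos zero_less_power) auto
  have \<Delta>: "\<Delta> = l2^2 * (s * (m1 + m2 + m3) - d^2 * c^2)"
    unfolding \<Delta>_def s_def d_def by (simp add: power2_eq_square algebra_simps)
  have c2: "c^2 \<le> 1" using c by (simp add: abs_square_le_1)
  have "d^2 * c^2 \<le> d^2 * 1" by (rule mult_left_mono[OF c2]) simp
  moreover have "s * (m1 + m3) - d^2 = m1 * m3 * (l1 + l3)^2"
    unfolding s_def d_def by (simp add: power2_eq_square algebra_simps)
  moreover have "m1 * m3 * (l1 + l3)^2 \<ge> 0" using pos by simp
  moreover have "s * (m1 + m2 + m3) = s * (m1 + m3) + s * m2" by (simp add: algebra_simps)
  moreover have "s * m2 > 0" using s pos by simp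
  ultimately have "s * (m1 + m2 + m3) - d^2 * c^2 > 0" by linarith
  then show "0 < \<Delta>" unfolding \<Delta> using pos by simp
  have "s * (m1 + m2 + m3) - d^2 * c^2 \<le> s * (m1 + m2 + m3)" by simp
  then have "l2^2 * (s * (m1 + m2 + m3) - d^2 * c^2) \<le> l2^2 * (s * (m1 + m2 + m3))" by (rule mult_left_mono) simp
  then show "\<Delta> \<le> l2^2 * s * (m1 + m2 + m3)" unfolding \<Delta> by (simp add: mult.assoc)
  have "l1^2 + 2 * l1 * l2 * c + l2^2 = (l1 + l2 * c)^2 + l2^2 * (1 - c^2)"
    "l3^2 - 2 * l3 * l2 * c + l2^2 = (l3 - l2 * c)^2 + l2^2 * (1 - c^2)"
    by (simp_all add: power2_eq_square algebra_simps)
  then have "l1^2 + 2 * l1 * l2 * c + l2^2 \<ge> 0" "l3^2 - 2 * l3 * l2 * c + l2^2 \<ge> 0"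
    using c2 by simp_all
  then have "m1 * (l1^2 + 2 * l1 * l2 * c + l2^2) + m3 * (l3^2 - 2 * l3 * l2 * c + l2^2) \<ge> 0"
    using pos by simp
  then show "m2 * l2^2 \<le> (m1 + m2 + m3) * l2^2 + m1 * l1^2 + m3 * l3^2 + 2 * d * l2 * c"
    unfolding d_def by (simp add: algebra_simps)
qed

text \<open>With \<open>S = sin \<phi>\<close> between 0 and \<open>\<phi>\<close>, all terms are at most a multiple of \<open>\<phi>\<close>. The spring contributes
  \<open>- \<alpha> k\<^sub>1 \<phi>\<close>; the inertial terms, quadratic in the velocities, use up a quarter of it by the choice of
  the radius \<open>R0\<close>, and the follower force another quarter by the bound on \<open>F\<close>.\<close>

lemma restoring_estimate:
  fixes A12 A22 a \<alpha> k1 F l2 d \<phi> S v1 v2 R0 :: real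
  assumes A: "\<alpha> \<le> A22" "\<bar>A12\<bar> \<le> a" and pos: "\<alpha> > 0" "a > 0" "k1 > 0" "l2 > 0"
    and R0: "0 < R0" "R0 \<le> 1" "(\<bar>d\<bar> * l2 + 3 * a * l2 * \<bar>d\<bar> / \<alpha>) * R0 \<le> k1 / 4"
    and F: "a * l2 * \<bar>F\<bar> \<le> \<alpha> * k1 / 4"
    and z: "\<bar>v1\<bar> \<le> R0" "\<bar>v2\<bar> \<le> R0" "0 \<le> S" "S \<le> \<phi>"
  shows "A22 * (- k1 * \<phi> - d * l2 * v2^2 * S) - A12 * (- F * l2 * S + d * l2 * v1 * (v1 + 2 * v2) * S)
     \<le> - (\<alpha> * k1 / 2) * \<phi>"
proof -
  have \<phi>: "\<phi> \<ge> 0" using z by linarith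
  have R2: "R0 * R0 \<le> R0" using R0 by (simp add: mult_left_le)
  have v2: "v2^2 \<le> R0"
  proof -
    have "\<bar>v2\<bar> * \<bar>v2\<bar> \<le> R0 * R0" using z(2) by (intro mult_mono) auto
    then show ?thesis using R2 by (simp add: power2_eq_square)
  qed
  have v1: "\<bar>v1 * (v1 + 2 * v2)\<bar> \<le> 3 * R0"
  proof -
    have "\<bar>v1\<bar> * \<bar>v1 + 2 * v2\<bar> \<le> R0 * (3 * R0)" using z(1,2) by (intro mult_mono) auto
    then show ?thesis using R2 by (simp add: abs_mult)
  qed
  define D where "D = \<bar>d\<bar> * l2"
  have D: "D \<ge> 0" using pos by (simp add: D_def)
  have 1: "- (d * l2 * v2^2 * S) \<le> D * R0 * \<phi>"
  proof -
    have "\<bar>d * l2 * v2^2 * S\<bar> = D * v2^2 * S" using z(3) pos by (simp add: D_def abs_mult)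
    also have "\<dots> \<le> D * R0 * \<phi>" using v2 z D R0 by (intro mult_mono) auto
    finally show ?thesis by linarith
  qed
  have DR: "D * R0 \<le> k1 / 4"
  proof -
    have "3 * a * l2 * \<bar>d\<bar> / \<alpha> * R0 \<ge> 0" using pos R0 by simp
    moreover have "(\<bar>d\<bar> * l2 + 3 * a * l2 * \<bar>d\<bar> / \<alpha>) * R0 = D * R0 + 3 * a * l2 * \<bar>d\<bar> / \<alpha> * R0"
      by (simp only: D_def distrib_right)
    ultimately show ?thesis using R0(3) by linarith
  qed
  have "A22 * (- k1 * \<phi> - d * l2 * v2^2 * S) \<le> A22 * ((- k1 + D * R0) * \<phi>)"
    using 1 A(1) pos by (intro mult_left_mono) (auto simp: algebra_simps)
  also have "\<dots> \<le> \<alpha> * ((- k1 + D * R0) * \<phi>)"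
    using A(1) DR pos \<phi> by (intro mult_right_mono_neg mult_nonpos_nonneg) auto
  finally have I: "A22 * (- k1 * \<phi> - d * l2 * v2^2 * S) \<le> \<alpha> * ((- k1 + D * R0) * \<phi>)" .
  have "\<bar>- F * l2 * S + d * l2 * v1 * (v1 + 2 * v2) * S\<bar> \<le> \<bar>F\<bar> * l2 * S + D * \<bar>v1 * (v1 + 2 * v2)\<bar> * S"
    using abs_triangle_ineq[of "- F * l2 * S" "d * l2 * v1 * (v1 + 2 * v2) * S"] z(3) pos
    by (simp add: abs_mult D_def mult.assoc)
  also have "\<dots> \<le> \<bar>F\<bar> * l2 * \<phi> + D * (3 * R0) * \<phi>"
    using v1 z D pos R0 by (intro add_mono mult_mono) auto
  finally have r2: "\<bar>- F * l2 * S + d * l2 * v1 * (v1 + 2 * v2) * S\<bar> \<le> \<bar>F\<bar> * l2 * \<phi> + D * (3 * R0) * \<phi>" .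
  have "\<bar>A12 * (- F * l2 * S + d * l2 * v1 * (v1 + 2 * v2) * S)\<bar> \<le> a * (\<bar>F\<bar> * l2 * \<phi> + D * (3 * R0) * \<phi>)"
    unfolding abs_mult by (rule mult_mono[OF A(2) r2]) (use pos in auto)
  also have "\<dots> = a * l2 * \<bar>F\<bar> * \<phi> + \<alpha> * (3 * a * l2 * \<bar>d\<bar> / \<alpha> * R0) * \<phi>"
    using pos by (simp add: D_def field_simps)
  also have "\<dots> \<le> \<alpha> * k1 / 4 * \<phi> + \<alpha> * (3 * a * l2 * \<bar>d\<bar> / \<alpha> * R0) * \<phi>"
    using F \<phi> by (intro add_right_mono mult_right_mono)
  finally have II: "- (A12 * (- F * l2 * S + d * l2 * v1 * (v1 + 2 * v2) * S))
      \<le> \<alpha> * k1 / 4 * \<phi> + \<alpha> * (3 * a * l2 * \<bar>d\<bar> / \<alpha> * R0) * \<phi>" by linarith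
  have "\<alpha> * ((\<bar>d\<bar> * l2 + 3 * a * l2 * \<bar>d\<bar> / \<alpha>) * R0) * \<phi> \<le> \<alpha> * (k1 / 4) * \<phi>"
    using R0(3) pos \<phi> by (intro mult_right_mono mult_left_mono) auto
  moreover have "\<alpha> * ((\<bar>d\<bar> * l2 + 3 * a * l2 * \<bar>d\<bar> / \<alpha>) * R0) * \<phi>
      = \<alpha> * (D * R0) * \<phi> + \<alpha> * (3 * a * l2 * \<bar>d\<bar> / \<alpha> * R0) * \<phi>"
    by (simp only: D_def distrib_right distrib_left)
  moreover have "\<alpha> * ((- k1 + D * R0) * \<phi>) = - (\<alpha> * k1 * \<phi>) + \<alpha> * (D * R0) * \<phi>" by (simp add: algebra_simps)
  moreover have "\<alpha> * (k1 / 4) * \<phi> = \<alpha> * k1 * \<phi> / 4" "\<alpha> * k1 / 4 * \<phi> = \<alpha> * k1 * \<phi> / 4"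
    "- (\<alpha> * k1 / 2) * \<phi> = - (\<alpha> * k1 * \<phi>) / 2" by simp_all
  ultimately show ?thesis using I II by linarith
qed

lemma ziegler_analytic:
  fixes m1 m2 m3 l1 l2 l3 :: real
  assumes pos: "m1 > 0" "m2 > 0" "m3 > 0" "l1 > 0" "l2 > 0" "l3 > 0"
  shows "real_analytic_on UNIV (\<lambda>z. ziegler_reduced m1 m2 m3 l1 l2 l3 k1 F z $ i)"
proof -
  have nz: "(m1 * l1^2 + m3 * l3^2) * ((m1 + m2 + m3) * l2^2 + m1 * l1^2 + m3 * l3^2
        + 2 * (m1 * l1 - m3 * l3) * l2 * cos (z $ 1)) -
      (m1 * l1^2 + m3 * l3^2 + (m1 * l1 - m3 * l3) * l2 * cos (z $ 1))^2 \<noteq> 0" for z :: "real^3"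
    using ziegler_determinant(1)[OF pos, of "cos (z $ 1)"] by simp
  consider "i = 1" | "i = 2" | "i = 3" using exhaust_3 by blast
  then show ?thesis
  proof cases
    case 1 then show ?thesis by (simp add: ziegler_reduced_def Let_def real_analytic_on_nth)
  next
    case 2
    show ?thesis
      unfolding 2 ziegler_reduced_def Let_def vector_3
      by (rule real_analytic_on_divide[OF _ _ nz])
        (intro real_analytic_on_add real_analytic_on_diff real_analytic_on_mult real_analytic_on_power
          real_analytic_on_sin real_analytic_on_cos real_analytic_on_nth real_analytic_on_const)+
  next
    case 3
    show ?thesis
      unfolding 3 ziegler_reduced_def Let_def vector_3
      by (rule real_analytic_on_divide[OF _ _ nz])
        (intro real_analytic_on_add real_analytic_on_diff real_analytic_on_mult real_analytic_on_power
          real_analytic_on_sin real_analytic_on_cos real_analytic_on_nth real_analytic_on_const)+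
  qed
qed

text \<open>\<open>A\<^sub>1\<^sub>1\<close>, \<open>A\<^sub>1\<^sub>2\<close> and \<open>A\<^sub>2\<^sub>2\<close> are even in \<open>\<phi>\<^sub>1\<close>, while \<open>r\<^sub>1\<close> and \<open>r\<^sub>2\<close> are odd.\<close>

lemma ziegler_odd:
  "ziegler_reduced m1 m2 m3 l1 l2 l3 k1 F (mirror z) $ 2 = - ziegler_reduced m1 m2 m3 l1 l2 l3 k1 F z $ 2"
  "ziegler_reduced m1 m2 m3 l1 l2 l3 k1 F (mirror z) $ 3 = - ziegler_reduced m1 m2 m3 l1 l2 l3 k1 F z $ 3"
proof -
  have odd: "(A * (- k1 * - x - B * - S) - C * (- F * l2 * - S + E * - S)) / D
      = - ((A * (- k1 * x - B * S) - C * (- F * l2 * S + E * S)) / D)"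
    "(A * (- F * l2 * - S + E * - S) - C * (- k1 * - x - B * - S)) / D
      = - ((A * (- F * l2 * S + E * S) - C * (- k1 * x - B * S)) / D)"
    for A B C D E S x :: real
    by (simp_all add: minus_divide_left algebra_simps)
  show "ziegler_reduced m1 m2 m3 l1 l2 l3 k1 F (mirror z) $ 2 = - ziegler_reduced m1 m2 m3 l1 l2 l3 k1 F z $ 2"
    unfolding ziegler_reduced_def Let_def mirror_def vector_3 cos_minus sin_minus by (rule odd(1))
  show "ziegler_reduced m1 m2 m3 l1 l2 l3 k1 F (mirror z) $ 3 = - ziegler_reduced m1 m2 m3 l1 l2 l3 k1 F z $ 3"
    unfolding ziegler_reduced_def Let_def mirror_def vector_3 cos_minus sin_minus by (rule odd(2))
qed

theorem proposition12:
  fixes m1 m2 m3 l1 l2 l3 :: real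
  assumes "m1 > 0" "m2 > 0" "m3 > 0" "l1 > 0" "l2 > 0" "l3 > 0"
  shows "\<exists>K1::real. \<forall>k1>K1. \<exists>\<epsilon>>0. \<forall>F::real. \<bar>F\<bar> < \<epsilon> \<longrightarrow>
    (\<exists>W :: (real^3) set.
       open W \<and> W \<noteq> {} \<and>
       flow_invariant (ziegler_reduced m1 m2 m3 l1 l2 l3 k1 F) W \<and>
       filled_by_nonconstant_periodic (ziegler_reduced m1 m2 m3 l1 l2 l3 k1 F) W \<and>
       (\<exists>f g. independent_first_integrals (ziegler_reduced m1 m2 m3 l1 l2 l3 k1 F) W f g) \<and>
       jacobi_integrable (ziegler_full m1 m2 m3 l1 l2 l3 k1 F) {x. forget_phi2 x \<in> W} \<and>
       broadly_integrable_with d_phi2 (ziegler_full m1 m2 m3 l1 l2 l3 k1 F)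
         {x. forget_phi2 x \<in> W})"
proof (rule exI[of _ 0], intro allI impI)
  \<comment> \<open>Near the origin any positive stiffness dominates a sufficiently weak follower force, so the threshold
  can be 0.\<close>
  note pos = assms
  fix k1 :: real assume k1: "k1 > 0"
  define s where "s = m1 * l1^2 + m3 * l3^2"
  define d where "d = m1 * l1 - m3 * l3"
  define a where "a = s + \<bar>d\<bar> * l2"
  define \<alpha> where "\<alpha> = m2 * l2^2"
  define \<Delta> where "\<Delta> = l2^2 * s * (m1 + m2 + m3)"
  define \<epsilon> where "\<epsilon> = \<alpha> * k1 / (4 * a * l2)"
  have s: "s > 0" unfolding s_def using pos by (intro add_pos_pos mult_pos_pos zero_less_power) auto
  have a: "a > 0" unfolding a_def using s pos by (intro add_pos_nonneg) auto
  have \<alpha>: "\<alpha> > 0" unfolding \<alpha>_def using pos by simp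
  have \<Delta>: "\<Delta> > 0" unfolding \<Delta>_def using pos s by simp
  have \<epsilon>: "\<epsilon> > 0" unfolding \<epsilon>_def using \<alpha> a k1 pos by simp
  define q where "q = \<bar>d\<bar> * l2 + 3 * a * l2 * \<bar>d\<bar> / \<alpha>"
  have q: "q \<ge> 0" unfolding q_def using a \<alpha> pos by simp
  \<comment> \<open>The radius is at most 1 so that sines of angles below it are positive and \<open>R0\<^sup>2 \<le> R0\<close>.\<close>
  define R0 where "R0 = min 1 (k1 / (4 * (q + 1)))"
  have R0: "0 < R0" "R0 \<le> 1" using k1 q by (auto simp: R0_def)
  have qR0: "q * R0 \<le> k1 / 4"
  proof -
    have "q * R0 \<le> (q + 1) * (k1 / (4 * (q + 1)))" using q R0 by (intro mult_mono) (auto simp: R0_def)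
    also have "\<dots> = k1 / 4" using q by (simp add: field_simps)
    finally show ?thesis .
  qed
  define \<kappa> where "\<kappa> = sqrt (\<alpha> * k1 / 2 / \<Delta>)"
  have \<kappa>: "\<kappa> > 0" "\<kappa>\<^sup>2 = \<alpha> * k1 / 2 / \<Delta>" using \<alpha> k1 \<Delta> by (auto simp: \<kappa>_def)
  show "\<exists>\<epsilon>>0. \<forall>F::real. \<bar>F\<bar> < \<epsilon> \<longrightarrow>
    (\<exists>W :: (real^3) set.
       open W \<and> W \<noteq> {} \<and>
       flow_invariant (ziegler_reduced m1 m2 m3 l1 l2 l3 k1 F) W \<and>
       filled_by_nonconstant_periodic (ziegler_reduced m1 m2 m3 l1 l2 l3 k1 F) W \<and>
       (\<exists>f g. independent_first_integrals (ziegler_reduced m1 m2 m3 l1 l2 l3 k1 F) W f g) \<and>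
       jacobi_integrable (ziegler_full m1 m2 m3 l1 l2 l3 k1 F) {x. forget_phi2 x \<in> W} \<and>
       broadly_integrable_with d_phi2 (ziegler_full m1 m2 m3 l1 l2 l3 k1 F)
         {x. forget_phi2 x \<in> W})"
  proof (intro exI[of _ \<epsilon>] conjI \<epsilon> allI impI)
    fix F :: real assume F: "\<bar>F\<bar> < \<epsilon>"
    let ?X = "ziegler_reduced m1 m2 m3 l1 l2 l3 k1 F"
    have aF: "a * l2 * \<bar>F\<bar> \<le> \<alpha> * k1 / 4"
    proof -
      have "a * l2 * \<bar>F\<bar> \<le> a * l2 * \<epsilon>" using F a pos by (intro mult_left_mono) auto
      also have "\<dots> = \<alpha> * k1 / 4" using a pos by (simp add: \<epsilon>_def)
      finally show ?thesis .
    qed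
    show "\<exists>W. open W \<and> W \<noteq> {} \<and> flow_invariant ?X W \<and> filled_by_nonconstant_periodic ?X W \<and>
      (\<exists>f g. independent_first_integrals ?X W f g) \<and>
      jacobi_integrable (ziegler_full m1 m2 m3 l1 l2 l3 k1 F) {x. forget_phi2 x \<in> W} \<and>
      broadly_integrable_with d_phi2 (ziegler_full m1 m2 m3 l1 l2 l3 k1 F) {x. forget_phi2 x \<in> W}"
      unfolding ziegler_full_lift
    proof (rule reversible_center_integrable[OF ziegler_analytic[OF pos] _ _ _ \<kappa>(1) R0(1)])
      show "?X z $ 1 = z $ 2" for z by (simp add: ziegler_reduced_def Let_def)
      show "?X (mirror z) $ 2 = - ?X z $ 2" "?X (mirror z) $ 3 = - ?X z $ 3" for z
        by (rule ziegler_odd)+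
      fix z :: "real^3" assume z: "norm z < R0" "z $ 1 > 0"
      define c where "c = cos (z $ 1)"
      define A12 where "A12 = s + d * l2 * c"
      define A22 where "A22 = (m1 + m2 + m3) * l2^2 + m1 * l1^2 + m3 * l3^2 + 2 * d * l2 * c"
      define N where "N = A22 * (- k1 * z $ 1 - d * l2 * (z $ 3)^2 * sin (z $ 1)) -
          A12 * (- F * l2 * sin (z $ 1) + d * l2 * z $ 2 * (z $ 2 + 2 * z $ 3) * sin (z $ 1))"
      have X2: "?X z $ 2 = N / (s * A22 - A12^2)"
        by (simp add: ziegler_reduced_def Let_def N_def A12_def A22_def c_def s_def d_def)
      have c: "\<bar>c\<bar> \<le> 1" by (simp add: c_def)
      have det: "0 < s * A22 - A12^2" "s * A22 - A12^2 \<le> \<Delta>" "\<alpha> \<le> A22"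
        using ziegler_determinant[OF pos c] by (simp_all only: s_def d_def A22_def A12_def \<alpha>_def \<Delta>_def)
      have zi: "\<bar>z $ i\<bar> \<le> R0" for i using component_le_norm_cart[of z i] z(1) by linarith
      have z1: "z $ 1 \<le> 1" using zi[of 1] R0(2) by linarith
      have "N \<le> - (\<alpha> * k1 / 2) * z $ 1"
        unfolding N_def
      proof (rule restoring_estimate[of \<alpha> A22 A12 a k1 l2 R0 d F "z $ 2" "z $ 3" "sin (z $ 1)" "z $ 1",
            OF det(3) _ \<alpha> a k1 pos(5) R0 _ aF zi zi])
        have "\<bar>d * l2 * c\<bar> \<le> \<bar>d\<bar> * l2 * 1" unfolding abs_mult using c pos by (intro mult_mono) auto
        then show "\<bar>A12\<bar> \<le> a" using s unfolding A12_def a_def by linarith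
        show "(\<bar>d\<bar> * l2 + 3 * a * l2 * \<bar>d\<bar> / \<alpha>) * R0 \<le> k1 / 4" using qR0 by (simp add: q_def)
        show "0 \<le> sin (z $ 1)" using z(2) z1 pi_gt3 by (intro sin_ge_zero) auto
        show "sin (z $ 1) \<le> z $ 1" using z(2) by (intro sin_x_le_x) auto
      qed
      then have "N / (s * A22 - A12^2) \<le> - (\<alpha> * k1 / 2) * z $ 1 / (s * A22 - A12^2)"
        using det(1) by (intro divide_right_mono) auto
      also have "\<dots> \<le> - (\<alpha> * k1 / 2) * z $ 1 / \<Delta>"
        using det(1,2) \<alpha> k1 z(2) by (intro divide_left_mono_neg) (auto intro: mult_nonpos_nonneg)
      also have "\<dots> = - \<kappa>\<^sup>2 * z $ 1" by (simp add: \<kappa>(2))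
      finally show "?X z $ 2 \<le> - \<kappa>\<^sup>2 * z $ 1" by (simp add: X2)
    qed
  qed
qed

end
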